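(* Let $\pi_0$ be a unitary representation of $G$ satisfying the technical condition (TC) with auxiliary data $\pi,H,L,P_L,P_0$, and let $\overline{\pi_0}^{\rm p}$ be the associated unitary representation. For $\sigma\in G$, $\Gamma_0\in\mathcal S$ and right coset representatives $\Gamma=\bigsqcup_i\Gamma_0s_i$, the trace of the Hecke operator is given by $${\rm Tr}\Big([\Gamma_0:(\Gamma_0)_\sigma]\,P_{H_0^{\Gamma_0}}\overline{\pi_0}^{\rm p}(\sigma)P_{H_0^{\Gamma_0}}\Big)=\sum_{i}\ \sum_{\theta\in s_i^{-1}\Gamma_0\sigma\Gamma_0s_i}{\rm Tr}(P_L\pi_0(\theta)P_L).$$
   Context: Setting. $G$ is a countable discrete group and $\Gamma\subseteq G$ is an almost normal subgroup: for every $\sigma\in G$ the group $\Gamma_\sigma=\Gamma\cap\sigma\Gamma\sigma^{-1}$ has finite index in $\Gamma$. It is assumed that $[\Gamma:\Gamma_\sigma]=[\Gamma:\Gamma_{\sigma^{-1}}]$ for all $\sigma\in G$. $\mathcal S$ is the smallest family of finite index subgroups of $\Gamma$ containing $\Gamma$ and closed under finite intersections and under the operations $\Gamma_0\mapsto(\Gamma_0)_\sigma=\Gamma_0\cap\sigma\Gamma_0\sigma^{-1}$, $\sigma\in G$; the intersection of all groups in $\mathcal S$ is assumed trivial. Technical condition (TC) on a unitary representation $\pi_0$ of $G$ on $H_0$: $\pi_0|_\Gamma$ is a (not necessarily integer) multiple of the left regular representation $\lambda_\Gamma$, and there is a unitary representation $\pi$ of $G$ on a Hilbert space $H\supseteq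 H_0$ such that: (i) $\pi|_\Gamma$ is an integer (possibly infinite) multiple of $\lambda_\Gamma$, so there is a closed subspace $L\subseteq H$ with $H\cong\ell^2(\Gamma)\otimes L$, $\pi|_\Gamma\cong\lambda_\Gamma\otimes{\rm Id}_L$, $L\cong\mathbb C e\otimes L$; (ii) with $P_L$ the orthogonal projection of $H$ onto $L$, the projections $\pi(g)P_L\pi(g^{-1})$, $g\in G$, commute; (iii) $H_0$ is $\pi(G)$-invariant and $\pi_0=\pi|_{H_0}$; with $P_0$ the orthogonal projection of $H$ onto $H_0$, $\pi_0(g)$ also denotes $P_0\pi(g)P_0$; (iv) $P_0P_L$ is trace class; (v) for all $g\in G$, $\Gamma_0\in\mathcal S$ the sum $\sum_{\theta\in\Gamma_0 g}P_L\pi_0(\theta)P_L$ converges in the Hilbert–Schmidt operators on $L$; (vi) the sum of the traces of the terms of this sum is absolutely convergent, the sum is trace class and its trace is the sum of the traces of its terms; (vii) the Murray–von Neumann dimension $\dim_{\{\pi_0(\Gamma)\}''}H_0$ is finite and strictly positive. Virtual invariant vectors. For $\Gamma_0\in\mathcal S$ with $\Gamma=\bigsqcup_i\Gamma_0 s_i$ put $L^{\Gamma_0}=\bigoplus_i\pi(s_i)L\subseteq H$, with orthogonal projection $P_{L^{\Gamma_0}}$. Let $\mathcal D_{L,\pi}=\{h\in H:\sum_{\gamma\in\Gamma_0}P_L\pi(\gamma)h\text{ converges for all }\Gamma_0\in\mathcal S\}$. $H_0^{\Gamma_0}$ is the space of formal sums $\sum_{\gamma\in\Gamma_0}\pi_0(\gamma)h$,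 $h\in\mathcal D_{L,\pi}$, where such a sum is identified with $\sum_{\gamma\in\Gamma_0}\pi_0(\gamma)l_0$, $l_0=\sum_{\gamma\in\Gamma_0}P_{L^{\Gamma_0}}\pi_0(\gamma)h\in L^{\Gamma_0}$; its scalar product is $$\Big\langle\sum_{\gamma\in\Gamma_0}\pi_0(\gamma)h_1,\sum_{\gamma'\in\Gamma_0}\pi_0(\gamma')h_2\Big\rangle_\infty=\frac1{[\Gamma:\Gamma_0]}\Big\langle\sum_{\gamma\in\Gamma_0}P_{L^{\Gamma_0}}\pi_0(\gamma)h_1,\sum_{\gamma'\in\Gamma_0}P_{L^{\Gamma_0}}\pi_0(\gamma')h_2\Big\rangle_H.$$ For $\Gamma_1\subseteq\Gamma_0$ in $\mathcal S$, $\Gamma_0=\bigsqcup_j\Gamma_1r_j$, $H_0^{\Gamma_0}\subseteq H_0^{\Gamma_1}$ isometrically via $\sum_{\gamma\in\Gamma_0}\pi_0(\gamma)h=\sum_{\gamma\in\Gamma_1}\pi_0(\gamma)\big(\sum_j\pi(r_j)h\big)$. $\overline H_0^{\rm p}$ is the Hilbert completion of $\bigvee_{\Gamma_0\in\mathcal S}H_0^{\Gamma_0}$, and $P_{H_0^{\Gamma_0}}$ is the orthogonal projection onto $H_0^{\Gamma_0}$. $\overline{\pi_0}^{\rm p}$ is the unitary representation of $G$ on $\overline H_0^{\rm p}$ determined as follows: given $g\in G$ and a vector in $H_0^{\Gamma_0}$, write it as an element $\sum_{\gamma\in\Gamma_1}\pi_0(\gamma)h$ of $H_0^{\Gamma_1}$,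 $\Gamma_1=(\Gamma_0)_{g^{-1}}$; then $\overline{\pi_0}^{\rm p}(g)$ maps it to $\sum_{\gamma\in g\Gamma_1g^{-1}}\pi_0(\gamma)\pi(g)h$ (note $g\Gamma_1g^{-1}=(\Gamma_0)_g\in\mathcal S$). *)

theory Defs
  imports "HOL-Analysis.Analysis" "HOL-Algebra.Coset"
begin

section \<open>Complex Hilbert spaces\<close>

class complex_inner = real_normed_vector +
  fixes scaleC :: "complex \<Rightarrow> 'a \<Rightarrow> 'a" (infixr "*\<^sub>C" 75)
    and cinner :: "'a \<Rightarrow> 'a \<Rightarrow> complex"
  assumes scaleC_add_right: "c *\<^sub>C (x + y) = c *\<^sub>C x + c *\<^sub>C y"
    and scaleC_add_left: "(c + d) *\<^sub>C x = c *\<^sub>C x + d *\<^sub>C x"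
    and scaleC_scaleC: "c *\<^sub>C d *\<^sub>C x = (c * d) *\<^sub>C x"
    and scaleR_scaleC: "r *\<^sub>R x = complex_of_real r *\<^sub>C x"
    and cinner_commute: "cinner x y = cnj (cinner y x)"
    and cinner_add_left: "cinner (x + y) z = cinner x z + cinner y z"
    and cinner_scaleC_left: "cinner (c *\<^sub>C x) y = c * cinner x y"
    and norm_cinner: "cinner x x = complex_of_real ((norm x)\<^sup>2)"

class chilbert_space = complex_inner + complete_space

instantiation complex :: chilbert_space
begin

definition scaleC_complex :: "complex \<Rightarrow> complex \<Rightarrow> complex"
  where "scaleC_complex c x = c * x"

definition cinner_complex :: "complex \<Rightarrow> complex \<Rightarrow> complex"
  where "cinner_complex x y = x * cnj y"

instance
  by standard
    (auto simp: scaleC_complex_def cinner_complex_def algebra_simps scaleR_conv_of_real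
       complex_norm_square simp flip: of_real_power)

end

definition closed_csubspace :: "'h::chilbert_space set \<Rightarrow> bool"
  where "closed_csubspace W \<longleftrightarrow> closed W \<and> 0 \<in> W \<and> (\<forall>x\<in>W. \<forall>y\<in>W. x + y \<in> W)
    \<and> (\<forall>c. \<forall>x\<in>W. c *\<^sub>C x \<in> W)"

definition clinear_on :: "'h::chilbert_space set \<Rightarrow> ('h \<Rightarrow> 'k::chilbert_space) \<Rightarrow> bool"
  where "clinear_on W T \<longleftrightarrow> (\<forall>x\<in>W. \<forall>y\<in>W. T (x + y) = T x + T y)
    \<and> (\<forall>c. \<forall>x\<in>W. T (c *\<^sub>C x) = c *\<^sub>C T x)"

definition bounded_clinear :: "('h::chilbert_space \<Rightarrow> 'h) \<Rightarrow> bool"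
  where "bounded_clinear T \<longleftrightarrow> bounded_linear T \<and> clinear_on UNIV T"

definition orth_proj :: "'h::chilbert_space set \<Rightarrow> 'h \<Rightarrow> 'h"
  where "orth_proj W x = (THE y. y \<in> W \<and> (\<forall>z\<in>W. cinner (x - y) z = 0))"

definition onb_of :: "'h::chilbert_space set \<Rightarrow> 'h set \<Rightarrow> bool"
  where "onb_of W B \<longleftrightarrow> B \<subseteq> W \<and> (\<forall>e\<in>B. norm e = 1)
    \<and> (\<forall>e\<in>B. \<forall>f\<in>B. e \<noteq> f \<longrightarrow> cinner e f = 0)
    \<and> (\<forall>x\<in>W. (\<forall>e\<in>B. cinner x e = 0) \<longrightarrow> x = 0)"

definition some_onb :: "'h::chilbert_space set"
  where "some_onb = (SOME B. onb_of UNIV B)"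

text \<open>The quantities below do not depend on the orthonormal basis.\<close>

definition hilbert_schmidt :: "('h::chilbert_space \<Rightarrow> 'h) \<Rightarrow> bool"
  where "hilbert_schmidt T \<longleftrightarrow> bounded_clinear T \<and> (\<lambda>e. (norm (T e))\<^sup>2) summable_on some_onb"

definition hs_norm :: "('h::chilbert_space \<Rightarrow> 'h) \<Rightarrow> real"
  where "hs_norm T = sqrt (\<Sum>\<^sub>\<infinity>e\<in>some_onb. (norm (T e))\<^sup>2)"

text \<open>The trace class is the set of products of two Hilbert--Schmidt operators.\<close>

definition trace_class :: "('h::chilbert_space \<Rightarrow> 'h) \<Rightarrow> bool"
  where "trace_class T \<longleftrightarrow> (\<exists>A B. hilbert_schmidt A \<and> hilbert_schmidt B \<and> T = A \<circ> B)"

definition ctrace :: "('h::chilbert_space \<Rightarrow> 'h) \<Rightarrow> complex"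
  where "ctrace T = (\<Sum>\<^sub>\<infinity>e\<in>some_onb. cinner (T e) e)"

text \<open>Unconditional convergence of a family of operators in the Hilbert--Schmidt norm.\<close>

definition hs_has_sum ::
    "('i \<Rightarrow> 'h::chilbert_space \<Rightarrow> 'h) \<Rightarrow> 'i set \<Rightarrow> ('h \<Rightarrow> 'h) \<Rightarrow> bool"
  where "hs_has_sum f A T \<longleftrightarrow> hilbert_schmidt T \<and> (\<forall>i\<in>A. hilbert_schmidt (f i))
    \<and> ((\<lambda>F. hs_norm (\<lambda>x. T x - (\<Sum>i\<in>F. f i x))) \<longlongrightarrow> 0) (finite_subsets_at_top A)"


section \<open>Almost normal subgroups\<close>

definition conj_set :: "('g, 'b) monoid_scheme \<Rightarrow> 'g \<Rightarrow> 'g set \<Rightarrow> 'g set"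
  where "conj_set G g A = (g <#\<^bsub>G\<^esub> A) #>\<^bsub>G\<^esub> inv\<^bsub>G\<^esub> g"

definition conj_inter :: "('g, 'b) monoid_scheme \<Rightarrow> 'g set \<Rightarrow> 'g \<Rightarrow> 'g set"
  where "conj_inter G A g = A \<inter> conj_set G g A"

definition cosets_in :: "('g, 'b) monoid_scheme \<Rightarrow> 'g set \<Rightarrow> 'g set \<Rightarrow> 'g set set"
  where "cosets_in G A B = rcosets\<^bsub>G\<lparr>carrier := A\<rparr>\<^esub> B"

definition index_in :: "('g, 'b) monoid_scheme \<Rightarrow> 'g set \<Rightarrow> 'g set \<Rightarrow> nat"
  where "index_in G A B = card (cosets_in G A B)"

definition double_coset :: "('g, 'b) monoid_scheme \<Rightarrow> 'g set \<Rightarrow> 'g \<Rightarrow> 'g set"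
  where "double_coset G A g = (A #>\<^bsub>G\<^esub> g) <#>\<^bsub>G\<^esub> A"

text \<open>\<open>A\<close> is the disjoint union of the right cosets \<open>B r\<close>, with \<open>r\<close> ranging over \<open>R\<close>.\<close>

definition right_transversal ::
    "('g, 'b) monoid_scheme \<Rightarrow> 'g set \<Rightarrow> 'g set \<Rightarrow> 'g set \<Rightarrow> bool"
  where "right_transversal G A B R \<longleftrightarrow> R \<subseteq> A \<and> (\<forall>a\<in>A. \<exists>!r. r \<in> R \<and> a \<in> B #>\<^bsub>G\<^esub> r)"

inductive_set level_family :: "('g, 'b) monoid_scheme \<Rightarrow> 'g set \<Rightarrow> 'g set set"
  for G :: "('g, 'b) monoid_scheme" and \<Gamma> :: "'g set" where
  base: "\<Gamma> \<in> level_family G \<Gamma>"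
| inter: "A \<in> level_family G \<Gamma> \<Longrightarrow> B \<in> level_family G \<Gamma> \<Longrightarrow> A \<inter> B \<in> level_family G \<Gamma>"
| conj: "A \<in> level_family G \<Gamma> \<Longrightarrow> g \<in> carrier G \<Longrightarrow> conj_inter G A g \<in> level_family G \<Gamma>"

locale almost_normal_pair = group G for G :: "('g, 'b) monoid_scheme" (structure) +
  fixes \<Gamma> :: "'g set"
  assumes countable_G: "countable (carrier G)"
    and subgroup_\<Gamma>: "subgroup \<Gamma> G"
    and almost_normal: "\<sigma> \<in> carrier G \<Longrightarrow> finite (cosets_in G \<Gamma> (conj_inter G \<Gamma> \<sigma>))"
    and index_inv: "\<sigma> \<in> carrier G \<Longrightarrow>
      index_in G \<Gamma> (conj_inter G \<Gamma> \<sigma>) = index_in G \<Gamma> (conj_inter G \<Gamma> (inv \<sigma>))"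
    and trivial_inter: "\<Inter> (level_family G \<Gamma>) = {\<one>}"


section \<open>Unitary representations and the technical condition\<close>

definition unitary_on :: "'h::chilbert_space set \<Rightarrow> ('h \<Rightarrow> 'h) \<Rightarrow> bool"
  where "unitary_on W T \<longleftrightarrow> clinear_on W T \<and> bij_betw T W W
    \<and> (\<forall>x\<in>W. \<forall>y\<in>W. cinner (T x) (T y) = cinner x y)"

definition unitary_rep_on ::
    "('g, 'b) monoid_scheme \<Rightarrow> 'h::chilbert_space set \<Rightarrow> ('g \<Rightarrow> 'h \<Rightarrow> 'h) \<Rightarrow> bool"
  where "unitary_rep_on G W \<rho> \<longleftrightarrow> closed_csubspace W
    \<and> (\<forall>g\<in>carrier G. unitary_on W (\<rho> g))
    \<and> (\<forall>g\<in>carrier G. \<forall>h\<in>carrier G. \<forall>x\<in>W. \<rho> (g \<otimes>\<^bsub>G\<^esub> h) x = \<rho> g (\<rho> h x))"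

text \<open>The Hilbert tensor product of \<open>\<ell>\<^sup>2(\<Gamma>)\<close> and \<open>M\<close> is the space of square summable
  functions from \<open>\<Gamma>\<close> to \<open>M\<close>; here functions are extended by zero outside \<open>\<Gamma>\<close>. The elementary
  tensor of the point mass at \<open>\<gamma>\<close> with \<open>m\<close> is the function supported at \<open>\<gamma>\<close> with value \<open>m\<close>.\<close>

definition ell2_fun :: "'g set \<Rightarrow> 'h::chilbert_space set \<Rightarrow> ('g \<Rightarrow> 'h) set"
  where "ell2_fun \<Gamma> M = {f. (\<forall>a\<in>\<Gamma>. f a \<in> M) \<and> (\<forall>a. a \<notin> \<Gamma> \<longrightarrow> f a = 0)
    \<and> (\<lambda>a. (norm (f a))\<^sup>2) summable_on \<Gamma>}"

text \<open>\<open>V\<close> is a linear isometry from \<open>W\<close> to the tensor product of \<open>\<ell>\<^sup>2(\<Gamma>)\<close> and \<open>M\<close> which intertwines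
  \<open>\<rho>\<close>, restricted to \<open>\<Gamma>\<close>, with the left regular representation tensored with the identity.\<close>

definition regular_embedding ::
    "('g, 'b) monoid_scheme \<Rightarrow> 'g set \<Rightarrow> ('g \<Rightarrow> 'h::chilbert_space \<Rightarrow> 'h) \<Rightarrow> 'h set \<Rightarrow> 'h set
      \<Rightarrow> ('h \<Rightarrow> 'g \<Rightarrow> 'h) \<Rightarrow> bool"
  where "regular_embedding G \<Gamma> \<rho> W M V \<longleftrightarrow> closed_csubspace M
    \<and> (\<forall>x\<in>W. V x \<in> ell2_fun \<Gamma> M)
    \<and> (\<forall>a\<in>\<Gamma>. clinear_on W (\<lambda>x. V x a))
    \<and> (\<forall>x\<in>W. \<forall>y\<in>W. ((\<lambda>a. cinner (V x a) (V y a)) has_sum cinner x y) \<Gamma>)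
    \<and> (\<forall>\<gamma>\<in>\<Gamma>. \<forall>x\<in>W. \<forall>a\<in>\<Gamma>. V (\<rho> \<gamma> x) a = V x (inv\<^bsub>G\<^esub> \<gamma> \<otimes>\<^bsub>G\<^esub> a))"

text \<open>A not necessarily integer multiple of the left regular representation of \<open>\<Gamma>\<close> is a
  subrepresentation of an integer one.\<close>

definition multiple_of_regular ::
    "('g, 'b) monoid_scheme \<Rightarrow> 'g set \<Rightarrow> ('g \<Rightarrow> 'h::chilbert_space \<Rightarrow> 'h) \<Rightarrow> 'h set \<Rightarrow> bool"
  where "multiple_of_regular G \<Gamma> \<rho> W \<longleftrightarrow> (\<exists>M V. regular_embedding G \<Gamma> \<rho> W M V)"

text \<open>The dimension of \<open>W\<close> over the von Neumann algebra of \<open>\<Gamma>\<close>, with its canonical trace \<open>\<tau>\<close>, is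
  \<open>(\<tau> \<otimes> Tr)(V V\<^sup>*)\<close> for any \<open>V\<close> as in \<^const>\<open>regular_embedding\<close>. With \<open>Q\<close> the projection onto the
  functions supported at the neutral element, this is \<open>Tr(Q V V\<^sup>* Q) = Tr(V\<^sup>* Q V)\<close>, and the latter
  is the sum of the numbers \<open>\<parallel>(V x)(1)\<parallel>\<^sup>2\<close> over an orthonormal basis of \<open>W\<close>.\<close>

definition vN_dim ::
    "('g, 'b) monoid_scheme \<Rightarrow> 'g set \<Rightarrow> ('g \<Rightarrow> 'h::chilbert_space \<Rightarrow> 'h) \<Rightarrow> 'h set \<Rightarrow> ennreal"
  where "vN_dim G \<Gamma> \<rho> W = (THE d. \<exists>M V B. regular_embedding G \<Gamma> \<rho> W M V \<and> onb_of W B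
    \<and> d = (\<Sum>\<^sub>\<infinity>x\<in>B. ennreal ((norm (V x \<one>\<^bsub>G\<^esub>))\<^sup>2)))"

locale technical_condition = almost_normal_pair G \<Gamma>
  for G :: "('g, 'b) monoid_scheme" (structure) and \<Gamma> :: "'g set" +
  fixes \<pi>\<^sub>0 :: "'g \<Rightarrow> 'h::chilbert_space \<Rightarrow> 'h" and H\<^sub>0 :: "'h set"
    and \<pi> :: "'g \<Rightarrow> 'h \<Rightarrow> 'h" and L :: "'h set"
  assumes rep_\<pi>\<^sub>0: "unitary_rep_on G H\<^sub>0 \<pi>\<^sub>0"
    and multiple_\<pi>\<^sub>0: "multiple_of_regular G \<Gamma> \<pi>\<^sub>0 H\<^sub>0"
    and rep_\<pi>: "unitary_rep_on G UNIV \<pi>"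
    and integer_multiple: "\<exists>V. regular_embedding G \<Gamma> \<pi> UNIV L V \<and> range V = ell2_fun \<Gamma> L
      \<and> (\<forall>l\<in>L. V l = (\<lambda>a. if a = \<one> then l else 0))"
    and commuting: "g \<in> carrier G \<Longrightarrow> h \<in> carrier G \<Longrightarrow>
      (\<pi> g \<circ> orth_proj L \<circ> \<pi> (inv g)) \<circ> (\<pi> h \<circ> orth_proj L \<circ> \<pi> (inv h))
      = (\<pi> h \<circ> orth_proj L \<circ> \<pi> (inv h)) \<circ> (\<pi> g \<circ> orth_proj L \<circ> \<pi> (inv g))"
    and invariant: "g \<in> carrier G \<Longrightarrow> \<pi> g ` H\<^sub>0 \<subseteq> H\<^sub>0"
    \<comment> \<open>On \<open>H\<^sub>0\<close> this is the restriction of \<open>\<pi> g\<close>.\<close>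
    and \<pi>\<^sub>0_eq: "g \<in> carrier G \<Longrightarrow> \<pi>\<^sub>0 g = orth_proj H\<^sub>0 \<circ> \<pi> g \<circ> orth_proj H\<^sub>0"
    and trace_class_P\<^sub>0P\<^sub>L: "trace_class (orth_proj H\<^sub>0 \<circ> orth_proj L)"
    and coset_sums: "g \<in> carrier G \<Longrightarrow> \<Gamma>\<^sub>0 \<in> level_family G \<Gamma> \<Longrightarrow>
      \<exists>T. hs_has_sum (\<lambda>\<theta>. orth_proj L \<circ> \<pi>\<^sub>0 \<theta> \<circ> orth_proj L) (\<Gamma>\<^sub>0 #> g) T
        \<and> (\<lambda>\<theta>. cmod (ctrace (orth_proj L \<circ> \<pi>\<^sub>0 \<theta> \<circ> orth_proj L))) summable_on (\<Gamma>\<^sub>0 #> g)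
        \<and> trace_class T
        \<and> ctrace T = (\<Sum>\<^sub>\<infinity>\<theta>\<in>\<Gamma>\<^sub>0 #> g. ctrace (orth_proj L \<circ> \<pi>\<^sub>0 \<theta> \<circ> orth_proj L))"
    and dim_finite_pos: "0 < vN_dim G \<Gamma> \<pi>\<^sub>0 H\<^sub>0" "vN_dim G \<Gamma> \<pi>\<^sub>0 H\<^sub>0 < \<infinity>"


section \<open>Virtual invariant vectors and the associated representation\<close>

text \<open>For \<open>\<rho> = \<pi>\<close> this is the domain \<open>\<D>\<^bsub>L,\<pi>\<^esub>\<close>.\<close>

definition conv_domain ::
    "('g, 'b) monoid_scheme \<Rightarrow> 'g set \<Rightarrow> 'h::chilbert_space set \<Rightarrow> ('g \<Rightarrow> 'h \<Rightarrow> 'h) \<Rightarrow> 'h set"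
  where "conv_domain G \<Gamma> L \<rho> =
    {h. \<forall>\<Gamma>\<^sub>0\<in>level_family G \<Gamma>. (\<lambda>\<gamma>. orth_proj L (\<rho> \<gamma> h)) summable_on \<Gamma>\<^sub>0}"

text \<open>The vectors \<open>h\<close> which give rise to formal sums of \<open>\<pi>\<^sub>0(\<gamma>)h\<close> over \<open>\<Gamma>\<^sub>0\<close>: besides
  \<open>h \<in> \<D>\<^bsub>L,\<pi>\<^esub>\<close>, the sums of \<open>\<pi>\<^sub>0(\<gamma>)h\<close>, projected to \<open>L\<close> or to its translates, have to make sense.
  For \<open>h \<in> H\<^sub>0\<close> the second condition is the same as the first.\<close>

definition virtual_domain ::
    "('g, 'b) monoid_scheme \<Rightarrow> 'g set \<Rightarrow> ('g \<Rightarrow> 'h \<Rightarrow> 'h) \<Rightarrow> ('g \<Rightarrow> 'h \<Rightarrow> 'h)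
      \<Rightarrow> 'h::chilbert_space set \<Rightarrow> 'h set"
  where "virtual_domain G \<Gamma> \<pi>\<^sub>0 \<pi> L = conv_domain G \<Gamma> L \<pi> \<inter> conv_domain G \<Gamma> L \<pi>\<^sub>0"

text \<open>The space \<open>L\<^bsup>\<Gamma>\<^sub>0\<^esup>\<close> for the (finite) set \<open>R\<close> of right coset representatives of \<open>\<Gamma>\<^sub>0\<close>.\<close>

definition level_space ::
    "('g \<Rightarrow> 'h \<Rightarrow> 'h) \<Rightarrow> 'h::chilbert_space set \<Rightarrow> 'g set \<Rightarrow> 'h set"
  where "level_space \<pi> L R = {\<Sum>s\<in>R. \<pi> s (v s) | v. \<forall>s\<in>R. v s \<in> L}"

definition level_vector ::
    "('g \<Rightarrow> 'h \<Rightarrow> 'h) \<Rightarrow> ('g \<Rightarrow> 'h \<Rightarrow> 'h) \<Rightarrow> 'h::chilbert_space set \<Rightarrow> 'g set \<Rightarrow> 'g set \<Rightarrow> 'h \<Rightarrow> 'h"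
  where "level_vector \<pi>\<^sub>0 \<pi> L R \<Gamma>\<^sub>0 h = (\<Sum>\<^sub>\<infinity>\<gamma>\<in>\<Gamma>\<^sub>0. orth_proj (level_space \<pi> L R) (\<pi>\<^sub>0 \<gamma> h))"

text \<open>The Hilbert completion is the type \<open>'k\<close>, which is determined up to unitary equivalence: it
  contains, as \<open>\<Phi> \<Gamma>\<^sub>0 h\<close>, the formal sum of \<open>\<pi>\<^sub>0(\<gamma>)h\<close> over \<open>\<gamma> \<in> \<Gamma>\<^sub>0\<close>. Formal sums have the prescribed
  inner product, identifications and inclusions, and they are dense. (The family of levels is closed
  under intersections, so the union of the spaces of formal sums is a linear subspace.)\<close>

locale virtual_representation = technical_condition G \<Gamma> \<pi>\<^sub>0 H\<^sub>0 \<pi> L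
  for G :: "('g, 'b) monoid_scheme" (structure) and \<Gamma> :: "'g set"
    and \<pi>\<^sub>0 :: "'g \<Rightarrow> 'h::chilbert_space \<Rightarrow> 'h" and H\<^sub>0 :: "'h set"
    and \<pi> :: "'g \<Rightarrow> 'h \<Rightarrow> 'h" and L :: "'h set" +
  fixes \<Phi> :: "'g set \<Rightarrow> 'h \<Rightarrow> 'k::chilbert_space"
    and U :: "'g \<Rightarrow> 'k \<Rightarrow> 'k"
  assumes formal_linear: "\<Gamma>\<^sub>0 \<in> level_family G \<Gamma> \<Longrightarrow>
      clinear_on (virtual_domain G \<Gamma> \<pi>\<^sub>0 \<pi> L) (\<Phi> \<Gamma>\<^sub>0)"
    and formal_cinner: "\<Gamma>\<^sub>0 \<in> level_family G \<Gamma> \<Longrightarrow> right_transversal G \<Gamma> \<Gamma>\<^sub>0 R \<Longrightarrow>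
      h\<^sub>1 \<in> virtual_domain G \<Gamma> \<pi>\<^sub>0 \<pi> L \<Longrightarrow> h\<^sub>2 \<in> virtual_domain G \<Gamma> \<pi>\<^sub>0 \<pi> L \<Longrightarrow>
      cinner (\<Phi> \<Gamma>\<^sub>0 h\<^sub>1) (\<Phi> \<Gamma>\<^sub>0 h\<^sub>2) = 1 / of_nat (index_in G \<Gamma> \<Gamma>\<^sub>0) *
        cinner (level_vector \<pi>\<^sub>0 \<pi> L R \<Gamma>\<^sub>0 h\<^sub>1) (level_vector \<pi>\<^sub>0 \<pi> L R \<Gamma>\<^sub>0 h\<^sub>2)"
    and formal_ident: "\<Gamma>\<^sub>0 \<in> level_family G \<Gamma> \<Longrightarrow> right_transversal G \<Gamma> \<Gamma>\<^sub>0 R \<Longrightarrow>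
      h \<in> virtual_domain G \<Gamma> \<pi>\<^sub>0 \<pi> L \<Longrightarrow> \<Phi> \<Gamma>\<^sub>0 h = \<Phi> \<Gamma>\<^sub>0 (level_vector \<pi>\<^sub>0 \<pi> L R \<Gamma>\<^sub>0 h)"
    and formal_inclusion: "\<Gamma>\<^sub>0 \<in> level_family G \<Gamma> \<Longrightarrow> \<Gamma>\<^sub>1 \<in> level_family G \<Gamma> \<Longrightarrow> \<Gamma>\<^sub>1 \<subseteq> \<Gamma>\<^sub>0 \<Longrightarrow>
      right_transversal G \<Gamma>\<^sub>0 \<Gamma>\<^sub>1 R \<Longrightarrow> h \<in> virtual_domain G \<Gamma> \<pi>\<^sub>0 \<pi> L \<Longrightarrow>
      \<Phi> \<Gamma>\<^sub>0 h = \<Phi> \<Gamma>\<^sub>1 (\<Sum>r\<in>R. \<pi> r h)"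
    and formal_dense:
      "closure (\<Union>\<Gamma>\<^sub>0\<in>level_family G \<Gamma>. \<Phi> \<Gamma>\<^sub>0 ` virtual_domain G \<Gamma> \<pi>\<^sub>0 \<pi> L) = UNIV"
    and rep_U: "unitary_rep_on G UNIV U"
    and U_formal: "g \<in> carrier G \<Longrightarrow> \<Gamma>\<^sub>0 \<in> level_family G \<Gamma> \<Longrightarrow> \<Gamma>\<^sub>1 = conj_inter G \<Gamma>\<^sub>0 (inv g) \<Longrightarrow>
      h \<in> virtual_domain G \<Gamma> \<pi>\<^sub>0 \<pi> L \<Longrightarrow> \<pi> g h \<in> virtual_domain G \<Gamma> \<pi>\<^sub>0 \<pi> L \<Longrightarrow>
      U g (\<Phi> \<Gamma>\<^sub>1 h) = \<Phi> (conj_set G g \<Gamma>\<^sub>1) (\<pi> g h)"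

text \<open>The space \<open>H\<^sub>0\<^bsup>\<Gamma>\<^sub>0\<^esup>\<close> of formal sums over \<open>\<Gamma>\<^sub>0\<close>, inside the completion.\<close>

definition virtual_space ::
    "('g, 'b) monoid_scheme \<Rightarrow> 'g set \<Rightarrow> ('g \<Rightarrow> 'h::chilbert_space \<Rightarrow> 'h) \<Rightarrow> ('g \<Rightarrow> 'h \<Rightarrow> 'h)
      \<Rightarrow> 'h set \<Rightarrow> ('g set \<Rightarrow> 'h \<Rightarrow> 'k::chilbert_space) \<Rightarrow> 'g set \<Rightarrow> 'k set"
  where "virtual_space G \<Gamma> \<pi>\<^sub>0 \<pi> L \<Phi> \<Gamma>\<^sub>0 = \<Phi> \<Gamma>\<^sub>0 ` virtual_domain G \<Gamma> \<pi>\<^sub>0 \<pi> L"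

definition hecke_operator ::
    "('g, 'b) monoid_scheme \<Rightarrow> 'g set \<Rightarrow> ('g \<Rightarrow> 'h::chilbert_space \<Rightarrow> 'h) \<Rightarrow> ('g \<Rightarrow> 'h \<Rightarrow> 'h)
      \<Rightarrow> 'h set \<Rightarrow> ('g set \<Rightarrow> 'h \<Rightarrow> 'k::chilbert_space) \<Rightarrow> ('g \<Rightarrow> 'k \<Rightarrow> 'k)
      \<Rightarrow> 'g set \<Rightarrow> 'g \<Rightarrow> 'k \<Rightarrow> 'k"
  where "hecke_operator G \<Gamma> \<pi>\<^sub>0 \<pi> L \<Phi> U \<Gamma>\<^sub>0 \<sigma> =
    (\<lambda>x. of_nat (index_in G \<Gamma>\<^sub>0 (conj_inter G \<Gamma>\<^sub>0 \<sigma>)) *\<^sub>C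
      (orth_proj (virtual_space G \<Gamma> \<pi>\<^sub>0 \<pi> L \<Phi> \<Gamma>\<^sub>0) \<circ> U \<sigma>
        \<circ> orth_proj (virtual_space G \<Gamma> \<pi>\<^sub>0 \<pi> L \<Phi> \<Gamma>\<^sub>0)) x)"

end

theory Submission
  imports Defs
begin

text \<open>On \<open>L\<^bsup>\<Lambda>\<^esup>\<close> the operator \<open>x \<mapsto> \<Sum>\<^bsub>\<gamma>\<in>\<Lambda>\<^esub> Q \<pi>\<^sub>0(\<gamma>) x\<close>, with \<open>Q\<close> the projection onto \<open>L\<^bsup>\<Lambda>\<^esup>\<close>, is self-adjoint, and the identification of formal sums
  forces it to be idempotent. Being a Hilbert--Schmidt projection it has finite rank, and up to the factor
  \<open>[\<Gamma> : \<Lambda>]\<^bsup>1/2\<^esup>\<close> its range is the space of formal sums over \<open>\<Lambda>\<close>. Passing to the level \<open>\<Lambda>\<^sub>\<sigma>\<close> and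
  recombining cosets gives, for \<open>x, y \<in> L\<^bsup>\<Lambda>\<^esup>\<close>,
  \<open>[\<Gamma> : \<Lambda>\<^sub>\<sigma>] \<langle>U(\<sigma>) \<Phi> x, \<Phi> y\<rangle> = \<Sum>\<^bsub>\<theta>\<in>\<Lambda>\<sigma>\<Lambda>\<^esub> \<langle>\<pi>\<^sub>0(\<theta>) x, y\<rangle>\<close>.
  The left-hand side is a finite-rank form whose trace is that of the Hecke operator; computing the trace of
  the right-hand side along the blocks \<open>\<pi>(s) L\<close> of \<open>L\<^bsup>\<Lambda>\<^esup>\<close> gives the sum over \<open>\<theta>\<close> of the traces of
  \<open>P\<^sub>L \<pi>\<^sub>0(\<theta>) P\<^sub>L\<close>.\<close>

text \<open>The scalar product of formal sums is computed from level vectors, and a formal sum is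
  identified with the one built from its own level vector. Taking a second level vector therefore
  changes nothing, which is the idempotence; self-adjointness only reflects that \<Lambda> is closed
  under inversion. The obstacle is the exchange of the trace with the sum over theta: condition (vi)
  permits it only along right cosets of a level. But s^{-1} \<Lambda> \<sigma> \<Lambda> s is a
  finite union of right cosets of s^{-1} \<Lambda> s, and this group is again a level, so (vi)
  applies piece by piece. Finite rank does the rest: both traces become double sums over one finite
  basis of fixed vectors, and the spaces of formal sums get an orthogonal projection without their
  closedness being known beforehand. Constants: the two projections in the Hecke operator contribute
  [\<Gamma> : \<Lambda>]^2, and with [\<Lambda> : \<Lambda>_\<sigma>] this is [\<Gamma> : \<Lambda>]
  [\<Gamma> : \<Lambda>_\<sigma>]. The surplus [\<Gamma> : \<Lambda>] cancels against the factor
  1/[\<Gamma> : \<Lambda>] of the scalar product.\<close>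

instance chilbert_space \<subseteq> banach ..

section \<open>Hilbert spaces\<close>

lemma cinner_add_right: "cinner (x::'a::complex_inner) (y + z) = cinner x y + cinner x z"
proof -
  have "cinner x (y + z) = cnj (cinner (y + z) x)" by (rule cinner_commute)
  then show ?thesis by (simp add: cinner_add_left cinner_commute[symmetric])
qed

lemma cinner_scaleC_right: "cinner (x::'a::complex_inner) (c *\<^sub>C y) = cnj c * cinner x y"
proof -
  have "cinner x (c *\<^sub>C y) = cnj (cinner (c *\<^sub>C y) x)" by (rule cinner_commute)
  then show ?thesis by (simp add: cinner_scaleC_left cinner_commute[symmetric])
qed

lemma cinner_zero_left [simp]: "cinner (0::'a::complex_inner) y = 0"
  using cinner_add_left[of 0 0 y] by simp

lemma cinner_zero_right [simp]: "cinner (y::'a::complex_inner) 0 = 0"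
  using cinner_add_right[of y 0 0] by simp

lemma scaleC_minus_one: "(-1) *\<^sub>C (x::'a::complex_inner) = - x"
  using scaleR_scaleC[of "-1" x] by simp

lemma scaleC_one [simp]: "1 *\<^sub>C (x::'a::complex_inner) = x"
  using scaleR_scaleC[of "1" x] by simp

lemma scaleC_zero_left [simp]: "0 *\<^sub>C (x::'a::complex_inner) = 0"
  using scaleR_scaleC[of "0" x] by simp

lemma scaleC_zero_right [simp]: "c *\<^sub>C (0::'a::complex_inner) = 0"
  using scaleC_add_right[of c 0 0] by simp

lemma cinner_minus_left: "cinner (- x) (y::'a::complex_inner) = - cinner x y"
  using cinner_scaleC_left[of "-1" x y] by (simp add: scaleC_minus_one)

lemma cinner_minus_right: "cinner y (- x::'a::complex_inner) = - cinner y x"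
  using cinner_scaleC_right[of y "-1" x] by (simp add: scaleC_minus_one)

lemma cinner_diff_left: "cinner (x - y) (z::'a::complex_inner) = cinner x z - cinner y z"
  using cinner_add_left[of x "- y" z] by (simp add: cinner_minus_left)

lemma cinner_diff_right: "cinner (z::'a::complex_inner) (x - y) = cinner z x - cinner z y"
  using cinner_add_right[of z x "- y"] by (simp add: cinner_minus_right)

lemma cinner_sum_left: "cinner (\<Sum>i\<in>A. f i) (z::'a::complex_inner) = (\<Sum>i\<in>A. cinner (f i) z)"
  by (induction A rule: infinite_finite_induct) (auto simp: cinner_add_left)

lemma cinner_sum_right: "cinner (z::'a::complex_inner) (\<Sum>i\<in>A. f i) = (\<Sum>i\<in>A. cinner z (f i))"
  by (induction A rule: infinite_finite_induct) (auto simp: cinner_add_right)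

lemma scaleC_sum_right: "c *\<^sub>C (\<Sum>i\<in>A. f i) = (\<Sum>i\<in>A. c *\<^sub>C (f i::'a::complex_inner))"
  by (induction A rule: infinite_finite_induct) (auto simp: scaleC_add_right)

lemma cinner_self_eq_0_iff: "cinner x x = 0 \<longleftrightarrow> (x::'a::complex_inner) = 0"
  by (simp add: norm_cinner)

lemma cinner_ext: "x = y" if "\<And>z. cinner x z = cinner y z" for x y :: "'a::complex_inner"
proof -
  have "cinner (x - y) (x - y) = 0" using that by (simp add: cinner_diff_left)
  then show ?thesis by (simp add: cinner_self_eq_0_iff)
qed

text \<open>The class ties the norm to real scalars only; homogeneity for complex ones has to come
  from the inner product.\<close>

lemma norm_scaleC: "norm (c *\<^sub>C (x::'a::complex_inner)) = cmod c * norm x"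
proof -
  have "complex_of_real ((norm (c *\<^sub>C x))\<^sup>2) = c * (cnj c * complex_of_real ((norm x)\<^sup>2))"
    unfolding norm_cinner[symmetric] cinner_scaleC_left cinner_scaleC_right by (rule mult.left_commute)
  also have "\<dots> = (c * cnj c) * complex_of_real ((norm x)\<^sup>2)" by (simp only: mult.assoc)
  also have "\<dots> = complex_of_real ((cmod c * norm x)\<^sup>2)"
    unfolding complex_norm_square[symmetric] by (simp add: power_mult_distrib)
  finally have "(norm (c *\<^sub>C x))\<^sup>2 = (cmod c * norm x)\<^sup>2" using of_real_eq_iff by blast
  then show ?thesis by (simp add: power2_eq_iff_nonneg)
qed

lemma cinner_Cauchy_Schwarz: "cmod (cinner x y) \<le> norm x * norm (y::'a::complex_inner)"
proof (cases "y = 0")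
  case False
  define N where "N = (norm y)\<^sup>2"
  have N: "N > 0" using False by (simp add: N_def)
  define a where "a = cinner x y"
  \<comment> \<open>\<open>c *\<^sub>C y\<close> is the projection of \<open>x\<close> onto the line
    through \<open>y\<close>; the inequality says that the remainder has nonnegative squared
    norm.\<close>
  define c where "c = a / of_real N"
  have yx: "cinner y x = cnj a" unfolding a_def by (rule cinner_commute)
  have "complex_of_real ((norm (x - c *\<^sub>C y))\<^sup>2) = cinner (x - c *\<^sub>C y) (x - c *\<^sub>C y)"
    by (simp only: norm_cinner)
  also have "\<dots> = of_real ((norm x)\<^sup>2) - cnj c * a - c * cnj a + c * cnj c * of_real N"
    unfolding cinner_diff_left cinner_diff_right cinner_scaleC_left cinner_scaleC_right yx
      a_def[symmetric] by (simp add: norm_cinner N_def algebra_simps)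
  also have "\<dots> = of_real ((norm x)\<^sup>2) - a * cnj a / of_real N"
    using N by (simp add: c_def field_simps)
  also have "\<dots> = of_real ((norm x)\<^sup>2 - (cmod a)\<^sup>2 / N)"
    unfolding complex_norm_square[symmetric] by simp
  finally have "(norm (x - c *\<^sub>C y))\<^sup>2 = (norm x)\<^sup>2 - (cmod a)\<^sup>2 / N"
    using of_real_eq_iff by blast
  then have "(cmod a)\<^sup>2 / N \<le> (norm x)\<^sup>2" by (metis diff_ge_0_iff_ge zero_le_power2)
  then have "(cmod a)\<^sup>2 \<le> (norm x * norm y)\<^sup>2"
    using N by (simp add: field_simps power_mult_distrib N_def)
  then show ?thesis unfolding a_def by (rule power2_le_imp_le) simp
qed simp

lemma bounded_linear_cinner_left: "bounded_linear (\<lambda>x. cinner x (y::'a::complex_inner))"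
  by (rule bounded_linear_intro[where K = "norm y"])
    (auto simp: cinner_add_left scaleR_scaleC cinner_scaleC_left scaleC_complex_def
      cinner_Cauchy_Schwarz)

lemma bounded_linear_cinner_right: "bounded_linear (\<lambda>x. cinner (y::'a::complex_inner) x)"
proof (rule bounded_linear_intro[where K = "norm y"])
  show "norm (cinner y x) \<le> norm x * norm y" for x
    using cinner_Cauchy_Schwarz[of y x] by (simp add: mult.commute)
qed (auto simp: cinner_add_right scaleR_scaleC cinner_scaleC_right scaleC_complex_def)

lemma bounded_linear_scaleC: "bounded_linear (\<lambda>x. c *\<^sub>C (x::'a::complex_inner))"
  by (rule bounded_linear_intro[where K = "cmod c"])
    (auto simp: scaleC_add_right scaleR_scaleC scaleC_scaleC norm_scaleC mult.commute)

lemmas has_sum_cinner_left = has_sum_bounded_linear[OF bounded_linear_cinner_left]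
lemmas has_sum_cinner_right = has_sum_bounded_linear[OF bounded_linear_cinner_right]
lemmas has_sum_scaleC = has_sum_bounded_linear[OF bounded_linear_scaleC]

section \<open>Pythagoras and orthogonal series\<close>

lemma norm_sum_orthogonal:
  assumes "finite F" "\<And>i j. i \<in> F \<Longrightarrow> j \<in> F \<Longrightarrow> i \<noteq> j \<Longrightarrow> cinner (v i) (v j) = 0"
  shows "(norm (\<Sum>i\<in>F. v i :: 'a::complex_inner))\<^sup>2 = (\<Sum>i\<in>F. (norm (v i))\<^sup>2)"
proof -
  have "complex_of_real ((norm (\<Sum>i\<in>F. v i))\<^sup>2) = (\<Sum>j\<in>F. \<Sum>i\<in>F. cinner (v i) (v j))"
    unfolding norm_cinner[symmetric] cinner_sum_left cinner_sum_right ..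
  also have "\<dots> = (\<Sum>j\<in>F. \<Sum>i\<in>F. if i = j then cinner (v i) (v i) else 0)"
    using assms(2) by (intro sum.cong refl) auto
  also have "\<dots> = complex_of_real (\<Sum>i\<in>F. (norm (v i))\<^sup>2)"
    using assms(1) by (simp add: norm_cinner)
  finally show ?thesis using of_real_eq_iff by blast
qed

text \<open>By Pythagoras the norms of tails are tails of a convergent numerical sum. This serves
  basis expansions and later the orthogonal families of translates, neither of which need be
  absolutely summable.\<close>

lemma summable_on_orthogonal:
  fixes v :: "'i \<Rightarrow> 'a::chilbert_space"
  assumes orth: "\<And>i j. i \<in> A \<Longrightarrow> j \<in> A \<Longrightarrow> i \<noteq> j \<Longrightarrow> cinner (v i) (v j) = 0"
    and sq: "(\<lambda>i. (norm (v i))\<^sup>2) summable_on A"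
  shows "v summable_on A"
proof -
  let ?F = "filtermap (sum v) (finite_subsets_at_top A)"
  \<comment> \<open>An unconditional sum is a limit along the filter of finite subsets, so
    completeness is invoked for filters instead of sequences.\<close>
  have "cauchy_filter ?F"
    unfolding cauchy_filter_metric_filtermap
  proof (intro allI impI)
    fix e :: real assume "e > 0"
    define s where "s = (\<Sum>\<^sub>\<infinity>i\<in>A. (norm (v i))\<^sup>2)"
    have hs: "((\<lambda>i. (norm (v i))\<^sup>2) has_sum s) A" using sq by (simp add: s_def)
    have "(e/2)\<^sup>2 > 0" using \<open>e > 0\<close> by simp
    \<comment> \<open>The extra factor 1/2 turns the nonstrict approximation into the strict bound
      needed below.\<close>
    then obtain F where F: "finite F" "F \<subseteq> A" "dist (\<Sum>i\<in>F. (norm (v i))\<^sup>2) s \<le> (e/2)\<^sup>2 / 2"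
      using has_sum_finite_approximation[OF hs, of "(e/2)\<^sup>2 / 2"] by auto
    have small: "dist (sum v F') (sum v F) < e / 2" if F': "finite F'" "F \<subseteq> F'" "F' \<subseteq> A" for F'
    proof -
      have "sum v F' - sum v F = sum v (F' - F)" using F F' by (simp add: sum_diff)
      then have "(dist (sum v F') (sum v F))\<^sup>2 = (norm (sum v (F' - F)))\<^sup>2" by (simp add: dist_norm)
      also have "\<dots> = (\<Sum>i\<in>F' - F. (norm (v i))\<^sup>2)"
        by (rule norm_sum_orthogonal) (use F' in \<open>auto intro!: orth\<close>)
      also have "\<dots> = (\<Sum>i\<in>F'. (norm (v i))\<^sup>2) - (\<Sum>i\<in>F. (norm (v i))\<^sup>2)"
        using F F' by (simp add: sum_diff)
      also have "\<dots> \<le> s - (\<Sum>i\<in>F. (norm (v i))\<^sup>2)"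
        using finite_sum_le_has_sum[OF hs, of F'] F' by auto
      also have "\<dots> \<le> (e/2)\<^sup>2 / 2" using F(3) unfolding dist_real_def by linarith
      also have "\<dots> < (e/2)\<^sup>2" using \<open>(e/2)\<^sup>2 > 0\<close> by simp
      finally show ?thesis by (rule power2_less_imp_less) (use \<open>e > 0\<close> in simp)
    qed
    define P where "P F' \<longleftrightarrow> finite F' \<and> F \<subseteq> F' \<and> F' \<subseteq> A" for F'
    have "eventually P (finite_subsets_at_top A)"
      unfolding eventually_finite_subsets_at_top P_def using F by blast
    moreover have "dist (sum v F1) (sum v F2) < e" if "P F1" "P F2" for F1 F2
      using small[of F1] small[of F2] that dist_triangle_half_l[of "sum v F1" "sum v F" e "sum v F2"]
      by (auto simp: P_def dist_commute)
    ultimately show "\<exists>P. eventually P (finite_subsets_at_top A) \<and>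
        (\<forall>x y. P x \<and> P y \<longrightarrow> dist (sum v x) (sum v y) < e)" by blast
  qed
  moreover have "?F \<noteq> bot" by (simp add: filtermap_bot_iff)
  ultimately obtain x where "?F \<le> nhds x"
    using complete_UNIV[where 'a='a] unfolding complete_uniform by auto
  then show ?thesis unfolding summable_on_def has_sum_def filterlim_def by blast
qed

text \<open>Purely algebraic subspaces: \<open>D\<close>, the fixed vectors of a level and the
  spaces of formal sums come without a proof of closedness.\<close>

definition csubspace :: "'a::complex_inner set \<Rightarrow> bool"
  where "csubspace W \<longleftrightarrow> 0 \<in> W \<and> (\<forall>x\<in>W. \<forall>y\<in>W. x + y \<in> W) \<and> (\<forall>c. \<forall>x\<in>W. c *\<^sub>C x \<in> W)"

lemma closed_csubspace_iff: "closed_csubspace W \<longleftrightarrow> closed W \<and> csubspace W"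
  by (auto simp: closed_csubspace_def csubspace_def)

lemma csubspace_0: "csubspace W \<Longrightarrow> 0 \<in> W"
  and csubspace_add: "csubspace W \<Longrightarrow> x \<in> W \<Longrightarrow> y \<in> W \<Longrightarrow> x + y \<in> W"
  and csubspace_scaleC: "csubspace W \<Longrightarrow> x \<in> W \<Longrightarrow> c *\<^sub>C x \<in> W"
  by (auto simp: csubspace_def)

lemma csubspace_diff: "csubspace W \<Longrightarrow> x \<in> W \<Longrightarrow> y \<in> W \<Longrightarrow> x - y \<in> W"
  using csubspace_add[of W x "- y"] csubspace_scaleC[of W y "-1"] by (simp add: scaleC_minus_one)

lemma csubspace_sum: "csubspace W \<Longrightarrow> (\<And>i. i \<in> I \<Longrightarrow> f i \<in> W) \<Longrightarrow> sum f I \<in> W"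
  by (induction I rule: infinite_finite_induct) (auto simp: csubspace_0 csubspace_add)

lemma csubspace_UNIV [simp]: "csubspace UNIV"
  by (simp add: csubspace_def)

lemma closed_csubspace_UNIV [simp]: "closed_csubspace UNIV"
  by (simp add: closed_csubspace_iff)

lemma has_sum_closed_csubspace:
  assumes "closed_csubspace W" "(f has_sum s) A" "\<And>i. i \<in> A \<Longrightarrow> f i \<in> W"
  shows "s \<in> W"
proof -
  have "eventually (\<lambda>F. sum f F \<in> W) (finite_subsets_at_top A)"
    using assms by (intro eventually_finite_subsets_at_top_weakI csubspace_sum)
      (auto simp: closed_csubspace_iff)
  then show ?thesis
    using Lim_in_closed_set[of W "sum f" "finite_subsets_at_top A" s] assms
    by (auto simp: closed_csubspace_iff has_sum_def)
qed

section \<open>Orthonormal sets, bases and orthogonal projections\<close>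

definition orthonormal :: "'a::complex_inner set \<Rightarrow> bool"
  where "orthonormal B \<longleftrightarrow> (\<forall>e\<in>B. norm e = 1) \<and> (\<forall>e\<in>B. \<forall>f\<in>B. e \<noteq> f \<longrightarrow> cinner e f = 0)"

lemma onb_of_iff:
  "onb_of W B \<longleftrightarrow> B \<subseteq> W \<and> orthonormal B \<and> (\<forall>x\<in>W. (\<forall>e\<in>B. cinner x e = 0) \<longrightarrow> x = 0)"
  by (auto simp: onb_of_def orthonormal_def)

lemma orthonormal_cinner:
  "orthonormal B \<Longrightarrow> e \<in> B \<Longrightarrow> f \<in> B \<Longrightarrow> cinner e f = (if e = f then 1 else 0)"
  by (auto simp: orthonormal_def norm_cinner)

lemma Bessel_finite:
  assumes "orthonormal F" "finite F"
  shows "(\<Sum>e\<in>F. (cmod (cinner x e))\<^sup>2) \<le> (norm x)\<^sup>2"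
proof -
  \<comment> \<open>\<open>y\<close> is the projection of \<open>x\<close> onto the span of
    \<open>F\<close>. Since \<open>cinner x y\<close> equals the squared norm of \<open>y\<close>,
    Cauchy--Schwarz gives that \<open>y\<close> is no longer than \<open>x\<close>.\<close>
  define y where "y = (\<Sum>e\<in>F. cinner x e *\<^sub>C e)"
  have xy: "cinner x y = of_real (\<Sum>e\<in>F. (cmod (cinner x e))\<^sup>2)"
    unfolding of_real_sum
    by (simp add: y_def cinner_sum_right cinner_scaleC_right)
      (intro sum.cong refl, metis complex_norm_square mult.commute of_real_power)
  have "(norm y)\<^sup>2 = (\<Sum>e\<in>F. (norm (cinner x e *\<^sub>C e))\<^sup>2)"
    unfolding y_def using assms
    by (intro norm_sum_orthogonal) (auto simp: cinner_scaleC_left cinner_scaleC_right orthonormal_def)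
  also have "\<dots> = (\<Sum>e\<in>F. (cmod (cinner x e))\<^sup>2)"
    using assms by (intro sum.cong) (auto simp: norm_scaleC orthonormal_def)
  finally have yy: "(norm y)\<^sup>2 = (\<Sum>e\<in>F. (cmod (cinner x e))\<^sup>2)" .
  then have "cmod (cinner x y) = (norm y)\<^sup>2" using xy by (metis norm_of_real abs_power2)
  then have "norm y * norm y \<le> norm x * norm y"
    using cinner_Cauchy_Schwarz[of x y] by (simp add: power2_eq_square)
  then have "norm y \<le> norm x" by (cases "y = 0") auto
  then show ?thesis unfolding yy[symmetric] by (simp add: power_mono)
qed

lemma orthonormal_subset: "orthonormal B \<Longrightarrow> F \<subseteq> B \<Longrightarrow> orthonormal F"
  by (auto simp: orthonormal_def)

lemma Bessel_summable:
  assumes "orthonormal B"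
  shows "(\<lambda>e. (cmod (cinner x e))\<^sup>2) summable_on B"
proof -
  have "(\<Sum>e\<in>F. (cmod (cinner x e))\<^sup>2) \<le> (norm x)\<^sup>2" if "finite F" "F \<subseteq> B" for F
    using that assms Bessel_finite orthonormal_subset by blast
  then show ?thesis
    by (intro nonneg_bdd_above_summable_on bdd_aboveI[of _ "(norm x)\<^sup>2"]) auto
qed

text \<open>\<open>onb_of\<close> asks for maximality inside \<open>W\<close>, which is what Zorn's
  lemma produces for any algebraic subspace. The space of fixed vectors is treated in this way
  before it is known to be finite-dimensional.\<close>

lemma onb_exists: "csubspace W \<Longrightarrow> \<exists>B. onb_of W B" for W :: "'a::chilbert_space set"
proof -
  assume W: "csubspace W"
  let ?A = "{B. B \<subseteq> W \<and> orthonormal B}"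
  have "\<exists>M\<in>?A. \<forall>X\<in>?A. M \<subseteq> X \<longrightarrow> X = M"
  proof (rule subset_Zorn')
    fix C assume C: "subset.chain ?A C"
    have CA: "\<And>X. X \<in> C \<Longrightarrow> orthonormal X" and lin: "\<And>X Y. X \<in> C \<Longrightarrow> Y \<in> C \<Longrightarrow> X \<subseteq> Y \<or> Y \<subseteq> X"
      using C unfolding subset_chain_def by blast+
    have "cinner e f = 0" if "X \<in> C" "Y \<in> C" "e \<in> X" "f \<in> Y" "e \<noteq> f" for X Y e f
      using lin[OF that(1,2)] CA[OF that(1)] CA[OF that(2)] that unfolding orthonormal_def by blast
    then have "orthonormal (\<Union>C)" using CA by (auto simp: orthonormal_def)
    then show "\<Union>C \<in> ?A" using C by (auto simp: subset.chain_def)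
  qed
  then obtain B where BA: "B \<in> ?A" and Bmax: "\<forall>X\<in>?A. B \<subseteq> X \<longrightarrow> X = B" ..
  have B: "B \<subseteq> W" "orthonormal B" using BA by auto
  have max: "X = B" if "X \<subseteq> W" "orthonormal X" "B \<subseteq> X" for X using Bmax that by simp
  have "x = 0" if x: "x \<in> W" "\<forall>e\<in>B. cinner x e = 0" for x
  proof (rule ccontr)
    assume "x \<noteq> 0"
    define u where "u = complex_of_real (1 / norm x) *\<^sub>C x"
    have u: "norm u = 1" unfolding u_def norm_scaleC norm_of_real using \<open>x \<noteq> 0\<close> by simp
    have uW: "u \<in> W" unfolding u_def by (rule csubspace_scaleC[OF W x(1)])
    have uB: "cinner u e = 0" if "e \<in> B" for e using x(2) that by (simp add: u_def cinner_scaleC_left)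
    have "cinner e u = 0" if "e \<in> B" for e using uB[OF that] cinner_commute[of e u] by simp
    then have "orthonormal (insert u B)" using B(2) u uB by (auto simp: orthonormal_def)
    then have "u \<in> B" using max[of "insert u B"] B(1) uW by auto
    then have "cinner u u = 0" by (rule uB)
    then show False using u by (simp add: norm_cinner)
  qed
  then show ?thesis using B by (auto simp: onb_of_iff)
qed

text \<open>The existence half of the projection theorem: the limit of the Fourier series is the
  nearest point.\<close>

lemma onb_expansion:
  assumes W: "closed_csubspace W" and B: "onb_of W B"
  shows "\<exists>y\<in>W. ((\<lambda>e. cinner x e *\<^sub>C e) has_sum y) B \<and> (\<forall>z\<in>W. cinner (x - y) z = 0)"
proof -
  have on: "orthonormal B" and BW: "B \<subseteq> W" using B by (auto simp: onb_of_iff)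
  have csW: "csubspace W" using W by (simp add: closed_csubspace_iff)
  have summ: "(\<lambda>e. cinner x e *\<^sub>C e) summable_on B" for x
  proof (rule summable_on_orthogonal)
    have "(\<lambda>e. (norm (cinner x e *\<^sub>C e))\<^sup>2) summable_on B \<longleftrightarrow> (\<lambda>e. (cmod (cinner x e))\<^sup>2) summable_on B"
      using on by (intro summable_on_cong) (auto simp: norm_scaleC orthonormal_def)
    then show "(\<lambda>e. (norm (cinner x e *\<^sub>C e))\<^sup>2) summable_on B" using Bessel_summable[OF on] by simp
  qed (use on in \<open>auto simp: cinner_scaleC_left cinner_scaleC_right orthonormal_def\<close>)
  define y where "y x = (\<Sum>\<^sub>\<infinity>e\<in>B. cinner x e *\<^sub>C e)" for x
  have y: "((\<lambda>e. cinner x e *\<^sub>C e) has_sum y x) B" for x using summ by (simp add: y_def)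
  have yW: "y x \<in> W" for x
    by (rule has_sum_closed_csubspace[OF W y]) (use BW csW in \<open>auto simp: csubspace_scaleC\<close>)
  have orth: "cinner (x - y x) e = 0" if "e \<in> B" for x e
  proof -
    have "((\<lambda>f. cinner (cinner x f *\<^sub>C f) e) has_sum cinner (y x) e) B"
      by (rule has_sum_cinner_left[OF y])
    moreover have "((\<lambda>f. cinner x f * cinner f e) has_sum cinner x e) {e}"
      using that on by (intro has_sum_finiteI) (auto simp: orthonormal_cinner)
    then have "((\<lambda>f. cinner (cinner x f *\<^sub>C f) e) has_sum cinner x e) B"
      using has_sum_cong_neutral[of B "{e}" "\<lambda>f. cinner x f * cinner f e" "\<lambda>f. cinner (cinner x f *\<^sub>C f) e"]
        that on by (auto simp: cinner_scaleC_left orthonormal_def)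
    ultimately show ?thesis using has_sum_unique by (fastforce simp: cinner_diff_left)
  qed
  \<comment> \<open>The defect \<open>z - y z\<close> lies in \<open>W\<close> and is orthogonal to
    \<open>B\<close>, so maximality kills it. Orthogonality to \<open>B\<close> then passes to every
    \<open>z\<close> in \<open>W\<close> through its own expansion.\<close>
  have zy: "y z = z" if "z \<in> W" for z
    using B that orth[of _ z] yW[of z] csubspace_diff[OF csW that yW[of z]] by (auto simp: onb_of_iff)
  have "cinner (x - y x) z = 0" if "z \<in> W" for z
  proof -
    have "((\<lambda>e. cinner (x - y x) (cinner z e *\<^sub>C e)) has_sum cinner (x - y x) z) B"
      using has_sum_cinner_right[OF y[of z]] zy[OF that] by simp
    moreover have "((\<lambda>e. cinner (x - y x) (cinner z e *\<^sub>C e)) has_sum 0) B"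
      using orth by (intro has_sum_0) (auto simp: cinner_scaleC_right)
    ultimately show ?thesis using has_sum_unique by blast
  qed
  then show ?thesis using y yW by blast
qed

text \<open>A candidate that has the right properties settles both existence and uniqueness in the
  definite description, so this also computes projections onto subspaces whose closedness is
  open.\<close>

lemma orth_proj_eqI:
  assumes W: "csubspace W" and y: "y \<in> W" "\<And>z. z \<in> W \<Longrightarrow> cinner (x - y) z = 0"
  shows "orth_proj W x = y"
  unfolding orth_proj_def
proof (rule the_equality)
  fix y' assume y': "y' \<in> W \<and> (\<forall>z\<in>W. cinner (x - y') z = 0)"
  have "y' - y \<in> W" using W y y' csubspace_diff by blast
  then have "cinner (x - y) (y' - y) - cinner (x - y') (y' - y) = 0" using y y' by simp
  then have "cinner (y' - y) (y' - y) = 0" by (simp add: cinner_diff_left)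
  then show "y' = y" by (simp add: cinner_self_eq_0_iff)
qed (use y in auto)

lemma onb_some_onb: "onb_of UNIV (some_onb :: 'a::chilbert_space set)"
  unfolding some_onb_def by (rule someI_ex) (simp add: onb_exists)

lemma orthonormal_some_onb: "orthonormal (some_onb :: 'a::chilbert_space set)"
  using onb_some_onb by (auto simp: onb_of_iff)

lemma some_onb_expansion: "((\<lambda>e. cinner x e *\<^sub>C e) has_sum x) (some_onb :: 'a::chilbert_space set)"
proof -
  obtain y where y: "((\<lambda>e. cinner x e *\<^sub>C e) has_sum y) (some_onb :: 'a::chilbert_space set)"
    "\<forall>z. cinner (x - y) z = 0"
    using onb_expansion[OF closed_csubspace_UNIV onb_some_onb, of x] by auto
  then have "cinner (x - y) (x - y) = 0" by simp
  then have "x - y = 0" unfolding cinner_self_eq_0_iff .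
  then show ?thesis using y by simp
qed

lemma Parseval: "((\<lambda>e. cinner x e * cinner e y) has_sum cinner x y) (some_onb :: 'a::chilbert_space set)"
  using has_sum_cinner_left[OF some_onb_expansion, of x y] by (simp add: cinner_scaleC_left)

lemma Parseval_norm: "((\<lambda>e. (cmod (cinner x e))\<^sup>2) has_sum (norm x)\<^sup>2) (some_onb :: 'a::chilbert_space set)"
proof -
  have "((\<lambda>e. cinner x e * cinner e x) has_sum cinner x x) some_onb" by (rule Parseval)
  moreover have "cinner x e * cinner e x = complex_of_real ((cmod (cinner x e))\<^sup>2)" for e
    unfolding cinner_commute[of e x] by (rule complex_norm_square[symmetric])
  ultimately have "((\<lambda>e. complex_of_real ((cmod (cinner x e))\<^sup>2)) has_sum complex_of_real ((norm x)\<^sup>2)) some_onb"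
    by (simp only: norm_cinner)
  then have "((\<lambda>e. Re (complex_of_real ((cmod (cinner x e))\<^sup>2))) has_sum Re (complex_of_real ((norm x)\<^sup>2))) some_onb"
    by (rule has_sum_Re)
  then show ?thesis by simp
qed

context
  fixes W :: "'a::chilbert_space set"
  assumes W: "closed_csubspace W"
begin

lemma orth_proj_in: "orth_proj W x \<in> W"
  and orth_proj_orth: "z \<in> W \<Longrightarrow> cinner (x - orth_proj W x) z = 0"
proof -
  have cs: "csubspace W" using W by (simp add: closed_csubspace_iff)
  obtain B where B: "onb_of W B" using onb_exists[OF cs] by blast
  obtain y where y: "y \<in> W" "\<forall>z\<in>W. cinner (x - y) z = 0" using onb_expansion[OF W B, of x] by auto
  then have "orth_proj W x = y" using orth_proj_eqI[OF cs] by blast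
  then show "orth_proj W x \<in> W" and "z \<in> W \<Longrightarrow> cinner (x - orth_proj W x) z = 0" using y by auto
qed

lemma orth_proj_cinner_left: "z \<in> W \<Longrightarrow> cinner (orth_proj W x) z = cinner x z"
  using orth_proj_orth[of z x] by (simp add: cinner_diff_left)

lemma orth_proj_cinner_right: "z \<in> W \<Longrightarrow> cinner z (orth_proj W x) = cinner z x"
  using orth_proj_cinner_left[of z x] cinner_commute[of z x] cinner_commute[of z "orth_proj W x"] by simp

lemma orth_proj_selfadj: "cinner (orth_proj W x) y = cinner x (orth_proj W y)"
  using orth_proj_cinner_left[of "orth_proj W y" x] orth_proj_cinner_right[of "orth_proj W x" y]
  by (simp add: orth_proj_in)

lemma orth_proj_id: "x \<in> W \<Longrightarrow> orth_proj W x = x"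
  using W by (intro orth_proj_eqI) (auto simp: closed_csubspace_iff)

lemma orth_proj_add: "orth_proj W (x + y) = orth_proj W x + orth_proj W y"
  by (rule cinner_ext) (simp add: orth_proj_selfadj cinner_add_left)

lemma orth_proj_scaleC: "orth_proj W (c *\<^sub>C x) = c *\<^sub>C orth_proj W x"
  by (rule cinner_ext) (simp add: orth_proj_selfadj cinner_scaleC_left)

lemma orth_proj_norm_le: "norm (orth_proj W x) \<le> norm x"
proof -
  have "complex_of_real ((norm (orth_proj W x))\<^sup>2) = cinner x (orth_proj W x)"
    by (metis norm_cinner orth_proj_in orth_proj_cinner_left)
  then have "(norm (orth_proj W x))\<^sup>2 \<le> norm x * norm (orth_proj W x)"
    using cinner_Cauchy_Schwarz[of x "orth_proj W x"] by (metis norm_of_real abs_power2)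
  then show ?thesis by (cases "orth_proj W x = 0") (auto simp: power2_eq_square)
qed

lemma bounded_clinear_orth_proj: "bounded_clinear (orth_proj W)"
  unfolding bounded_clinear_def clinear_on_def
  by (auto simp: orth_proj_add orth_proj_scaleC scaleR_scaleC orth_proj_norm_le
    intro!: bounded_linear_intro[where K = 1])

end

section \<open>Hilbert--Schmidt and trace class operators\<close>

lemma bounded_clinear_bounded_linear: "bounded_clinear T \<Longrightarrow> bounded_linear T"
  by (simp add: bounded_clinear_def)

lemma bounded_clinear_plus:
  "bounded_clinear A \<Longrightarrow> bounded_clinear B \<Longrightarrow> bounded_clinear (\<lambda>x. A x + B x)"
  by (auto simp: bounded_clinear_def clinear_on_def scaleC_add_right bounded_linear_add)

lemma bounded_clinear_scale: "bounded_clinear A \<Longrightarrow> bounded_clinear (\<lambda>x. c *\<^sub>C A x)"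
  using bounded_linear_compose[OF bounded_linear_scaleC, of A c]
  by (auto simp: bounded_clinear_def clinear_on_def scaleC_add_right scaleC_scaleC mult.commute)

lemma bounded_clinear_zero: "bounded_clinear (\<lambda>x. 0)"
  by (auto simp: bounded_clinear_def clinear_on_def)

lemma norm_add_sq_le: "(norm (a + b))\<^sup>2 \<le> 2 * (norm a)\<^sup>2 + 2 * (norm (b::'a::real_normed_vector))\<^sup>2"
proof -
  have "(norm (a + b))\<^sup>2 \<le> (norm a + norm b)\<^sup>2" by (simp add: norm_triangle_ineq power_mono)
  also have "\<dots> \<le> 2 * (norm a)\<^sup>2 + 2 * (norm b)\<^sup>2"
    using sum_squares_bound[of "norm a" "norm b"] by (simp add: power2_sum)
  finally show ?thesis .
qed

lemma square_summable_add:
  fixes f g :: "'i \<Rightarrow> 'a::real_normed_vector"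
  assumes "(\<lambda>i. (norm (f i))\<^sup>2) summable_on A" "(\<lambda>i. (norm (g i))\<^sup>2) summable_on A"
  shows "(\<lambda>i. (norm (f i + g i))\<^sup>2) summable_on A"
proof (rule summable_on_comparison_test)
  show "(\<lambda>i. 2 * (norm (f i))\<^sup>2 + 2 * (norm (g i))\<^sup>2) summable_on A"
    by (rule summable_on_add[OF summable_on_cmult_right[OF assms(1)] summable_on_cmult_right[OF assms(2)]])
qed (rule norm_add_sq_le, simp)

lemma square_summable_sum:
  fixes f :: "'j \<Rightarrow> 'i \<Rightarrow> 'a::real_normed_vector"
  shows "(\<And>j. j \<in> J \<Longrightarrow> (\<lambda>i. (norm (f j i))\<^sup>2) summable_on A) \<Longrightarrow>
    (\<lambda>i. (norm (\<Sum>j\<in>J. f j i))\<^sup>2) summable_on A"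
  by (induction J rule: infinite_finite_induct) (auto intro!: square_summable_add)

section \<open>Hilbert--Schmidt operators and their sums\<close>

lemma hilbert_schmidt_add:
  "hilbert_schmidt A \<Longrightarrow> hilbert_schmidt B \<Longrightarrow> hilbert_schmidt (\<lambda>x. A x + B x)"
  by (auto simp: hilbert_schmidt_def bounded_clinear_plus square_summable_add)

lemma hilbert_schmidt_scale: "hilbert_schmidt A \<Longrightarrow> hilbert_schmidt (\<lambda>x. c *\<^sub>C A x)"
  by (auto simp: hilbert_schmidt_def bounded_clinear_scale norm_scaleC power_mult_distrib
    intro: summable_on_cmult_right)

lemma hilbert_schmidt_sum:
  "(\<And>i. i \<in> I \<Longrightarrow> hilbert_schmidt (f i)) \<Longrightarrow> hilbert_schmidt (\<lambda>x. \<Sum>i\<in>I. f i x)"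
proof (induction I rule: infinite_finite_induct)
  case (insert i I)
  then show ?case using hilbert_schmidt_add[of "f i" "\<lambda>x. \<Sum>i\<in>I. f i x"] by simp
qed (auto simp: hilbert_schmidt_def bounded_clinear_zero)

lemma hilbert_schmidt_diff:
  assumes "hilbert_schmidt A" "hilbert_schmidt B"
  shows "hilbert_schmidt (\<lambda>x. A x - B x)"
  using hilbert_schmidt_add[OF assms(1) hilbert_schmidt_scale[OF assms(2), of "-1"]]
  by (simp add: scaleC_minus_one)

text \<open>Expand \<open>x\<close> in the basis and apply Cauchy--Schwarz to the coefficients and
  the images, on finite partial sums.\<close>

lemma norm_le_hs_norm:
  assumes "hilbert_schmidt T"
  shows "norm (T x) \<le> hs_norm T * norm x"
proof -
  have bl: "bounded_linear T" and sc: "\<And>c x. T (c *\<^sub>C x) = c *\<^sub>C T x"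
    and sq: "(\<lambda>e. (norm (T e))\<^sup>2) summable_on some_onb"
    using assms by (auto simp: hilbert_schmidt_def bounded_clinear_def clinear_on_def)
  have "((\<lambda>e. cinner x e *\<^sub>C T e) has_sum T x) some_onb"
    using has_sum_bounded_linear[OF bl some_onb_expansion[of x]] by (simp add: sc)
  then have lim: "((\<lambda>F. norm (\<Sum>e\<in>F. cinner x e *\<^sub>C T e)) \<longlongrightarrow> norm (T x)) (finite_subsets_at_top some_onb)"
    unfolding has_sum_def by (rule tendsto_norm)
  have "norm (\<Sum>e\<in>F. cinner x e *\<^sub>C T e) \<le> hs_norm T * norm x" if F: "finite F" "F \<subseteq> some_onb" for F
  proof -
    have "norm (\<Sum>e\<in>F. cinner x e *\<^sub>C T e) \<le> (\<Sum>e\<in>F. \<bar>cmod (cinner x e)\<bar> * \<bar>norm (T e)\<bar>)"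
      by (rule order_trans[OF norm_sum]) (simp add: norm_scaleC)
    also have "\<dots> \<le> L2_set (\<lambda>e. cmod (cinner x e)) F * L2_set (\<lambda>e. norm (T e)) F"
      by (rule L2_set_mult_ineq)
    also have "\<dots> \<le> norm x * hs_norm T"
    proof (intro mult_mono)
      show "L2_set (\<lambda>e. cmod (cinner x e)) F \<le> norm x"
        unfolding L2_set_def using Bessel_finite[OF orthonormal_subset[OF orthonormal_some_onb F(2)] F(1), of x]
        by (simp add: real_le_lsqrt sum_nonneg)
      show "L2_set (\<lambda>e. norm (T e)) F \<le> hs_norm T"
        unfolding L2_set_def hs_norm_def
        by (intro real_sqrt_le_mono finite_sum_le_infsum sq F) auto
    qed auto
    finally show ?thesis by (simp add: mult.commute)
  qed
  then show ?thesis
    by (intro tendsto_upperbound[OF lim] eventually_finite_subsets_at_top_weakI) auto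
qed

text \<open>Turns the convergence in condition (v) into convergence of vectors, which can be
  combined with unitaries and inner products.\<close>

lemma hs_has_sum_pointwise:
  assumes "hs_has_sum f A T"
  shows "((\<lambda>i. f i x) has_sum T x) A"
proof -
  let ?F = "finite_subsets_at_top A"
  have T: "hilbert_schmidt T" and f: "\<And>i. i \<in> A \<Longrightarrow> hilbert_schmidt (f i)"
    and lim: "((\<lambda>F. hs_norm (\<lambda>x. T x - (\<Sum>i\<in>F. f i x))) \<longlongrightarrow> 0) ?F"
    using assms by (auto simp: hs_has_sum_def)
  have lim2: "((\<lambda>F. hs_norm (\<lambda>x. T x - (\<Sum>i\<in>F. f i x)) * norm x) \<longlongrightarrow> 0) ?F"
    using tendsto_mult_right[OF lim, of "norm x"] by simp
  have "((\<lambda>F. (\<Sum>i\<in>F. f i x) - T x) \<longlongrightarrow> 0) ?F"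
  proof (rule Lim_null_comparison[OF eventually_finite_subsets_at_top_weakI lim2])
    fix F assume "finite F" "F \<subseteq> A"
    then have "hilbert_schmidt (\<lambda>x. T x - (\<Sum>i\<in>F. f i x))"
      by (intro hilbert_schmidt_diff hilbert_schmidt_sum T f) auto
    from norm_le_hs_norm[OF this, of x]
    show "norm ((\<Sum>i\<in>F. f i x) - T x) \<le> hs_norm (\<lambda>x. T x - (\<Sum>i\<in>F. f i x)) * norm x"
      by (simp add: norm_minus_commute)
  qed
  then show ?thesis unfolding has_sum_def by (rule iffD2[OF Lim_null])
qed

lemma has_sum_finite_sum:
  fixes f :: "'j \<Rightarrow> 'i \<Rightarrow> 'a::topological_comm_monoid_add"
  shows "(\<And>j. j \<in> J \<Longrightarrow> (f j has_sum s j) A) \<Longrightarrow> ((\<lambda>i. \<Sum>j\<in>J. f j i) has_sum (\<Sum>j\<in>J. s j)) A"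
  by (induction J rule: infinite_finite_induct) (auto intro!: has_sum_add)

text \<open>Each summand has square sum equal to the product of the squared norms of
  \<open>u i\<close> and \<open>v i\<close>, by Parseval.\<close>

lemma hilbert_schmidt_finite_rank:
  fixes u v :: "'i \<Rightarrow> 'a::chilbert_space"
  shows "hilbert_schmidt (\<lambda>x. \<Sum>i\<in>I. cinner x (u i) *\<^sub>C v i)"
proof (rule hilbert_schmidt_sum)
  fix i
  have "bounded_clinear (\<lambda>x. cinner x (u i) *\<^sub>C v i)"
    unfolding bounded_clinear_def clinear_on_def
  proof (intro conjI)
    show "bounded_linear (\<lambda>x. cinner x (u i) *\<^sub>C v i)"
    proof (rule bounded_linear_intro[where K = "norm (u i) * norm (v i)"])
      show "norm (cinner x (u i) *\<^sub>C v i) \<le> norm x * (norm (u i) * norm (v i))" for x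
        unfolding norm_scaleC mult.assoc[symmetric] by (rule mult_right_mono[OF cinner_Cauchy_Schwarz norm_ge_zero])
    qed (simp_all add: cinner_add_left scaleC_add_left scaleR_scaleC cinner_scaleC_left scaleC_scaleC)
  qed (simp_all add: cinner_add_left scaleC_add_left cinner_scaleC_left scaleC_scaleC)
  moreover have "(\<lambda>e. (norm (cinner e (u i) *\<^sub>C v i))\<^sup>2) summable_on some_onb"
  proof -
    have "(\<lambda>e. (cmod (cinner (u i) e))\<^sup>2 * (norm (v i))\<^sup>2) summable_on some_onb"
      by (rule summable_on_cmult_left[OF has_sum_imp_summable[OF Parseval_norm]])
    moreover have "(norm (cinner e (u i) *\<^sub>C v i))\<^sup>2 = (cmod (cinner (u i) e))\<^sup>2 * (norm (v i))\<^sup>2" for e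
      using cinner_commute[of e "u i"] by (simp add: norm_scaleC power_mult_distrib)
    ultimately show ?thesis by simp
  qed
  ultimately show "hilbert_schmidt (\<lambda>x. cinner x (u i) *\<^sub>C v i)" by (simp add: hilbert_schmidt_def)
qed

text \<open>Expanding \<open>B e\<close> bounds the sum of \<open>|\<langle>A B e, e\<rangle>|\<close> by the sum of \<open>|\<langle>B e, f\<rangle>|\<^sup>2 + |\<langle>A f, e\<rangle>|\<^sup>2\<close>,
  so that adjoints are not needed.\<close>

lemma trace_class_summable:
  fixes T :: "'a::chilbert_space \<Rightarrow> 'a"
  assumes "trace_class T"
  shows "(\<lambda>e. cmod (cinner (T e) e)) summable_on some_onb"
proof -
  obtain A B :: "'a \<Rightarrow> 'a" where A: "hilbert_schmidt A" and B: "hilbert_schmidt B" and T: "T = A \<circ> B"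
    using assms by (auto simp: trace_class_def)
  have blA: "bounded_linear A" and scA: "\<And>c x. A (c *\<^sub>C x) = c *\<^sub>C A x"
    and sqA: "(\<lambda>e. (norm (A e))\<^sup>2) summable_on some_onb"
    and sqB: "(\<lambda>e. (norm (B e))\<^sup>2) summable_on some_onb"
    using A B by (auto simp: hilbert_schmidt_def bounded_clinear_def clinear_on_def)
  have exp: "((\<lambda>f. cinner (B e) f * cinner (A f) e) has_sum cinner (T e) e) some_onb" for e
    using has_sum_cinner_left[OF has_sum_bounded_linear[OF blA some_onb_expansion[of "B e"]], of e]
    by (simp add: scA cinner_scaleC_left T)
  define C where "C = (\<Sum>\<^sub>\<infinity>e\<in>some_onb. (norm (B e))\<^sup>2) + (\<Sum>\<^sub>\<infinity>e\<in>some_onb. (norm (A e))\<^sup>2)"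
  have bound: "(\<Sum>e\<in>F. cmod (cinner (T e) e)) \<le> C" if F: "finite F" "F \<subseteq> some_onb" for F
  proof -
    have nf: "norm f = 1" if "f \<in> some_onb" for f :: 'a
      using orthonormal_some_onb that by (auto simp: orthonormal_def)
    have oF: "orthonormal F" using F orthonormal_some_onb orthonormal_subset by blast
    have sA: "(\<lambda>f. (cmod (cinner (A f) e))\<^sup>2) summable_on some_onb" if "e \<in> F" for e
    proof (rule summable_on_comparison_test[OF sqA])
      fix f
      have "cmod (cinner (A f) e) \<le> norm (A f)"
        using cinner_Cauchy_Schwarz[of "A f" e] nf[of e] that F by auto
      then show "(cmod (cinner (A f) e))\<^sup>2 \<le> (norm (A f))\<^sup>2" by (simp add: power_mono)
    qed auto
    have sB: "((\<lambda>f. (cmod (cinner (B e) f))\<^sup>2) has_sum (norm (B e))\<^sup>2) some_onb" for e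
      by (rule Parseval_norm)
    have one: "cmod (cinner (T e) e) \<le> (norm (B e))\<^sup>2 + (\<Sum>\<^sub>\<infinity>f\<in>some_onb. (cmod (cinner (A f) e))\<^sup>2)"
      if "e \<in> F" for e
    proof -
      let ?g = "\<lambda>f. (cmod (cinner (B e) f))\<^sup>2 + (cmod (cinner (A f) e))\<^sup>2"
      have g: "(?g has_sum ((norm (B e))\<^sup>2 + (\<Sum>\<^sub>\<infinity>f\<in>some_onb. (cmod (cinner (A f) e))\<^sup>2))) some_onb"
        using that by (intro has_sum_add sB has_sum_infsum sA)
      have le: "norm (cinner (B e) f * cinner (A f) e) \<le> ?g f" for f
        using sum_squares_bound[of "cmod (cinner (B e) f)" "cmod (cinner (A f) e)"]
          mult_nonneg_nonneg[OF norm_ge_zero norm_ge_zero, of "cinner (B e) f" "cinner (A f) e"]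
        unfolding norm_mult by linarith
      have abs: "(\<lambda>f. norm (cinner (B e) f * cinner (A f) e)) summable_on some_onb"
        by (rule summable_on_comparison_test[OF has_sum_imp_summable[OF g]]) (use le in auto)
      have "cmod (cinner (T e) e) \<le> (\<Sum>\<^sub>\<infinity>f\<in>some_onb. norm (cinner (B e) f * cinner (A f) e))"
        by (rule norm_has_sum_bound[OF has_sum_infsum[OF abs] exp])
      also have "\<dots> \<le> (norm (B e))\<^sup>2 + (\<Sum>\<^sub>\<infinity>f\<in>some_onb. (cmod (cinner (A f) e))\<^sup>2)"
        by (rule has_sum_mono[OF has_sum_infsum[OF abs] g]) (use le in auto)
      finally show ?thesis .
    qed
    have "(\<Sum>e\<in>F. cmod (cinner (T e) e))
        \<le> (\<Sum>e\<in>F. (norm (B e))\<^sup>2) + (\<Sum>e\<in>F. \<Sum>\<^sub>\<infinity>f\<in>some_onb. (cmod (cinner (A f) e))\<^sup>2)"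
      unfolding sum.distrib[symmetric] by (rule sum_mono) (rule one)
    also have "(\<Sum>e\<in>F. (norm (B e))\<^sup>2) \<le> (\<Sum>\<^sub>\<infinity>e\<in>some_onb. (norm (B e))\<^sup>2)"
      by (rule finite_sum_le_infsum[OF sqB F]) auto
    \<comment> \<open>After exchanging the finite sum with the sum over \<open>f\<close>, Bessel for
      the finite orthonormal set \<open>F\<close> bounds the sum over \<open>e\<close> by the
      squared norm of \<open>A f\<close>.\<close>
    also have "(\<Sum>e\<in>F. \<Sum>\<^sub>\<infinity>f\<in>some_onb. (cmod (cinner (A f) e))\<^sup>2) \<le> (\<Sum>\<^sub>\<infinity>e\<in>some_onb. (norm (A e))\<^sup>2)"
      by (rule has_sum_mono[OF has_sum_finite_sum[OF has_sum_infsum[OF sA]] has_sum_infsum[OF sqA]])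
        (auto intro: Bessel_finite oF F)
    finally show ?thesis by (simp add: C_def)
  qed
  show ?thesis
    using bound by (intro nonneg_bdd_above_summable_on bdd_aboveI[of _ C]) auto
qed

text \<open>An \<open>infsum\<close> is 0 when summability fails; here the trace is a genuine
  sum.\<close>

lemma ctrace_has_sum:
  "trace_class T \<Longrightarrow> ((\<lambda>e. cinner (T e) e) has_sum ctrace T) some_onb"
  unfolding ctrace_def by (rule has_sum_infsum, rule abs_summable_summable, rule trace_class_summable)

text \<open>Parseval, term by term. It is used in both spaces: in the completion for the Hecke
  operator and in the original space for the blocks of the double coset sum.\<close>

lemma finite_rank_trace:
  fixes u :: "'i \<Rightarrow> 'a::chilbert_space"
  shows "((\<lambda>e. \<Sum>i\<in>I. \<Sum>k\<in>K. \<alpha> i k * cinner e (u i) * cinner (v k) e) has_sum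
    (\<Sum>i\<in>I. \<Sum>k\<in>K. \<alpha> i k * cinner (v k) (u i))) some_onb"
proof (rule has_sum_finite_sum, rule has_sum_finite_sum)
  fix i k
  have "((\<lambda>e. \<alpha> i k * (cinner (v k) e * cinner e (u i))) has_sum \<alpha> i k * cinner (v k) (u i)) some_onb"
    by (rule has_sum_cmult_right[OF Parseval])
  then show "((\<lambda>e. \<alpha> i k * cinner e (u i) * cinner (v k) e) has_sum \<alpha> i k * cinner (v k) (u i)) some_onb"
    by (simp add: mult_ac)
qed

section \<open>Almost normal subgroups and coset representatives\<close>

context group
begin

lemma inv_cancel_left [simp]:
  "x \<in> carrier G \<Longrightarrow> y \<in> carrier G \<Longrightarrow> inv x \<otimes> (x \<otimes> y) = y"
  "x \<in> carrier G \<Longrightarrow> y \<in> carrier G \<Longrightarrow> x \<otimes> (inv x \<otimes> y) = y"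
  by (simp_all add: m_assoc[symmetric])

section \<open>Conjugates of sets and subgroups\<close>

lemma conj_set_eq: "conj_set G g A = (\<lambda>a. g \<otimes> a \<otimes> inv g) ` A"
  by (auto simp: conj_set_def l_coset_def r_coset_def)

lemma conj_set_carrier: "A \<subseteq> carrier G \<Longrightarrow> g \<in> carrier G \<Longrightarrow> conj_set G g A \<subseteq> carrier G"
  by (auto simp: conj_set_eq)

lemma mem_conj_set:
  assumes "A \<subseteq> carrier G" "g \<in> carrier G"
  shows "x \<in> conj_set G g A \<longleftrightarrow> x \<in> carrier G \<and> inv g \<otimes> x \<otimes> g \<in> A"
proof -
  have "inv g \<otimes> (g \<otimes> a \<otimes> inv g) \<otimes> g = a" if "a \<in> carrier G" for a
    using that assms by (simp add: m_assoc)
  moreover have "g \<otimes> (inv g \<otimes> x \<otimes> g) \<otimes> inv g = x" if "x \<in> carrier G"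
    using that assms by (simp add: m_assoc)
  ultimately show ?thesis
    using assms unfolding conj_set_eq by (auto simp: subset_iff) (metis image_eqI)
qed

lemma conj_set_mult:
  assumes "A \<subseteq> carrier G" "g \<in> carrier G" "h \<in> carrier G"
  shows "conj_set G g (conj_set G h A) = conj_set G (g \<otimes> h) A"
  unfolding conj_set_eq image_image
  using assms by (intro image_cong refl) (auto simp: m_assoc inv_mult_group subset_iff)

lemma conj_set_Int:
  assumes "A \<subseteq> carrier G" "B \<subseteq> carrier G" "g \<in> carrier G"
  shows "conj_set G g (A \<inter> B) = conj_set G g A \<inter> conj_set G g B"
  using assms by (auto simp: mem_conj_set le_infI1)

lemma conj_set_subgroup_self:
  assumes A: "subgroup A G" and g: "g \<in> A"
  shows "conj_set G g A = A"
proof -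
  have gc: "g \<in> carrier G" and Ac: "A \<subseteq> carrier G" using A g subgroup.subset by auto
  have "x \<in> A" if "x \<in> carrier G" "inv g \<otimes> x \<otimes> g \<in> A" for x
  proof -
    have "g \<otimes> (inv g \<otimes> x \<otimes> g) \<otimes> inv g \<in> A"
      using A g that by (simp add: subgroup.m_closed subgroup.m_inv_closed)
    then show ?thesis using that gc by (simp add: m_assoc)
  qed
  moreover have "inv g \<otimes> x \<otimes> g \<in> A" if "x \<in> A" for x
    using A g that by (simp add: subgroup.m_closed subgroup.m_inv_closed)
  ultimately show ?thesis using Ac gc by (auto simp: mem_conj_set)
qed

text \<open>Conjugation by \<open>g\<close> exchanges the two groups that are intersected. So
  \<open>U g\<close>, applied to a formal sum over the level for \<open>inv g\<close>, lands at the
  level for \<open>g\<close>.\<close>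

lemma conj_inter_conj:
  assumes A: "A \<subseteq> carrier G" and g: "g \<in> carrier G"
  shows "conj_set G g (conj_inter G A (inv g)) = conj_inter G A g"
proof -
  have "conj_set G g (conj_set G (inv g) A) = conj_set G \<one> A"
    using assms by (simp add: conj_set_mult)
  also have "\<dots> = A" using A by (auto simp: mem_conj_set subset_iff)
  finally show ?thesis
    using assms by (simp add: conj_inter_def conj_set_Int conj_set_carrier Int_commute)
qed

lemma subgroup_conj_set:
  assumes A: "subgroup A G" and g: "g \<in> carrier G"
  shows "subgroup (conj_set G g A) G"
proof (rule subgroupI)
  have Ac: "A \<subseteq> carrier G" by (rule subgroup.subset[OF A])
  show "conj_set G g A \<subseteq> carrier G" by (rule conj_set_carrier[OF Ac g])
  show "conj_set G g A \<noteq> {}" using subgroup.one_closed[OF A] by (auto simp: conj_set_eq)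
  fix x y assume x: "x \<in> conj_set G g A"
  then have xc: "x \<in> carrier G" and xA: "inv g \<otimes> x \<otimes> g \<in> A" using Ac g by (auto simp: mem_conj_set)
  have "inv (inv g \<otimes> x \<otimes> g) \<in> A" by (rule subgroup.m_inv_closed[OF A xA])
  then show "inv x \<in> conj_set G g A"
    using Ac g xc by (simp add: mem_conj_set inv_mult_group m_assoc)
  assume y: "y \<in> conj_set G g A"
  then have yc: "y \<in> carrier G" and yA: "inv g \<otimes> y \<otimes> g \<in> A" using Ac g by (auto simp: mem_conj_set)
  have "(inv g \<otimes> x \<otimes> g) \<otimes> (inv g \<otimes> y \<otimes> g) \<in> A" by (rule subgroup.m_closed[OF A xA yA])
  then show "x \<otimes> y \<in> conj_set G g A"
    using Ac g xc yc by (simp add: mem_conj_set m_assoc)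
qed

section \<open>Coverings by finitely many right cosets\<close>

lemma mem_r_coset:
  assumes "B \<subseteq> carrier G" "x \<in> carrier G" "r \<in> carrier G"
  shows "x \<in> B #> r \<longleftrightarrow> x \<otimes> inv r \<in> B"
proof -
  have "x = x \<otimes> inv r \<otimes> r" using assms by (simp add: m_assoc)
  moreover have "b \<otimes> r \<otimes> inv r = b" if "b \<in> B" for b
    using that assms by (auto simp: m_assoc subset_iff)
  ultimately show ?thesis unfolding r_coset_def by auto
qed

lemma r_coset_eq_image: "B #> r = (\<lambda>b. b \<otimes> r) ` B"
  by (auto simp: r_coset_def)

text \<open>Finite index in a form that also compares groups that are not nested, such as \<Gamma>
  and its conjugates. Transitivity and stability under conjugation and intersection become
  direct.\<close>

definition finitely_covered :: "'a set \<Rightarrow> 'a set \<Rightarrow> bool"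
  where "finitely_covered A B \<longleftrightarrow> (\<exists>F. finite F \<and> F \<subseteq> carrier G \<and> A \<subseteq> (\<Union>f\<in>F. B #> f))"

lemma finitely_covered_mono: "finitely_covered A B \<Longrightarrow> B \<subseteq> C \<Longrightarrow> finitely_covered A C"
  unfolding finitely_covered_def r_coset_eq_image by (meson SUP_mono' image_mono subset_trans)

text \<open>Two elements lying in the same coset of \<open>B\<close> and in the same coset of
  \<open>C\<close> have their quotient in both groups, so one representative per cell of the common
  refinement is enough.\<close>

lemma finitely_covered_Int:
  assumes B: "subgroup B G" and C: "subgroup C G" and A: "A \<subseteq> carrier G"
    and "finitely_covered A B" "finitely_covered A C"
  shows "finitely_covered A (B \<inter> C)"
proof -
  obtain F E where F: "finite F" "F \<subseteq> carrier G" "A \<subseteq> (\<Union>f\<in>F. B #> f)"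
    and E: "finite E" "E \<subseteq> carrier G" "A \<subseteq> (\<Union>f\<in>E. C #> f)"
    using assms by (auto simp: finitely_covered_def)
  define c where "c f e = (SOME x. x \<in> A \<and> x \<in> B #> f \<and> x \<in> C #> e)" for f e
  \<comment> \<open>For an empty cell the choice \<open>c f e\<close> is arbitrary; the condition of
    membership in \<open>A\<close> keeps the representatives inside the carrier.\<close>
  let ?D = "(\<lambda>p. c (fst p) (snd p)) ` {p \<in> F \<times> E. c (fst p) (snd p) \<in> A}"
  have "finite ?D" using F E by simp
  moreover have "?D \<subseteq> carrier G" using A by auto
  moreover have "A \<subseteq> (\<Union>d\<in>?D. (B \<inter> C) #> d)"
  proof
    fix a assume a: "a \<in> A"
    obtain f e where fe: "f \<in> F" "a \<in> B #> f" "e \<in> E" "a \<in> C #> e" using a F E by blast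
    have c: "c f e \<in> A \<and> c f e \<in> B #> f \<and> c f e \<in> C #> e"
      unfolding c_def by (rule someI[of _ a]) (use a fe in auto)
    have ac: "a \<in> carrier G" "c f e \<in> carrier G" "f \<in> carrier G" "e \<in> carrier G"
      using a c A F E fe by auto
    have quot: "a \<otimes> inv (c f e) \<in> X" if X: "subgroup X G" and g: "g \<in> carrier G" "a \<in> X #> g" "c f e \<in> X #> g" for X g
    proof -
      have Xc: "X \<subseteq> carrier G" by (rule subgroup.subset[OF X])
      have "(a \<otimes> inv g) \<otimes> inv (c f e \<otimes> inv g) \<in> X"
        using X g ac Xc by (simp add: mem_r_coset subgroup.m_closed subgroup.m_inv_closed)
      then show ?thesis using ac g by (simp add: inv_mult_group m_assoc)
    qed
    have "a \<otimes> inv (c f e) \<in> B \<inter> C" using quot[OF B, of f] quot[OF C, of e] ac fe c by auto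
    then have "a \<in> (B \<inter> C) #> c f e"
      using ac subgroup.subset[OF B] by (subst mem_r_coset) auto
    then show "a \<in> (\<Union>d\<in>?D. (B \<inter> C) #> d)"
      using fe(1,3) c by (intro UN_I[of "c f e"] image_eqI[of _ _ "(f, e)"]) auto
  qed
  ultimately show ?thesis unfolding finitely_covered_def by blast
qed

lemma finitely_covered_conj_set:
  assumes "finitely_covered A B" "A \<subseteq> carrier G" "B \<subseteq> carrier G" "g \<in> carrier G"
  shows "finitely_covered (conj_set G g A) (conj_set G g B)"
proof -
  obtain F where F: "finite F" "F \<subseteq> carrier G" "A \<subseteq> (\<Union>f\<in>F. B #> f)"
    using assms by (auto simp: finitely_covered_def)
  have "conj_set G g A \<subseteq> (\<Union>f\<in>conj_set G g F. conj_set G g B #> f)"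
  proof
    fix x assume "x \<in> conj_set G g A"
    then obtain a where a: "a \<in> A" "x = g \<otimes> a \<otimes> inv g" by (auto simp: conj_set_eq)
    obtain f b where f: "f \<in> F" "b \<in> B" "a = b \<otimes> f" using a F by (auto simp: r_coset_eq_image)
    have "x = (g \<otimes> b \<otimes> inv g) \<otimes> (g \<otimes> f \<otimes> inv g)"
      using a f assms F by (auto simp: m_assoc subset_iff)
    then show "x \<in> (\<Union>f\<in>conj_set G g F. conj_set G g B #> f)"
      using f by (auto simp: conj_set_eq r_coset_eq_image)
  qed
  then show ?thesis unfolding finitely_covered_def
    using F assms by (intro exI[of _ "conj_set G g F"]) (auto simp: conj_set_carrier conj_set_eq)
qed

lemma finitely_covered_trans:
  assumes "finitely_covered A B" "finitely_covered B C" "C \<subseteq> carrier G"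
  shows "finitely_covered A C"
proof -
  obtain F E where F: "finite F" "F \<subseteq> carrier G" "A \<subseteq> (\<Union>f\<in>F. B #> f)"
    and E: "finite E" "E \<subseteq> carrier G" "B \<subseteq> (\<Union>f\<in>E. C #> f)"
    using assms by (auto simp: finitely_covered_def)
  have "A \<subseteq> (\<Union>d\<in>(\<lambda>(e, f). e \<otimes> f) ` (E \<times> F). C #> d)"
  proof
    fix a assume "a \<in> A"
    then obtain f b where f: "f \<in> F" "b \<in> B" "a = b \<otimes> f" using F by (auto simp: r_coset_eq_image)
    then obtain e c where e: "e \<in> E" "c \<in> C" "b = c \<otimes> e" using E by (auto simp: r_coset_eq_image)
    have "a = c \<otimes> (e \<otimes> f)" using e f E F assms by (auto simp: m_assoc subset_iff)
    then show "a \<in> (\<Union>d\<in>(\<lambda>(e, f). e \<otimes> f) ` (E \<times> F). C #> d)"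
      using e f by (auto simp: r_coset_eq_image)
  qed
  moreover have "(\<lambda>(e, f). e \<otimes> f) ` (E \<times> F) \<subseteq> carrier G" using E F by auto
  ultimately show ?thesis
    unfolding finitely_covered_def using E F by (intro exI[of _ "(\<lambda>(e, f). e \<otimes> f) ` (E \<times> F)"]) auto
qed

section \<open>Systems of right coset representatives\<close>

lemma right_transversalD:
  assumes "right_transversal G A B R"
  shows "R \<subseteq> A" and "a \<in> A \<Longrightarrow> \<exists>r\<in>R. a \<in> B #> r"
    and "a \<in> A \<Longrightarrow> r \<in> R \<Longrightarrow> s \<in> R \<Longrightarrow> a \<in> B #> r \<Longrightarrow> a \<in> B #> s \<Longrightarrow> r = s"
  using assms unfolding right_transversal_def by blast+

lemma right_transversal_exists:
  assumes A: "subgroup A G" and B: "subgroup B G" and BA: "B \<subseteq> A"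
  shows "\<exists>R. right_transversal G A B R"
proof -
  have Ac: "A \<subseteq> carrier G" and Bc: "B \<subseteq> carrier G" using A B by (auto dest: subgroup.subset)
  \<comment> \<open>The choice depends on the set \<open>B #> a\<close> alone, so elements of one
    coset get the same representative.\<close>
  define p where "p a = (SOME x. x \<in> B #> a)" for a
  have p: "p a \<in> B #> a" if "a \<in> A" for a
    unfolding p_def by (rule someI[of _ a]) (use that Ac in \<open>auto simp: rcos_self B\<close>)
  have eqc: "B #> p a = B #> a" if "a \<in> A" for a
    using repr_independence[OF p[OF that] _ B] that Ac by auto
  have self: "a \<in> B #> a" if "a \<in> A" for a using that Ac by (auto simp: rcos_self B)
  have sub: "B #> a \<subseteq> A" if "a \<in> A" for a
    using that A BA by (auto simp: r_coset_eq_image subgroup.m_closed subset_iff)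
  have "right_transversal G A B (p ` A)"
    unfolding right_transversal_def
  proof (intro conjI ballI)
    show "p ` A \<subseteq> A" using p sub by blast
    fix a assume a: "a \<in> A"
    show "\<exists>!r. r \<in> p ` A \<and> a \<in> B #> r"
    proof (rule ex1I[of _ "p a"])
      show "p a \<in> p ` A \<and> a \<in> B #> p a" using a eqc self by auto
      fix r assume "r \<in> p ` A \<and> a \<in> B #> r"
      then obtain b where b: "b \<in> A" "r = p b" "a \<in> B #> b" using eqc by auto
      have "B #> b = B #> a" using repr_independence[OF b(3) _ B] b Ac by auto
      then show "r = p a" using b by (simp add: p_def)
    qed
  qed
  then show ?thesis by blast
qed

lemma right_transversal_card:
  assumes A: "subgroup A G" and B: "subgroup B G" and BA: "B \<subseteq> A" and R: "right_transversal G A B R"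
  shows "card R = index_in G A B"
proof -
  have Ac: "A \<subseteq> carrier G" and Bc: "B \<subseteq> carrier G" using A B by (auto dest: subgroup.subset)
  have RA: "R \<subseteq> A" by (rule right_transversalD[OF R])
  have cos: "cosets_in G A B = (\<lambda>a. B #> a) ` A"
    by (auto simp: cosets_in_def RCOSETS_def r_coset_def)
  have self: "a \<in> B #> a" if "a \<in> A" for a using that Ac by (auto simp: rcos_self B)
  have "bij_betw (\<lambda>r. B #> r) R (cosets_in G A B)"
    unfolding bij_betw_def cos
  proof
    show "inj_on (\<lambda>r. B #> r) R"
      using right_transversalD(3)[OF R] self RA by (intro inj_onI) blast
    show "(\<lambda>r. B #> r) ` R = (\<lambda>r. B #> r) ` A"
    proof
      show "(\<lambda>r. B #> r) ` A \<subseteq> (\<lambda>r. B #> r) ` R"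
      proof
        fix X assume "X \<in> (\<lambda>r. B #> r) ` A"
        then obtain a where a: "a \<in> A" "X = B #> a" by auto
        then obtain r where r: "r \<in> R" "a \<in> B #> r" using right_transversalD(2)[OF R] by blast
        have "B #> r = B #> a" using repr_independence[OF r(2) _ B] r RA Ac by auto
        then show "X \<in> (\<lambda>r. B #> r) ` R" using a r by auto
      qed
    qed (use RA in auto)
  qed
  then show ?thesis unfolding index_in_def by (rule bij_betw_same_card)
qed

text \<open>Each representative lies in one of the covering cosets, and two representatives in the
  same covering coset would represent the same coset.\<close>

lemma right_transversal_finite:
  assumes A: "subgroup A G" and B: "subgroup B G" and R: "right_transversal G A B R"
    and cov: "finitely_covered A B"
  shows "finite R"
proof -
  have Ac: "A \<subseteq> carrier G" and Bc: "B \<subseteq> carrier G" using A B by (auto dest: subgroup.subset)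
  have RA: "R \<subseteq> A" by (rule right_transversalD[OF R])
  obtain F where F: "finite F" "F \<subseteq> carrier G" "A \<subseteq> (\<Union>f\<in>F. B #> f)"
    using cov by (auto simp: finitely_covered_def)
  have "\<forall>r\<in>R. \<exists>f\<in>F. r \<in> B #> f" using RA F by blast
  then obtain \<phi> where \<phi>: "\<And>r. r \<in> R \<Longrightarrow> \<phi> r \<in> F \<and> r \<in> B #> \<phi> r" by metis
  have "inj_on \<phi> R"
  proof (rule inj_onI)
    fix r s assume rs: "r \<in> R" "s \<in> R" "\<phi> r = \<phi> s"
    have c: "r \<in> carrier G" "s \<in> carrier G" "\<phi> r \<in> carrier G" using rs \<phi> RA Ac F by blast+
    have "B #> \<phi> r = B #> r" using repr_independence[of r B "\<phi> r"] \<phi>[OF rs(1)] c B by blast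
    moreover have "B #> \<phi> r = B #> s" using repr_independence[of s B "\<phi> r"] \<phi>[OF rs(2)] rs c B by simp
    ultimately show "r = s"
      using right_transversalD(3)[OF R, of r r s] rs RA rcos_self[OF c(1) B] by auto
  qed
  moreover have "\<phi> ` R \<subseteq> F" using \<phi> by auto
  ultimately show ?thesis using F(1) by (metis finite_imageD finite_subset)
qed

lemma right_transversal_partition:
  assumes A: "subgroup A G" and B: "subgroup B G" and BA: "B \<subseteq> A" and R: "right_transversal G A B R"
  shows "A = (\<Union>r\<in>R. B #> r)" and "r \<in> R \<Longrightarrow> s \<in> R \<Longrightarrow> r \<noteq> s \<Longrightarrow> (B #> r) \<inter> (B #> s) = {}"
proof -
  have RA: "R \<subseteq> A" by (rule right_transversalD[OF R])
  have sub: "B #> a \<subseteq> A" if "a \<in> A" for a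
    using that A BA by (auto simp: r_coset_eq_image subgroup.m_closed subset_iff)
  show "A = (\<Union>r\<in>R. B #> r)" using right_transversalD(2)[OF R] sub RA by blast
  show "(B #> r) \<inter> (B #> s) = {}" if "r \<in> R" "s \<in> R" "r \<noteq> s"
    using right_transversalD(3)[OF R _ that(1,2)] sub RA that by blast
qed

text \<open>Inverting all elements turns the right cosets of a transversal into left cosets. The
  left form appears when a unitary is moved across an inner product.\<close>

lemma inverse_partition:
  assumes A: "subgroup A G" and B: "subgroup B G" and BA: "B \<subseteq> A" and R: "right_transversal G A B R"
  shows "A = (\<Union>r\<in>R. (\<lambda>b. inv r \<otimes> b) ` B)"
    and "r \<in> R \<Longrightarrow> s \<in> R \<Longrightarrow> r \<noteq> s \<Longrightarrow> (\<lambda>b. inv r \<otimes> b) ` B \<inter> (\<lambda>b. inv s \<otimes> b) ` B = {}"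
proof -
  have Ac: "A \<subseteq> carrier G" and Bc: "B \<subseteq> carrier G" using A B by (auto dest: subgroup.subset)
  have RA: "R \<subseteq> A" by (rule right_transversalD[OF R])
  have iff: "x \<in> (\<lambda>b. inv r \<otimes> b) ` B \<longleftrightarrow> inv x \<in> B #> r" if "x \<in> carrier G" "r \<in> carrier G" for x r
  proof
    assume "x \<in> (\<lambda>b. inv r \<otimes> b) ` B"
    then obtain b where b: "b \<in> B" "x = inv r \<otimes> b" by auto
    then have "inv x = inv b \<otimes> r" using that Bc by (auto simp: inv_mult_group)
    then show "inv x \<in> B #> r" using b subgroup.m_inv_closed[OF B] by (auto simp: r_coset_eq_image)
  next
    assume "inv x \<in> B #> r"
    then obtain b where b: "b \<in> B" "inv x = b \<otimes> r" by (auto simp: r_coset_eq_image)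
    then have "inv (inv x) = inv (b \<otimes> r)" by simp
    also have "\<dots> = inv r \<otimes> inv b" using b that Bc by (intro inv_mult_group) auto
    finally have "x = inv r \<otimes> inv b" using that by simp
    then show "x \<in> (\<lambda>b. inv r \<otimes> b) ` B" using subgroup.m_inv_closed[OF B b(1)] by (rule image_eqI)
  qed
  have sub: "(\<lambda>b. inv r \<otimes> b) ` B \<subseteq> A" if "r \<in> R" for r
    using that A BA RA by (auto simp: subgroup.m_closed subgroup.m_inv_closed subset_iff)
  note P = right_transversal_partition[OF A B BA R]
  show "A = (\<Union>r\<in>R. (\<lambda>b. inv r \<otimes> b) ` B)"
  proof
    show "A \<subseteq> (\<Union>r\<in>R. (\<lambda>b. inv r \<otimes> b) ` B)"
    proof
      fix x assume x: "x \<in> A"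
      then have "inv x \<in> (\<Union>r\<in>R. B #> r)" using P(1) subgroup.m_inv_closed[OF A] by blast
      then show "x \<in> (\<Union>r\<in>R. (\<lambda>b. inv r \<otimes> b) ` B)" using iff x Ac RA by blast
    qed
  qed (use sub in auto)
  show "(\<lambda>b. inv r \<otimes> b) ` B \<inter> (\<lambda>b. inv s \<otimes> b) ` B = {}" if "r \<in> R" "s \<in> R" "r \<noteq> s"
  proof -
    have "False" if x: "x \<in> (\<lambda>b. inv r \<otimes> b) ` B" "x \<in> (\<lambda>b. inv s \<otimes> b) ` B" for x
    proof -
      have c: "x \<in> carrier G" "r \<in> carrier G" "s \<in> carrier G" using x sub[OF \<open>r \<in> R\<close>] \<open>r \<in> R\<close> \<open>s \<in> R\<close> RA Ac by blast+
      show False using iff[OF c(1,2)] iff[OF c(1,3)] x P(2)[OF \<open>r \<in> R\<close> \<open>s \<in> R\<close> \<open>r \<noteq> s\<close>] by blast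
    qed
    then show ?thesis by blast
  qed
qed

text \<open>Describes the level space of a subgroup through that of the larger group. Injectivity of
  the product map makes the indices multiply.\<close>

lemma right_transversal_trans:
  assumes A: "subgroup A G" and B: "subgroup B G" and C: "subgroup C G"
    and BA: "B \<subseteq> A" and CB: "C \<subseteq> B"
    and R: "right_transversal G A B R" and T: "right_transversal G B C T"
  shows "right_transversal G A C ((\<lambda>(t, s). t \<otimes> s) ` (T \<times> R))" (is ?trans)
    and "inj_on (\<lambda>(t, s). t \<otimes> s) (T \<times> R)" (is ?inj)
proof -
  have Ac: "A \<subseteq> carrier G" and Bc: "B \<subseteq> carrier G" and Cc: "C \<subseteq> carrier G"
    using A B C by (auto dest: subgroup.subset)
  have RA: "R \<subseteq> A" and TB: "T \<subseteq> B" using R T by (auto dest: right_transversalD(1))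
  \<comment> \<open>Comparing modulo \<open>B\<close> first identifies the factors in
    \<open>R\<close>; after cancelling them, comparing modulo \<open>C\<close> identifies the
    factors in \<open>T\<close>.\<close>
  have key: "t \<otimes> s = t' \<otimes> s' \<and> t = t' \<and> s = s'"
    if asm: "t \<in> T" "t' \<in> T" "s \<in> R" "s' \<in> R" "a \<in> C #> (t \<otimes> s)" "a \<in> C #> (t' \<otimes> s')" for t t' s s' a
  proof -
    have c: "t \<in> carrier G" "t' \<in> carrier G" "s \<in> carrier G" "s' \<in> carrier G"
      using asm RA TB Ac Bc by auto
    have tB: "t \<in> B" "t' \<in> B" using asm TB by auto
    obtain x where x: "x \<in> C" "a = x \<otimes> (t \<otimes> s)" using asm(5) unfolding r_coset_eq_image by blast
    obtain y where y: "y \<in> C" "a = y \<otimes> (t' \<otimes> s')" using asm(6) unfolding r_coset_eq_image by blast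
    have xy: "x \<in> carrier G" "y \<in> carrier G" using x y Cc by auto
    have a1: "a = (x \<otimes> t) \<otimes> s" and a2: "a = (y \<otimes> t') \<otimes> s'" using x y c xy by (simp_all add: m_assoc)
    have xt: "x \<otimes> t \<in> B" and yt: "y \<otimes> t' \<in> B" using x y CB tB subgroup.m_closed[OF B] by auto
    have aA: "a \<in> A" using a1 xt BA RA asm subgroup.m_closed[OF A] by auto
    have "a \<in> B #> s" unfolding a1 r_coset_eq_image by (rule imageI[OF xt])
    moreover have "a \<in> B #> s'" unfolding a2 r_coset_eq_image by (rule imageI[OF yt])
    ultimately have ss: "s = s'" using right_transversalD(3)[OF R aA] asm by blast
    then have "x \<otimes> t = y \<otimes> t'" using a1 a2 c xy by simp
    then have "x \<otimes> t \<in> C #> t'" unfolding r_coset_eq_image using y(1) by simp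
    moreover have "x \<otimes> t \<in> C #> t" unfolding r_coset_eq_image by (rule imageI[OF x(1)])
    ultimately have "t = t'" using right_transversalD(3)[OF T xt] asm by blast
    then show ?thesis using ss by simp
  qed
  show ?inj
  proof (rule inj_onI)
    fix p q assume pq: "p \<in> T \<times> R" "q \<in> T \<times> R" "(\<lambda>(t, s). t \<otimes> s) p = (\<lambda>(t, s). t \<otimes> s) q"
    have "fst p \<otimes> snd p \<in> C #> (fst p \<otimes> snd p)"
      using pq(1) RA TB Ac Bc by (intro rcos_self[OF _ C] m_closed) auto
    then show "p = q"
      using key[of "fst p" "fst q" "snd p" "snd q" "fst p \<otimes> snd p"] pq by (auto simp: case_prod_beta prod_eq_iff)
  qed
  show ?trans
    unfolding right_transversal_def
  proof (intro conjI ballI)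
    show "(\<lambda>(t, s). t \<otimes> s) ` (T \<times> R) \<subseteq> A"
      using subgroup.m_closed[OF A] subsetD[OF TB] subsetD[OF BA] subsetD[OF RA] by auto
    fix a assume a: "a \<in> A"
    obtain s b where s: "s \<in> R" "b \<in> B" "a = b \<otimes> s"
      using right_transversalD(2)[OF R a] by (auto simp: r_coset_eq_image)
    obtain t c where t: "t \<in> T" "c \<in> C" "b = c \<otimes> t"
      using right_transversalD(2)[OF T s(2)] by (auto simp: r_coset_eq_image)
    have "c \<in> carrier G" "t \<in> carrier G" "s \<in> carrier G" using s t Cc TB RA Ac Bc by auto
    then have "a = c \<otimes> (t \<otimes> s)" using s t by (simp add: m_assoc)
    then have ats: "a \<in> C #> (t \<otimes> s)" using t by (auto simp: r_coset_eq_image)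
    show "\<exists>!r. r \<in> (\<lambda>(t, s). t \<otimes> s) ` (T \<times> R) \<and> a \<in> C #> r"
    proof (rule ex1I[of _ "t \<otimes> s"])
      show "t \<otimes> s \<in> (\<lambda>(t, s). t \<otimes> s) ` (T \<times> R) \<and> a \<in> C #> (t \<otimes> s)" using s t ats by auto
      fix r assume r: "r \<in> (\<lambda>(t, s). t \<otimes> s) ` (T \<times> R) \<and> a \<in> C #> r"
      then obtain t' s' where t': "t' \<in> T" "s' \<in> R" "r = t' \<otimes> s'" by auto
      then show "r = t \<otimes> s" using key[of t' t s' s a] s t r ats by auto
    qed
  qed
qed

text \<open>If c and \<sigma> c \<sigma>^{-1} both lie in \<open>A\<close>, then A \<sigma> c a = A
  \<sigma> a, because the conjugate is absorbed on the left; conversely equal cosets differ by such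
  a c. So the right cosets in the double coset are indexed by \<open>A\<close> modulo the
  intersection of \<open>A\<close> with \<sigma>^{-1} A \<sigma>.\<close>

lemma double_coset_partition:
  assumes A: "subgroup A G" and \<sigma>: "\<sigma> \<in> carrier G"
    and R: "right_transversal G A (conj_inter G A (inv \<sigma>)) R"
  shows "double_coset G A \<sigma> = (\<Union>r\<in>R. A #> (\<sigma> \<otimes> r))"
    and "r \<in> R \<Longrightarrow> s \<in> R \<Longrightarrow> r \<noteq> s \<Longrightarrow> (A #> (\<sigma> \<otimes> r)) \<inter> (A #> (\<sigma> \<otimes> s)) = {}"
proof -
  let ?B = "conj_inter G A (inv \<sigma>)"
  have Ac: "A \<subseteq> carrier G" by (rule subgroup.subset[OF A])
  have RA: "R \<subseteq> A" by (rule right_transversalD[OF R])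
  have memB: "x \<in> ?B \<longleftrightarrow> x \<in> A \<and> \<sigma> \<otimes> x \<otimes> inv \<sigma> \<in> A" for x
    unfolding conj_inter_def using Ac \<sigma> by (auto simp: mem_conj_set)
  have dc: "double_coset G A \<sigma> = (\<Union>a\<in>A. A #> (\<sigma> \<otimes> a))"
    unfolding double_coset_def set_mult_def r_coset_eq_image using Ac \<sigma> by (auto simp: m_assoc subset_iff)
  show "double_coset G A \<sigma> = (\<Union>r\<in>R. A #> (\<sigma> \<otimes> r))"
  proof
    show "double_coset G A \<sigma> \<subseteq> (\<Union>r\<in>R. A #> (\<sigma> \<otimes> r))"
    proof
      fix x assume "x \<in> double_coset G A \<sigma>"
      then obtain a b where ab: "a \<in> A" "b \<in> A" "x = b \<otimes> (\<sigma> \<otimes> a)"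
        unfolding dc by (auto simp: r_coset_eq_image)
      obtain r c where r: "r \<in> R" "c \<in> ?B" "a = c \<otimes> r"
        using right_transversalD(2)[OF R ab(1)] by (auto simp: r_coset_eq_image)
      have c: "c \<in> carrier G" "r \<in> carrier G" "b \<in> carrier G" using r ab RA Ac memB by auto
      have "x = (b \<otimes> (\<sigma> \<otimes> c \<otimes> inv \<sigma>)) \<otimes> (\<sigma> \<otimes> r)" using ab r c \<sigma> by (simp add: m_assoc)
      moreover have "b \<otimes> (\<sigma> \<otimes> c \<otimes> inv \<sigma>) \<in> A" using ab r memB subgroup.m_closed[OF A] by blast
      ultimately show "x \<in> (\<Union>r\<in>R. A #> (\<sigma> \<otimes> r))" using r by (auto simp: r_coset_eq_image)
    qed
  qed (use RA dc in auto)
  show "(A #> (\<sigma> \<otimes> r)) \<inter> (A #> (\<sigma> \<otimes> s)) = {}" if rs: "r \<in> R" "s \<in> R" "r \<noteq> s"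
  proof (rule ccontr)
    assume "\<not> ?thesis"
    then obtain x y where xy: "x \<in> A" "y \<in> A" "x \<otimes> (\<sigma> \<otimes> r) = y \<otimes> (\<sigma> \<otimes> s)"
      by (auto simp: r_coset_eq_image)
    have c: "x \<in> carrier G" "y \<in> carrier G" "r \<in> carrier G" "s \<in> carrier G" using xy rs RA Ac by auto
    have "inv y \<otimes> (x \<otimes> (\<sigma> \<otimes> r)) = \<sigma> \<otimes> s" unfolding xy(3) using c \<sigma> by simp
    then have "inv \<sigma> \<otimes> (inv y \<otimes> (x \<otimes> (\<sigma> \<otimes> r))) = s" using c \<sigma> by simp
    then have s: "s \<otimes> inv r = inv \<sigma> \<otimes> (inv y \<otimes> x) \<otimes> \<sigma>"
      using c \<sigma> by (auto simp: m_assoc)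
    have "\<sigma> \<otimes> (s \<otimes> inv r) \<otimes> inv \<sigma> = inv y \<otimes> x" unfolding s using c \<sigma> by (simp add: m_assoc)
    moreover have "inv y \<otimes> x \<in> A" "s \<otimes> inv r \<in> A"
      using xy(1,2) subsetD[OF RA rs(1)] subsetD[OF RA rs(2)]
        subgroup.m_closed[OF A] subgroup.m_inv_closed[OF A] by auto
    ultimately have "s \<otimes> inv r \<in> ?B" using memB by simp
    moreover have "s = (s \<otimes> inv r) \<otimes> r" using c by (simp add: m_assoc)
    ultimately have "s \<in> ?B #> r" by (auto simp: r_coset_eq_image)
    moreover have "s \<in> ?B #> s"
    proof -
      have "\<one> \<in> ?B" using memB subgroup.one_closed[OF A] \<sigma> by simp
      then show ?thesis using c by (auto simp: r_coset_eq_image intro!: image_eqI[of _ _ \<one>])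
    qed
    ultimately show False using right_transversalD(3)[OF R _ rs(1,2)] rs RA by blast
  qed
qed

end

context almost_normal_pair
begin

section \<open>The family of levels: finite index and stability under conjugation by
  \<Gamma>\<close>

lemma finitely_covered_conj_inter: "\<sigma> \<in> carrier G \<Longrightarrow> finitely_covered \<Gamma> (conj_inter G \<Gamma> \<sigma>)"
proof -
  assume \<sigma>: "\<sigma> \<in> carrier G"
  have \<Gamma>c: "\<Gamma> \<subseteq> carrier G" by (rule subgroup.subset[OF subgroup_\<Gamma>])
  let ?B = "conj_inter G \<Gamma> \<sigma>"
  have B: "subgroup ?B G"
    unfolding conj_inter_def by (rule subgroups_Inter_pair[OF subgroup_\<Gamma> subgroup_conj_set[OF subgroup_\<Gamma> \<sigma>]])
  have BA: "?B \<subseteq> \<Gamma>" by (auto simp: conj_inter_def)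
  obtain R where R: "right_transversal G \<Gamma> ?B R"
    using right_transversal_exists[OF subgroup_\<Gamma> B BA] by blast
  have RA: "R \<subseteq> \<Gamma>" by (rule right_transversalD[OF R])
  have cos: "cosets_in G \<Gamma> ?B = (\<lambda>a. ?B #> a) ` \<Gamma>"
    by (auto simp: cosets_in_def RCOSETS_def r_coset_def)
  have "inj_on (\<lambda>r. ?B #> r) R"
    using right_transversal_partition(2)[OF subgroup_\<Gamma> B BA R] rcos_self[OF _ B] RA \<Gamma>c
    by (intro inj_onI) blast
  moreover have "(\<lambda>r. ?B #> r) ` R \<subseteq> cosets_in G \<Gamma> ?B" unfolding cos using RA by auto
  ultimately have "finite R" using almost_normal[OF \<sigma>] by (metis finite_imageD finite_subset)
  then show ?thesis
    unfolding finitely_covered_def using right_transversal_partition(1)[OF subgroup_\<Gamma> B BA R] RA \<Gamma>c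
    by (intro exI[of _ R]) auto
qed

lemma level_family_props:
  assumes "A \<in> level_family G \<Gamma>"
  shows "subgroup A G \<and> A \<subseteq> \<Gamma> \<and> finitely_covered \<Gamma> A"
  using assms
proof induction
  case base
  have "finitely_covered \<Gamma> \<Gamma>"
    unfolding finitely_covered_def using subgroup.subset[OF subgroup_\<Gamma>]
    by (intro exI[of _ "{\<one>}"]) (auto simp: coset_mult_one)
  then show ?case using subgroup_\<Gamma> by simp
next
  case (inter A B)
  then show ?case
    using finitely_covered_Int[of A B \<Gamma>] subgroups_Inter_pair[of A B] subgroup.subset[OF subgroup_\<Gamma>] by blast
next
  case (conj A g)
  have \<Gamma>c: "\<Gamma> \<subseteq> carrier G" by (rule subgroup.subset[OF subgroup_\<Gamma>])
  have A: "subgroup A G" "A \<subseteq> \<Gamma>" "finitely_covered \<Gamma> A" using conj by auto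
  have Ac: "A \<subseteq> carrier G" using A \<Gamma>c by blast
  have gA: "subgroup (conj_set G g A) G" by (rule subgroup_conj_set[OF A(1) conj.hyps(2)])
  \<comment> \<open>Almost normality compares \<Gamma> with its conjugate, and the induction
    hypothesis, conjugated by \<open>g\<close>, compares that conjugate with the one of
    \<open>A\<close>. The detour is needed because the latter need not lie in \<Gamma>.\<close>
  have "finitely_covered \<Gamma> (conj_set G g \<Gamma>)"
    using finitely_covered_mono[OF finitely_covered_conj_inter[OF conj.hyps(2)]]
    unfolding conj_inter_def by blast
  moreover have "finitely_covered (conj_set G g \<Gamma>) (conj_set G g A)"
    by (rule finitely_covered_conj_set[OF A(3) \<Gamma>c Ac conj.hyps(2)])
  ultimately have "finitely_covered \<Gamma> (conj_set G g A)"
    using finitely_covered_trans conj_set_carrier[OF Ac conj.hyps(2)] by blast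
  then show ?case
    unfolding conj_inter_def
    using finitely_covered_Int[OF A(1) gA \<Gamma>c A(3)] subgroups_Inter_pair[OF A(1) gA] A(2) by blast
qed

lemmas level_subgroup = level_family_props[THEN conjunct1]
lemmas level_subset = level_family_props[THEN conjunct2, THEN conjunct1]
lemmas level_covered = level_family_props[THEN conjunct2, THEN conjunct2]

lemma level_carrier: "A \<in> level_family G \<Gamma> \<Longrightarrow> A \<subseteq> carrier G"
  using level_subgroup subgroup.subset by blast

text \<open>Conjugating the generating operation by \<open>s\<close> gives the same operation for
  the conjugated group and the element s g s^{-1}. This makes conditions (v) and (vi) available for
  cosets of s^{-1} \<Lambda> s.\<close>

lemma level_conj_set:
  assumes "A \<in> level_family G \<Gamma>" and s: "s \<in> \<Gamma>"
  shows "conj_set G s A \<in> level_family G \<Gamma>"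
  using assms(1)
proof induction
  case base
  show ?case unfolding conj_set_subgroup_self[OF subgroup_\<Gamma> s] by (rule level_family.base)
next
  case (inter A B)
  have sc: "s \<in> carrier G" using s subgroup.subset[OF subgroup_\<Gamma>] by blast
  show ?case
    unfolding conj_set_Int[OF level_carrier[OF inter.hyps(1)] level_carrier[OF inter.hyps(2)] sc]
    by (rule level_family.inter[OF inter.IH])
next
  case (conj A g)
  have sc: "s \<in> carrier G" using s subgroup.subset[OF subgroup_\<Gamma>] by blast
  have Ac: "A \<subseteq> carrier G" by (rule level_carrier[OF conj.hyps(1)])
  have "conj_set G (s \<otimes> g \<otimes> inv s) (conj_set G s A) = conj_set G s (conj_set G g A)"
    using Ac sc conj.hyps(2) by (simp add: conj_set_mult m_assoc)
  then have "conj_set G s (conj_inter G A g) = conj_inter G (conj_set G s A) (s \<otimes> g \<otimes> inv s)"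
    unfolding conj_inter_def using conj_set_Int[OF Ac conj_set_carrier[OF Ac conj.hyps(2)] sc] by simp
  then show ?case using level_family.conj[OF conj.IH] sc conj.hyps(2) by simp
qed

lemma level_transversal_finite:
  assumes "A \<in> level_family G \<Gamma>" "right_transversal G \<Gamma> A R"
  shows "finite R"
  by (rule right_transversal_finite[OF subgroup_\<Gamma> level_subgroup[OF assms(1)] assms(2) level_covered[OF assms(1)]])

lemma level_transversal_finite':
  assumes A: "A \<in> level_family G \<Gamma>" and B: "B \<in> level_family G \<Gamma>" and R: "right_transversal G A B R"
  shows "finite R"
proof -
  have "finitely_covered A B"
    using level_covered[OF B] level_subset[OF A] unfolding finitely_covered_def by blast
  then show ?thesis by (rule right_transversal_finite[OF level_subgroup[OF A] level_subgroup[OF B] R])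
qed

end

section \<open>The representation and its translates of \<open>L\<close>\<close>

context technical_condition
begin

lemma closed_L: "closed_csubspace L"
  using integer_multiple by (auto simp: regular_embedding_def)

lemma closed_H\<^sub>0: "closed_csubspace H\<^sub>0"
  using rep_\<pi>\<^sub>0 by (auto simp: unitary_rep_on_def)

lemma \<Gamma>_carrier: "\<Gamma> \<subseteq> carrier G"
  by (rule subgroup.subset[OF subgroup_\<Gamma>])

section \<open>Unitarity of \<open>\<pi>\<close> and the calculus of its compression
  \<open>\<pi>\<^sub>0\<close>\<close>

lemma \<pi>_mult: "g \<in> carrier G \<Longrightarrow> h \<in> carrier G \<Longrightarrow> \<pi> (g \<otimes> h) x = \<pi> g (\<pi> h x)"
  using rep_\<pi> by (auto simp: unitary_rep_on_def)

lemma \<pi>_cinner: "g \<in> carrier G \<Longrightarrow> cinner (\<pi> g x) (\<pi> g y) = cinner x y"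
  and \<pi>_add: "g \<in> carrier G \<Longrightarrow> \<pi> g (x + y) = \<pi> g x + \<pi> g y"
  and \<pi>_scaleC: "g \<in> carrier G \<Longrightarrow> \<pi> g (c *\<^sub>C x) = c *\<^sub>C \<pi> g x"
  and \<pi>_inj: "g \<in> carrier G \<Longrightarrow> \<pi> g x = \<pi> g y \<Longrightarrow> x = y"
  using rep_\<pi> by (auto simp: unitary_rep_on_def unitary_on_def clinear_on_def bij_betw_def inj_on_def)

lemma \<pi>_one [simp]: "\<pi> \<one> x = x"
proof -
  have "\<pi> \<one> (\<pi> \<one> x) = \<pi> \<one> x" using \<pi>_mult[of \<one> \<one> x] by simp
  then show ?thesis by (rule \<pi>_inj[rotated]) simp
qed

lemma \<pi>_inv [simp]:
  "g \<in> carrier G \<Longrightarrow> \<pi> (inv g) (\<pi> g x) = x" "g \<in> carrier G \<Longrightarrow> \<pi> g (\<pi> (inv g) x) = x"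
  by (simp_all flip: \<pi>_mult)

lemma \<pi>_adj: "g \<in> carrier G \<Longrightarrow> cinner (\<pi> g x) y = cinner x (\<pi> (inv g) y)"
  using \<pi>_cinner[of g x "\<pi> (inv g) y"] by simp

lemma \<pi>_norm: "g \<in> carrier G \<Longrightarrow> norm (\<pi> g x) = norm x"
proof -
  assume g: "g \<in> carrier G"
  have "complex_of_real ((norm (\<pi> g x))\<^sup>2) = complex_of_real ((norm x)\<^sup>2)"
    unfolding norm_cinner[symmetric] by (rule \<pi>_cinner[OF g])
  then have "(norm (\<pi> g x))\<^sup>2 = (norm x)\<^sup>2" using of_real_eq_iff by blast
  then show ?thesis by (simp add: power2_eq_iff_nonneg)
qed

lemma \<pi>_bounded_linear: "g \<in> carrier G \<Longrightarrow> bounded_linear (\<pi> g)"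
  by (rule bounded_linear_intro[where K = 1]) (simp_all add: \<pi>_add \<pi>_scaleC scaleR_scaleC \<pi>_norm)

lemma \<pi>_sum: "g \<in> carrier G \<Longrightarrow> \<pi> g (\<Sum>i\<in>I. f i) = (\<Sum>i\<in>I. \<pi> g (f i))"
  by (rule linear_sum) (rule bounded_linear.linear[OF \<pi>_bounded_linear])

lemma \<pi>_zero [simp]: "g \<in> carrier G \<Longrightarrow> \<pi> g 0 = 0"
  using \<pi>_sum[of g _ "{}"] by simp

text \<open>Invariance under \<open>g\<close> puts the candidate into the subspace; invariance under
  \<open>inv g\<close> gives the orthogonality of the remainder.\<close>

lemma proj_H\<^sub>0_\<pi>: "g \<in> carrier G \<Longrightarrow> orth_proj H\<^sub>0 (\<pi> g x) = \<pi> g (orth_proj H\<^sub>0 x)"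
proof -
  assume g: "g \<in> carrier G"
  show ?thesis
  proof (rule orth_proj_eqI)
    show "csubspace H\<^sub>0" using closed_H\<^sub>0 by (simp add: closed_csubspace_iff)
    show "\<pi> g (orth_proj H\<^sub>0 x) \<in> H\<^sub>0" using invariant[OF g] orth_proj_in[OF closed_H\<^sub>0] by blast
    fix z assume z: "z \<in> H\<^sub>0"
    have "\<pi> (inv g) z \<in> H\<^sub>0" using invariant[of "inv g"] g z by auto
    then show "cinner (\<pi> g x - \<pi> g (orth_proj H\<^sub>0 x)) z = 0"
      using g by (simp add: cinner_diff_left \<pi>_adj orth_proj_cinner_left[OF closed_H\<^sub>0])
  qed
qed

lemma \<pi>\<^sub>0_apply: "g \<in> carrier G \<Longrightarrow> \<pi>\<^sub>0 g x = orth_proj H\<^sub>0 (\<pi> g x)"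
  by (simp add: \<pi>\<^sub>0_eq proj_H\<^sub>0_\<pi> orth_proj_id[OF closed_H\<^sub>0 orth_proj_in[OF closed_H\<^sub>0]])

lemma \<pi>\<^sub>0_mult_right: "g \<in> carrier G \<Longrightarrow> h \<in> carrier G \<Longrightarrow> \<pi>\<^sub>0 (g \<otimes> h) x = \<pi>\<^sub>0 g (\<pi> h x)"
  by (simp add: \<pi>\<^sub>0_apply \<pi>_mult)

lemma \<pi>\<^sub>0_mult_left: "g \<in> carrier G \<Longrightarrow> h \<in> carrier G \<Longrightarrow> \<pi>\<^sub>0 (g \<otimes> h) x = \<pi> g (\<pi>\<^sub>0 h x)"
  by (simp add: \<pi>\<^sub>0_apply \<pi>_mult proj_H\<^sub>0_\<pi>)

lemma \<pi>\<^sub>0_adj: "g \<in> carrier G \<Longrightarrow> cinner (\<pi>\<^sub>0 g x) y = cinner x (\<pi>\<^sub>0 (inv g) y)"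
  by (simp add: \<pi>\<^sub>0_apply proj_H\<^sub>0_\<pi> \<pi>_adj orth_proj_selfadj[OF closed_H\<^sub>0])

lemma \<pi>\<^sub>0_add: "g \<in> carrier G \<Longrightarrow> \<pi>\<^sub>0 g (x + y) = \<pi>\<^sub>0 g x + \<pi>\<^sub>0 g y"
  and \<pi>\<^sub>0_scaleC: "g \<in> carrier G \<Longrightarrow> \<pi>\<^sub>0 g (c *\<^sub>C x) = c *\<^sub>C \<pi>\<^sub>0 g x"
  by (simp_all add: \<pi>\<^sub>0_apply \<pi>_add \<pi>_scaleC orth_proj_add[OF closed_H\<^sub>0] orth_proj_scaleC[OF closed_H\<^sub>0])

abbreviation P :: "'h \<Rightarrow> 'h" where "P \<equiv> orth_proj L"

text \<open>In the tensor product picture \<open>\<pi> \<gamma> l\<close> is the vector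
  \<open>l\<close> placed at \<gamma>, so distinct translates have disjoint supports.\<close>

lemma L_orthogonal:
  assumes "\<gamma> \<in> \<Gamma>" "\<delta> \<in> \<Gamma>" "\<gamma> \<noteq> \<delta>" "l \<in> L" "l' \<in> L"
  shows "cinner (\<pi> \<gamma> l) (\<pi> \<delta> l') = 0"
proof -
  obtain V where V: "regular_embedding G \<Gamma> \<pi> UNIV L V" and VL: "\<And>l. l \<in> L \<Longrightarrow> V l = (\<lambda>a. if a = \<one> then l else 0)"
    using integer_multiple by blast
  have c: "\<gamma> \<in> carrier G" "\<delta> \<in> carrier G" using assms \<Gamma>_carrier by auto
  have hs: "((\<lambda>a. cinner (V (\<pi> \<gamma> l) a) (V (\<pi> \<delta> l') a)) has_sum cinner (\<pi> \<gamma> l) (\<pi> \<delta> l')) \<Gamma>"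
    and tr: "\<And>g x a. g \<in> \<Gamma> \<Longrightarrow> a \<in> \<Gamma> \<Longrightarrow> V (\<pi> g x) a = V x (inv g \<otimes> a)"
    using V by (auto simp: regular_embedding_def)
  have "cinner (V (\<pi> \<gamma> l) a) (V (\<pi> \<delta> l') a) = 0" if a: "a \<in> \<Gamma>" for a
  proof -
    have ac: "a \<in> carrier G" using a \<Gamma>_carrier by auto
    have "inv \<gamma> \<otimes> a = \<one> \<Longrightarrow> \<gamma> = a" "inv \<delta> \<otimes> a = \<one> \<Longrightarrow> \<delta> = a"
      using c ac by (metis inv_cancel_left(2) r_one)+
    then show ?thesis using assms a by (auto simp: tr VL)
  qed
  then have "((\<lambda>a. cinner (V (\<pi> \<gamma> l) a) (V (\<pi> \<delta> l') a)) has_sum 0) \<Gamma>" by (rule has_sum_0)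
  then show ?thesis by (rule has_sum_unique[OF hs])
qed

text \<open>This is the isometry of the embedding \<open>V\<close>: the summand at \<gamma> is the
  squared norm of the value of \<open>V h\<close> at \<gamma>.\<close>

lemma square_sum_translates:
  "((\<lambda>\<gamma>. (norm (P (\<pi> (inv \<gamma>) h)))\<^sup>2) has_sum (norm h)\<^sup>2) \<Gamma>"
proof -
  obtain V where V: "regular_embedding G \<Gamma> \<pi> UNIV L V" and VL: "\<And>l. l \<in> L \<Longrightarrow> V l = (\<lambda>a. if a = \<one> then l else 0)"
    using integer_multiple by blast
  have one: "\<one> \<in> \<Gamma>" using subgroup.one_closed[OF subgroup_\<Gamma>] .
  have hs: "\<And>x y. ((\<lambda>a. cinner (V x a) (V y a)) has_sum cinner x y) \<Gamma>"
    and VinL: "\<And>x a. a \<in> \<Gamma> \<Longrightarrow> V x a \<in> L"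
    and tr: "\<And>g x a. g \<in> \<Gamma> \<Longrightarrow> a \<in> \<Gamma> \<Longrightarrow> V (\<pi> g x) a = V x (inv g \<otimes> a)"
    using V by (auto simp: regular_embedding_def ell2_fun_def)
  \<comment> \<open>Vectors of \<open>L\<close> are supported at the neutral element, so projecting
    to \<open>L\<close> reads off the value there; equivariance transports this to every
    \<gamma>.\<close>
  have PV: "P h = V h \<one>" for h
  proof (rule orth_proj_eqI)
    show "csubspace L" using closed_L by (simp add: closed_csubspace_iff)
    show "V h \<one> \<in> L" by (rule VinL[OF one])
    fix z assume z: "z \<in> L"
    have "((\<lambda>a. cinner (V h a) (V z a)) has_sum cinner (V h \<one>) z) {\<one>}"
      using z by (intro has_sum_finiteI) (auto simp: VL)
    then have "((\<lambda>a. cinner (V h a) (V z a)) has_sum cinner (V h \<one>) z) \<Gamma>"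
      by (subst has_sum_cong_neutral[where S = \<Gamma> and T = "{\<one>}" and g = "\<lambda>a. cinner (V h a) (V z a)"])
        (use one z in \<open>auto simp: VL\<close>)
    then have "cinner h z = cinner (V h \<one>) z" by (rule has_sum_unique[OF hs])
    then show "cinner (h - V h \<one>) z = 0" by (simp add: cinner_diff_left)
  qed
  have PV': "P (\<pi> (inv \<gamma>) h) = V h \<gamma>" if "\<gamma> \<in> \<Gamma>" for \<gamma>
    unfolding PV using that tr[of "inv \<gamma>" \<one> h] one subgroup.m_inv_closed[OF subgroup_\<Gamma> that] \<Gamma>_carrier
    by (simp add: subset_iff)
  have "((\<lambda>a. Re (cinner (V h a) (V h a))) has_sum Re (cinner h h)) \<Gamma>"
    by (rule has_sum_Re[OF hs])
  then have "((\<lambda>a. (norm (V h a))\<^sup>2) has_sum (norm h)\<^sup>2) \<Gamma>" by (simp add: norm_cinner)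
  then show ?thesis by (rule has_sum_cong[THEN iffD2, rotated]) (simp add: PV')
qed

lemma coset_pointwise_summable:
  assumes "g \<in> carrier G" "\<Lambda> \<in> level_family G \<Gamma>"
  shows "(\<lambda>\<theta>. P (\<pi>\<^sub>0 \<theta> (P x))) summable_on (\<Lambda> #> g)"
proof -
  obtain T where "hs_has_sum (\<lambda>\<theta>. P \<circ> \<pi>\<^sub>0 \<theta> \<circ> P) (\<Lambda> #> g) T"
    using coset_sums[OF assms] by blast
  from hs_has_sum_pointwise[OF this, of x] show ?thesis
    by (auto simp: o_def dest: has_sum_imp_summable)
qed

text \<open>On a left coset of \<open>\<Gamma>\<^sub>g\<close> the vectors \<open>P\<pi>(\<gamma>)\<pi>(g)l\<close> are pairwise orthogonal, because the projections
  onto the translates of \<open>L\<close> commute.\<close>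

lemma translate_summable:
  assumes g: "g \<in> carrier G" and l: "l \<in> L"
  shows "(\<lambda>\<gamma>. P (\<pi> \<gamma> (\<pi> g l))) summable_on \<Gamma>"
proof -
  let ?v = "\<lambda>\<gamma>. P (\<pi> \<gamma> (\<pi> g l))"
  let ?B = "conj_inter G \<Gamma> g"
  have BS: "?B \<in> level_family G \<Gamma>" by (rule level_family.conj[OF level_family.base g])
  obtain R where R: "right_transversal G \<Gamma> ?B R"
    using right_transversal_exists[OF subgroup_\<Gamma> level_subgroup[OF BS] level_subset[OF BS]] by blast
  have fin: "finite R" by (rule level_transversal_finite[OF BS R])
  have RG: "R \<subseteq> \<Gamma>" by (rule right_transversalD[OF R])
  note part = inverse_partition[OF subgroup_\<Gamma> level_subgroup[OF BS] level_subset[OF BS] R]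
  have sq: "(\<lambda>\<gamma>. (norm (?v \<gamma>))\<^sup>2) summable_on \<Gamma>"
  proof -
    have bij: "bij_betw (\<lambda>\<gamma>. inv \<gamma>) \<Gamma> \<Gamma>"
      using \<Gamma>_carrier subgroup.m_inv_closed[OF subgroup_\<Gamma>]
      by (intro bij_betwI[where g = "\<lambda>\<gamma>. inv \<gamma>"]) auto
    show ?thesis
      using summable_on_reindex_bij_betw[OF bij, of "\<lambda>\<gamma>. (norm (?v \<gamma>))\<^sup>2"]
        has_sum_imp_summable[OF square_sum_translates[of "\<pi> g l"]] by simp
  qed
  have "?v summable_on ((\<lambda>b. inv r \<otimes> b) ` ?B)" if r: "r \<in> R" for r
  proof (rule summable_on_orthogonal)
    have sub: "(\<lambda>b. inv r \<otimes> b) ` ?B \<subseteq> \<Gamma>" using part(1) r by blast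
    show "(\<lambda>\<gamma>. (norm (?v \<gamma>))\<^sup>2) summable_on ((\<lambda>b. inv r \<otimes> b) ` ?B)"
      by (rule summable_on_subset_banach[OF sq sub])
    fix \<gamma> \<gamma>' assume \<gamma>: "\<gamma> \<in> (\<lambda>b. inv r \<otimes> b) ` ?B" "\<gamma>' \<in> (\<lambda>b. inv r \<otimes> b) ` ?B" "\<gamma> \<noteq> \<gamma>'"
    then obtain b b' where b: "b \<in> ?B" "b' \<in> ?B" "\<gamma> = inv r \<otimes> b" "\<gamma>' = inv r \<otimes> b'" by auto
    have rc: "r \<in> carrier G" using r RG \<Gamma>_carrier by auto
    \<comment> \<open>On one left coset, \<gamma> g = x e with \<open>x\<close> common to the coset
      and e in \<Gamma>, so distinct \<gamma> give distinct translates of \<open>L\<close> inside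
      \<pi>(x) H.\<close>
    define x where "x = inv r \<otimes> g"
    have xc: "x \<in> carrier G" using rc g by (simp add: x_def)
    have *: "\<exists>e\<in>\<Gamma>. b = g \<otimes> e \<otimes> inv g" if "b \<in> ?B" for b
      using that by (auto simp: conj_inter_def conj_set_eq)
    obtain e e' where e: "e \<in> \<Gamma>" "b = g \<otimes> e \<otimes> inv g" "e' \<in> \<Gamma>" "b' = g \<otimes> e' \<otimes> inv g"
      using *[OF b(1)] *[OF b(2)] by blast
    have ec: "e \<in> carrier G" "e' \<in> carrier G" using e \<Gamma>_carrier by auto
    have ne: "e \<noteq> e'" using \<gamma>(3) b e by auto
    have gx: "\<gamma> \<otimes> g = x \<otimes> e" "\<gamma>' \<otimes> g = x \<otimes> e'"
      using b e ec rc g by (simp_all add: x_def m_assoc)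
    have gc: "\<gamma> \<in> carrier G" "\<gamma>' \<in> carrier G" using \<gamma> sub \<Gamma>_carrier by auto
    \<comment> \<open>\<open>commuting\<close> for \<open>y\<close> and the neutral element, applied
      to a vector fixed by the projection onto \<pi>(y) L: the projection \<open>P\<close> keeps
      that vector in \<pi>(y) L.\<close>
    have Q: "P (\<pi> y l) = \<pi> y (P (\<pi> (inv y) (P (\<pi> y l))))" if y: "y \<in> carrier G" for y
    proof -
      have "(\<pi> y \<circ> P \<circ> \<pi> (inv y)) ((\<pi> \<one> \<circ> P \<circ> \<pi> (inv \<one>)) (\<pi> y l))
        = (\<pi> \<one> \<circ> P \<circ> \<pi> (inv \<one>)) ((\<pi> y \<circ> P \<circ> \<pi> (inv y)) (\<pi> y l))"
        using fun_cong[OF commuting[OF y one_closed], of "\<pi> y l"] by simp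
      then show ?thesis using y orth_proj_id[OF closed_L l] by simp
    qed
    define u where "u = P (\<pi> (inv (x \<otimes> e)) (P (\<pi> (x \<otimes> e) l)))"
    define u' where "u' = P (\<pi> (inv (x \<otimes> e')) (P (\<pi> (x \<otimes> e') l)))"
    have uL: "u \<in> L" "u' \<in> L" by (simp_all add: u_def u'_def orth_proj_in[OF closed_L])
    have v: "?v \<gamma> = \<pi> x (\<pi> e u)" "?v \<gamma>' = \<pi> x (\<pi> e' u')"
      using Q[of "x \<otimes> e"] Q[of "x \<otimes> e'"] gc g xc ec
      by (simp_all add: u_def u'_def gx flip: \<pi>_mult)
    show "cinner (?v \<gamma>) (?v \<gamma>') = 0"
      unfolding v \<pi>_cinner[OF xc] by (rule L_orthogonal[OF e(1,3) ne uL])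
  qed
  then have "?v summable_on (\<Union>r\<in>R. (\<lambda>b. inv r \<otimes> b) ` ?B)"
    using part(2) by (intro summable_on_finite_union_disjoint[OF fin]) auto
  then show ?thesis using part(1) by simp
qed

section \<open>The domain of formal sums and the level spaces\<close>

abbreviation D :: "'h set" where "D \<equiv> virtual_domain G \<Gamma> \<pi>\<^sub>0 \<pi> L"

text \<open>Every level is a subset of \<Gamma>, and unconditional convergence in a Banach space
  passes to subsets, so the top level decides.\<close>

lemma D_iff: "h \<in> D \<longleftrightarrow> (\<lambda>\<gamma>. P (\<pi> \<gamma> h)) summable_on \<Gamma> \<and> (\<lambda>\<gamma>. P (\<pi>\<^sub>0 \<gamma> h)) summable_on \<Gamma>"
proof -
  have "h \<in> conv_domain G \<Gamma> L \<rho> \<longleftrightarrow> (\<lambda>\<gamma>. P (\<rho> \<gamma> h)) summable_on \<Gamma>" for \<rho>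
    unfolding conv_domain_def mem_Collect_eq
  proof
    assume "\<forall>\<Gamma>\<^sub>0\<in>level_family G \<Gamma>. (\<lambda>\<gamma>. P (\<rho> \<gamma> h)) summable_on \<Gamma>\<^sub>0"
    then show "(\<lambda>\<gamma>. P (\<rho> \<gamma> h)) summable_on \<Gamma>" using level_family.base ..
  next
    assume "(\<lambda>\<gamma>. P (\<rho> \<gamma> h)) summable_on \<Gamma>"
    then show "\<forall>\<Gamma>\<^sub>0\<in>level_family G \<Gamma>. (\<lambda>\<gamma>. P (\<rho> \<gamma> h)) summable_on \<Gamma>\<^sub>0"
      using summable_on_subset_banach[OF _ level_subset] by auto
  qed
  then show ?thesis by (simp add: virtual_domain_def)
qed

lemma csubspace_D: "csubspace D"
  unfolding csubspace_def
proof (intro conjI ballI allI)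
  have gc: "\<gamma> \<in> \<Gamma> \<Longrightarrow> \<gamma> \<in> carrier G" for \<gamma> using \<Gamma>_carrier by auto
  have z: "\<pi>\<^sub>0 \<gamma> 0 = 0" if "\<gamma> \<in> \<Gamma>" for \<gamma> using \<pi>\<^sub>0_scaleC[of \<gamma> 0 0] gc[OF that] by simp
  have Pz: "P 0 = 0" using orth_proj_scaleC[OF closed_L, of 0 0] by simp
  show "0 \<in> D" unfolding D_iff by (auto intro!: summable_on_0 simp: z Pz gc)
  fix x y assume xy: "x \<in> D" "y \<in> D"
  have "(\<lambda>\<gamma>. P (\<pi> \<gamma> (x + y))) summable_on \<Gamma> \<longleftrightarrow> (\<lambda>\<gamma>. P (\<pi> \<gamma> x) + P (\<pi> \<gamma> y)) summable_on \<Gamma>"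
    by (rule summable_on_cong) (simp add: \<pi>_add orth_proj_add[OF closed_L] gc)
  moreover have "(\<lambda>\<gamma>. P (\<pi>\<^sub>0 \<gamma> (x + y))) summable_on \<Gamma> \<longleftrightarrow> (\<lambda>\<gamma>. P (\<pi>\<^sub>0 \<gamma> x) + P (\<pi>\<^sub>0 \<gamma> y)) summable_on \<Gamma>"
    by (rule summable_on_cong) (simp add: \<pi>\<^sub>0_add orth_proj_add[OF closed_L] gc)
  ultimately show "x + y \<in> D" using xy unfolding D_iff by (auto intro: summable_on_add)
next
  have gc: "\<gamma> \<in> \<Gamma> \<Longrightarrow> \<gamma> \<in> carrier G" for \<gamma> using \<Gamma>_carrier by auto
  fix c x assume x: "x \<in> D"
  have "(\<lambda>\<gamma>. P (\<pi> \<gamma> (c *\<^sub>C x))) summable_on \<Gamma> \<longleftrightarrow> (\<lambda>\<gamma>. c *\<^sub>C P (\<pi> \<gamma> x)) summable_on \<Gamma>"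
    by (rule summable_on_cong) (simp add: \<pi>_scaleC orth_proj_scaleC[OF closed_L] gc)
  moreover have "(\<lambda>\<gamma>. P (\<pi>\<^sub>0 \<gamma> (c *\<^sub>C x))) summable_on \<Gamma> \<longleftrightarrow> (\<lambda>\<gamma>. c *\<^sub>C P (\<pi>\<^sub>0 \<gamma> x)) summable_on \<Gamma>"
    by (rule summable_on_cong) (simp add: \<pi>\<^sub>0_scaleC orth_proj_scaleC[OF closed_L] gc)
  ultimately show "c *\<^sub>C x \<in> D" using x unfolding D_iff
    by (auto intro: summable_on_bounded_linear[OF bounded_linear_scaleC])
qed

text \<open>The half for \<open>\<pi>\<close> comes from the orthogonality of translates, the half
  for \<open>\<pi>\<^sub>0\<close> from condition (v) for the coset \<Gamma> g. All translates under
  \<open>G\<close> are covered because \<open>U_formal\<close> needs \<open>\<pi> g h\<close> in the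
  domain as well.\<close>

lemma translate_in_D: "g \<in> carrier G \<Longrightarrow> l \<in> L \<Longrightarrow> \<pi> g l \<in> D"
  unfolding D_iff
proof
  assume g: "g \<in> carrier G" and l: "l \<in> L"
  show "(\<lambda>\<gamma>. P (\<pi> \<gamma> (\<pi> g l))) summable_on \<Gamma>" by (rule translate_summable[OF g l])
  have inj: "inj_on (\<lambda>\<gamma>. \<gamma> \<otimes> g) \<Gamma>" using \<Gamma>_carrier g by (auto simp: inj_on_def subset_iff)
  have "(\<lambda>\<theta>. P (\<pi>\<^sub>0 \<theta> (P l))) summable_on ((\<lambda>\<gamma>. \<gamma> \<otimes> g) ` \<Gamma>)"
    using coset_pointwise_summable[OF g level_family.base] by (simp add: r_coset_eq_image)
  then have "(\<lambda>\<gamma>. P (\<pi>\<^sub>0 (\<gamma> \<otimes> g) l)) summable_on \<Gamma>"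
    unfolding summable_on_reindex[OF inj] o_def orth_proj_id[OF closed_L l] .
  then show "(\<lambda>\<gamma>. P (\<pi>\<^sub>0 \<gamma> (\<pi> g l))) summable_on \<Gamma>"
    by (rule summable_on_cong[THEN iffD1, rotated]) (use \<Gamma>_carrier g in \<open>auto simp: \<pi>\<^sub>0_mult_right\<close>)
qed

lemma level_space_translate_in_D:
  assumes "R \<subseteq> \<Gamma>" "g \<in> carrier G" "x \<in> level_space \<pi> L R"
  shows "\<pi> g x \<in> D"
proof -
  obtain v where v: "x = (\<Sum>s\<in>R. \<pi> s (v s))" "\<And>s. s \<in> R \<Longrightarrow> v s \<in> L"
    using assms by (auto simp: level_space_def)
  have "\<pi> g x = (\<Sum>s\<in>R. \<pi> (g \<otimes> s) (v s))"
    unfolding v(1) \<pi>_sum[OF assms(2)] using assms \<Gamma>_carrier by (intro sum.cong) (auto simp: \<pi>_mult)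
  also have "\<dots> \<in> D"
    using assms v \<Gamma>_carrier by (intro csubspace_sum[OF csubspace_D] translate_in_D) auto
  finally show ?thesis .
qed

lemma level_space_in_D: "R \<subseteq> \<Gamma> \<Longrightarrow> x \<in> level_space \<pi> L R \<Longrightarrow> x \<in> D"
  using level_space_translate_in_D[of R \<one> x] by simp

text \<open>The sum of the projections onto the translates of \<open>L\<close>, later identified
  with the orthogonal projection onto the level space. It comes first because closedness of the
  level space is deduced from it.\<close>

definition level_proj :: "'g set \<Rightarrow> 'h \<Rightarrow> 'h"
  where "level_proj R x = (\<Sum>s\<in>R. \<pi> s (P (\<pi> (inv s) x)))"

lemma level_proj_in: "level_proj R x \<in> level_space \<pi> L R"
  unfolding level_proj_def level_space_def
  by (intro CollectI exI[of _ "\<lambda>s. P (\<pi> (inv s) x)"]) (simp add: orth_proj_in[OF closed_L])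

text \<open>The translates are mutually orthogonal, so compressing to one of them recovers exactly
  the corresponding component.\<close>

lemma level_proj_id:
  assumes "finite R" "R \<subseteq> \<Gamma>" "x \<in> level_space \<pi> L R"
  shows "level_proj R x = x"
proof -
  obtain v where v: "x = (\<Sum>s\<in>R. \<pi> s (v s))" "\<And>s. s \<in> R \<Longrightarrow> v s \<in> L"
    using assms by (auto simp: level_space_def)
  have Rc: "s \<in> carrier G" if "s \<in> R" for s using that assms \<Gamma>_carrier by auto
  have "P (\<pi> (inv s) x) = v s" if s: "s \<in> R" for s
  proof (rule orth_proj_eqI)
    show "csubspace L" using closed_L by (simp add: closed_csubspace_iff)
    show "v s \<in> L" using v s by simp
    fix z assume z: "z \<in> L"
    have "cinner (\<pi> (inv s) x) z = cinner x (\<pi> s z)" using Rc[OF s] by (simp add: \<pi>_adj)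
    also have "\<dots> = (\<Sum>t\<in>R. cinner (\<pi> t (v t)) (\<pi> s z))" by (simp add: v(1) cinner_sum_left)
    also have "\<dots> = (\<Sum>t\<in>R. if t = s then cinner (v s) z else 0)"
      using s z v Rc assms by (intro sum.cong refl) (auto simp: L_orthogonal subset_iff \<pi>_cinner)
    also have "\<dots> = cinner (v s) z" using assms s by simp
    finally show "cinner (\<pi> (inv s) x - v s) z = 0" by (simp add: cinner_diff_left)
  qed
  then show ?thesis unfolding level_proj_def v(1) by simp
qed

lemma bounded_linear_level_proj: "R \<subseteq> \<Gamma> \<Longrightarrow> bounded_linear (level_proj R)"
  unfolding level_proj_def[abs_def] using \<Gamma>_carrier
  by (intro bounded_linear_sum bounded_linear_compose[OF \<pi>_bounded_linear]
    bounded_linear_compose[OF bounded_clinear_bounded_linear[OF bounded_clinear_orth_proj[OF closed_L]]] \<pi>_bounded_linear) auto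

text \<open>The level space is the fixed point set of a continuous operator.\<close>

lemma closed_level_space:
  assumes "finite R" "R \<subseteq> \<Gamma>"
  shows "closed_csubspace (level_space \<pi> L R)"
proof -
  have eq: "level_space \<pi> L R = {x. level_proj R x = x}"
  proof (intro subset_antisym subsetI)
    fix x assume "x \<in> level_space \<pi> L R"
    then show "x \<in> {x. level_proj R x = x}" using level_proj_id[OF assms] by simp
  next
    fix x assume "x \<in> {x. level_proj R x = x}"
    then show "x \<in> level_space \<pi> L R" using level_proj_in[of R x] by simp
  qed
  have cont: "continuous_on UNIV (level_proj R)"
    using bounded_linear_level_proj[OF assms(2)] by (rule linear_continuous_on)
  have "closed {x. level_proj R x = x}"
    by (intro closed_Collect_eq cont continuous_on_id)
  moreover have "P 0 = 0" using orth_proj_scaleC[OF closed_L, of 0 0] by simp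
  then have "csubspace {x. level_proj R x = x}"
    using assms \<Gamma>_carrier unfolding csubspace_def level_proj_def
    by (auto simp: \<pi>_add \<pi>_scaleC orth_proj_add[OF closed_L] orth_proj_scaleC[OF closed_L] subset_iff
        sum.distrib scaleC_sum_right[symmetric] intro!: sum.neutral)
  ultimately show ?thesis by (simp add: eq closed_csubspace_iff)
qed

lemma orth_proj_level_space:
  assumes "finite R" "R \<subseteq> \<Gamma>"
  shows "orth_proj (level_space \<pi> L R) x = level_proj R x"
proof (rule orth_proj_eqI)
  show "csubspace (level_space \<pi> L R)" using closed_level_space[OF assms] by (simp add: closed_csubspace_iff)
  show "level_proj R x \<in> level_space \<pi> L R" by (rule level_proj_in)
  fix z assume z: "z \<in> level_space \<pi> L R"
  have Rc: "s \<in> carrier G" if "s \<in> R" for s using that assms \<Gamma>_carrier by auto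
  have "cinner (level_proj R x) z = (\<Sum>s\<in>R. cinner x (\<pi> s (P (\<pi> (inv s) z))))"
    unfolding level_proj_def cinner_sum_left using Rc
    by (intro sum.cong refl) (simp add: \<pi>_adj orth_proj_selfadj[OF closed_L])
  also have "\<dots> = cinner x (level_proj R z)" by (simp add: level_proj_def cinner_sum_right)
  also have "\<dots> = cinner x z" by (simp add: level_proj_id[OF assms z])
  finally show "cinner (x - level_proj R x) z = 0" by (simp add: cinner_diff_left)
qed

section \<open>Level vectors\<close>

context
  fixes \<Lambda> R :: "'g set"
  assumes \<Lambda>: "\<Lambda> \<in> level_family G \<Gamma>" and R: "right_transversal G \<Gamma> \<Lambda> R"
begin

lemma R_finite: "finite R" by (rule level_transversal_finite[OF \<Lambda> R])
lemma R_subset: "R \<subseteq> \<Gamma>" by (rule right_transversalD[OF R])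

abbreviation LS :: "'h set" where "LS \<equiv> level_space \<pi> L R"
abbreviation lv :: "'h \<Rightarrow> 'h" where "lv \<equiv> level_vector \<pi>\<^sub>0 \<pi> L R \<Lambda>"

text \<open>Cut into blocks, the sum over \<Lambda> becomes finitely many sums over the translates
  s^{-1} \<Lambda>, which lie in \<Gamma>, where membership in \<open>D\<close> gives
  convergence.\<close>

lemma level_vector_has_sum:
  assumes h: "h \<in> D"
  shows "((\<lambda>\<gamma>. orth_proj LS (\<pi>\<^sub>0 \<gamma> h)) has_sum lv h) \<Lambda>"
proof -
  have Rc: "s \<in> carrier G" if "s \<in> R" for s using that R_subset \<Gamma>_carrier by auto
  have \<Lambda>c: "\<gamma> \<in> carrier G" if "\<gamma> \<in> \<Lambda>" for \<gamma> using that level_carrier[OF \<Lambda>] by auto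
  have one: "(\<lambda>\<gamma>. \<pi> s (P (\<pi> (inv s) (\<pi>\<^sub>0 \<gamma> h)))) summable_on \<Lambda>" if s: "s \<in> R" for s
  proof (rule summable_on_bounded_linear[OF \<pi>_bounded_linear[OF Rc[OF s]]])
    have inj: "inj_on (\<lambda>\<gamma>. inv s \<otimes> \<gamma>) \<Lambda>" using \<Lambda>c Rc[OF s] by (auto simp: inj_on_def)
    have "(\<lambda>\<gamma>. inv s \<otimes> \<gamma>) ` \<Lambda> \<subseteq> \<Gamma>"
      using s R_subset level_subset[OF \<Lambda>] subgroup.m_closed[OF subgroup_\<Gamma>]
        subgroup.m_inv_closed[OF subgroup_\<Gamma>] by (auto simp: subset_iff)
    then have "(\<lambda>\<gamma>. P (\<pi>\<^sub>0 \<gamma> h)) summable_on ((\<lambda>\<gamma>. inv s \<otimes> \<gamma>) ` \<Lambda>)"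
      using h unfolding D_iff by (auto intro: summable_on_subset_banach[of _ \<Gamma>])
    then have "(\<lambda>\<gamma>. P (\<pi>\<^sub>0 (inv s \<otimes> \<gamma>) h)) summable_on \<Lambda>"
      unfolding summable_on_reindex[OF inj] o_def .
    then show "(\<lambda>\<gamma>. P (\<pi> (inv s) (\<pi>\<^sub>0 \<gamma> h))) summable_on \<Lambda>"
      by (rule summable_on_cong[THEN iffD1, rotated]) (use \<Lambda>c Rc s in \<open>auto simp: \<pi>\<^sub>0_mult_left\<close>)
  qed
  have "(\<lambda>\<gamma>. orth_proj LS (\<pi>\<^sub>0 \<gamma> h)) summable_on \<Lambda>"
    unfolding orth_proj_level_space[OF R_finite R_subset] level_proj_def
    by (rule has_sum_imp_summable[OF has_sum_finite_sum]) (rule has_sum_infsum[OF one])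
  then show ?thesis unfolding level_vector_def by simp
qed

lemma closed_LS: "closed_csubspace LS"
  by (rule closed_level_space[OF R_finite R_subset])

lemma LS_D: "x \<in> LS \<Longrightarrow> x \<in> D"
  by (rule level_space_in_D[OF R_subset])

lemma level_vector_in: "h \<in> D \<Longrightarrow> lv h \<in> LS"
  by (rule has_sum_closed_csubspace[OF closed_LS level_vector_has_sum]) (simp_all add: orth_proj_in[OF closed_LS])

lemma level_vector_cinner:
  assumes h: "h \<in> D" and y: "y \<in> LS"
  shows "((\<lambda>\<gamma>. cinner (\<pi>\<^sub>0 \<gamma> h) y) has_sum cinner (lv h) y) \<Lambda>"
  using has_sum_cinner_left[OF level_vector_has_sum[OF h], of y]
  by (simp add: orth_proj_cinner_left[OF closed_LS y])

lemma level_vector_add: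
  assumes "x \<in> D" "y \<in> D"
  shows "lv (x + y) = lv x + lv y"
proof -
  have "((\<lambda>\<gamma>. orth_proj LS (\<pi>\<^sub>0 \<gamma> x) + orth_proj LS (\<pi>\<^sub>0 \<gamma> y)) has_sum lv x + lv y) \<Lambda>"
    by (intro has_sum_add level_vector_has_sum assms)
  then have "((\<lambda>\<gamma>. orth_proj LS (\<pi>\<^sub>0 \<gamma> (x + y))) has_sum lv x + lv y) \<Lambda>"
    by (rule has_sum_cong[THEN iffD1, rotated])
      (use level_carrier[OF \<Lambda>] in \<open>auto simp: \<pi>\<^sub>0_add orth_proj_add[OF closed_LS]\<close>)
  then show ?thesis
    by (rule has_sum_unique[OF level_vector_has_sum[OF csubspace_add[OF csubspace_D assms]]])
qed

lemma level_vector_scaleC: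
  assumes "x \<in> D"
  shows "lv (c *\<^sub>C x) = c *\<^sub>C lv x"
proof -
  have "((\<lambda>\<gamma>. c *\<^sub>C orth_proj LS (\<pi>\<^sub>0 \<gamma> x)) has_sum c *\<^sub>C lv x) \<Lambda>"
    by (intro has_sum_scaleC level_vector_has_sum assms)
  then have "((\<lambda>\<gamma>. orth_proj LS (\<pi>\<^sub>0 \<gamma> (c *\<^sub>C x))) has_sum c *\<^sub>C lv x) \<Lambda>"
    by (rule has_sum_cong[THEN iffD1, rotated])
      (use level_carrier[OF \<Lambda>] in \<open>auto simp: \<pi>\<^sub>0_scaleC orth_proj_scaleC[OF closed_LS]\<close>)
  then show ?thesis
    by (rule has_sum_unique[OF level_vector_has_sum[OF csubspace_scaleC[OF csubspace_D assms]]])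
qed

lemma level_vector_diff:
  assumes "x \<in> D" "y \<in> D"
  shows "lv (x - y) = lv x - lv y"
  using level_vector_add[of "x - y" y] csubspace_diff[OF csubspace_D assms] assms by simp

text \<open>The adjoint of \<open>\<pi>\<^sub>0 \<gamma>\<close> is
  \<open>\<pi>\<^sub>0 (inv \<gamma>)\<close>, and inversion permutes \<Lambda>.\<close>

lemma level_vector_selfadj:
  assumes x: "x \<in> LS" and y: "y \<in> LS"
  shows "cinner (lv x) y = cinner x (lv y)"
proof -
  have \<Lambda>c: "\<gamma> \<in> carrier G" if "\<gamma> \<in> \<Lambda>" for \<gamma> using that level_carrier[OF \<Lambda>] by auto
  have bij: "bij_betw (\<lambda>\<gamma>. inv \<gamma>) \<Lambda> \<Lambda>"
    using \<Lambda>c subgroup.m_inv_closed[OF level_subgroup[OF \<Lambda>]]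
    by (intro bij_betwI[where g = "\<lambda>\<gamma>. inv \<gamma>"]) auto
  have "((\<lambda>\<gamma>. cinner (\<pi>\<^sub>0 (inv \<gamma>) x) y) has_sum cinner (lv x) y) \<Lambda>"
    using has_sum_reindex_bij_betw[OF bij, of "\<lambda>\<gamma>. cinner (\<pi>\<^sub>0 \<gamma> x) y"]
      level_vector_cinner[OF LS_D[OF x] y] by simp
  moreover have "((\<lambda>\<gamma>. cinner (\<pi>\<^sub>0 (inv \<gamma>) x) y) has_sum cinner x (lv y)) \<Lambda>"
  proof -
    have "((\<lambda>\<gamma>. cnj (cinner (\<pi>\<^sub>0 \<gamma> y) x)) has_sum cnj (cinner (lv y) x)) \<Lambda>"
      using level_vector_cinner[OF LS_D[OF y] x] by simp
    then have "((\<lambda>\<gamma>. cinner x (\<pi>\<^sub>0 \<gamma> y)) has_sum cinner x (lv y)) \<Lambda>"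
      by (simp add: cinner_commute[symmetric])
    then show ?thesis
      by (rule has_sum_cong[THEN iffD1, rotated]) (simp add: \<pi>\<^sub>0_adj \<Lambda>c)
  qed
  ultimately show ?thesis by (rule has_sum_unique)
qed

end

section \<open>Comparison of levels and their indices\<close>

lemma translate_in_level_space:
  assumes "finite S" "s \<in> S" "l \<in> L" "S \<subseteq> \<Gamma>"
  shows "\<pi> s l \<in> level_space \<pi> L S"
proof -
  have "0 \<in> L" using closed_L by (simp add: closed_csubspace_iff csubspace_0)
  moreover have "(\<Sum>t\<in>S. \<pi> t (if t = s then l else 0)) = \<pi> s l"
  proof -
    have "(\<Sum>t\<in>S. \<pi> t (if t = s then l else 0)) = (\<Sum>t\<in>S. if t = s then \<pi> s l else 0)"
      using assms \<Gamma>_carrier by (intro sum.cong) auto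
    then show ?thesis using assms by simp
  qed
  ultimately show ?thesis unfolding level_space_def using assms
    by (intro CollectI exI[of _ "\<lambda>t. if t = s then l else 0"]) auto
qed

lemma level_space_trans:
  assumes "finite T" "finite R" "R \<subseteq> \<Gamma>" "T \<subseteq> \<Gamma>" and t: "t \<in> T" and y: "y \<in> level_space \<pi> L R"
  shows "\<pi> t y \<in> level_space \<pi> L ((\<lambda>(t, s). t \<otimes> s) ` (T \<times> R))" (is "_ \<in> level_space \<pi> L ?S")
proof -
  obtain v where v: "y = (\<Sum>s\<in>R. \<pi> s (v s))" "\<And>s. s \<in> R \<Longrightarrow> v s \<in> L"
    using y by (auto simp: level_space_def)
  have Tc: "T \<subseteq> carrier G" and Rc: "R \<subseteq> carrier G" using assms \<Gamma>_carrier by auto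
  have S: "finite ?S" "?S \<subseteq> \<Gamma>"
    using assms subgroup.m_closed[OF subgroup_\<Gamma>] by (auto simp: subset_iff)
  have "\<pi> t y = (\<Sum>s\<in>R. \<pi> (t \<otimes> s) (v s))"
    unfolding v(1) using t Tc Rc by (subst \<pi>_sum) (auto simp: \<pi>_mult subset_iff)
  also have "\<dots> \<in> level_space \<pi> L ?S"
  proof (rule csubspace_sum)
    show "csubspace (level_space \<pi> L ?S)" using closed_level_space[OF S] by (simp add: closed_csubspace_iff)
    fix s assume "s \<in> R"
    then show "\<pi> (t \<otimes> s) (v s) \<in> level_space \<pi> L ?S"
      using v t by (intro translate_in_level_space[OF S(1) _ _ S(2)]) auto
  qed
  finally show ?thesis .
qed

text \<open>The index is a cardinality, hence 0 for infinitely many cosets; finiteness makes the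
  factor 1/[\<Gamma> : \<Lambda>] in the scalar product meaningful.\<close>

lemma index_pos:
  assumes "\<Lambda> \<in> level_family G \<Gamma>"
  shows "index_in G \<Gamma> \<Lambda> > 0"
proof -
  obtain R where R: "right_transversal G \<Gamma> \<Lambda> R"
    using right_transversal_exists[OF subgroup_\<Gamma> level_subgroup[OF assms] level_subset[OF assms]] by blast
  have "R \<noteq> {}" using right_transversalD(2)[OF R subgroup.one_closed[OF subgroup_\<Gamma>]] by auto
  then have "card R > 0" using level_transversal_finite[OF assms R] by (simp add: card_gt_0_iff)
  then show ?thesis
    using right_transversal_card[OF subgroup_\<Gamma> level_subgroup[OF assms] level_subset[OF assms] R] by simp
qed

lemma index_mult:
  assumes A: "A \<in> level_family G \<Gamma>" and B: "B \<in> level_family G \<Gamma>" and BA: "B \<subseteq> A"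
  shows "index_in G \<Gamma> B = index_in G \<Gamma> A * index_in G A B"
proof -
  note sA = level_subgroup[OF A] and sB = level_subgroup[OF B]
  obtain R where R: "right_transversal G \<Gamma> A R"
    using right_transversal_exists[OF subgroup_\<Gamma> sA level_subset[OF A]] by blast
  obtain T where T: "right_transversal G A B T"
    using right_transversal_exists[OF sA sB BA] by blast
  note tr = right_transversal_trans[OF subgroup_\<Gamma> sA sB level_subset[OF A] BA R T]
  have "index_in G \<Gamma> B = card (T \<times> R)"
    using right_transversal_card[OF subgroup_\<Gamma> sB level_subset[OF B] tr(1)] card_image[OF tr(2)] by simp
  then show ?thesis
    using right_transversal_card[OF subgroup_\<Gamma> sA level_subset[OF A] R]
      right_transversal_card[OF sA sB BA T] by (simp add: card_cartesian_product)
qed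

text \<open>The block of a sum over \<Lambda> k between the translates for \<open>s\<close> and
  \<open>s'\<close> runs over a right coset of s'^{-1} \<Lambda> s', the shape that condition (v)
  handles.\<close>

lemma bij_betw_conj_coset:
  assumes \<Lambda>: "\<Lambda> \<in> level_family G \<Gamma>" and s: "s \<in> carrier G" "s' \<in> carrier G" and k: "k \<in> carrier G"
  shows "bij_betw (\<lambda>\<gamma>. inv s' \<otimes> \<gamma> \<otimes> k \<otimes> s) \<Lambda> (conj_set G (inv s') \<Lambda> #> (inv s' \<otimes> k \<otimes> s))"
proof -
  have \<Lambda>c: "\<And>\<gamma>. \<gamma> \<in> \<Lambda> \<Longrightarrow> \<gamma> \<in> carrier G" using level_carrier[OF \<Lambda>] by auto
  have "inv s' \<otimes> \<gamma> \<otimes> inv (inv s') \<otimes> (inv s' \<otimes> k \<otimes> s) = inv s' \<otimes> \<gamma> \<otimes> k \<otimes> s" if "\<gamma> \<in> \<Lambda>" for \<gamma>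
    using s k \<Lambda>c[OF that] by (simp add: m_assoc)
  then have "conj_set G (inv s') \<Lambda> #> (inv s' \<otimes> k \<otimes> s) = (\<lambda>\<gamma>. inv s' \<otimes> \<gamma> \<otimes> k \<otimes> s) ` \<Lambda>"
    unfolding conj_set_eq r_coset_eq_image image_image by (intro image_cong) auto
  moreover have "inj_on (\<lambda>\<gamma>. inv s' \<otimes> \<gamma> \<otimes> k \<otimes> s) \<Lambda>"
    using s k \<Lambda>c by (auto simp: inj_on_def)
  ultimately show ?thesis by (simp add: bij_betw_def)
qed

section \<open>The fixed vectors of a level form a finite-dimensional space\<close>

context
  fixes \<Lambda> R :: "'g set"
  assumes \<Lambda>: "\<Lambda> \<in> level_family G \<Gamma>" and R: "right_transversal G \<Gamma> \<Lambda> R"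
begin

text \<open>On \<pi>(s) L the averaging operator is a finite sum of unitaries applied to
  Hilbert--Schmidt coset sums, one for each target block.\<close>

lemma level_vector_hilbert_schmidt:
  assumes s: "s \<in> R"
  shows "(\<lambda>e. (norm (level_vector \<pi>\<^sub>0 \<pi> L R \<Lambda> (\<pi> s (P e))))\<^sup>2) summable_on some_onb"
proof -
  have Rfin: "finite R" and RG: "R \<subseteq> \<Gamma>" using R_finite[OF \<Lambda> R] R_subset[OF \<Lambda> R] .
  have Rc: "\<And>s. s \<in> R \<Longrightarrow> s \<in> carrier G" using RG \<Gamma>_carrier by auto
  have \<Lambda>c: "\<And>\<gamma>. \<gamma> \<in> \<Lambda> \<Longrightarrow> \<gamma> \<in> carrier G" using level_carrier[OF \<Lambda>] by auto
  have "\<exists>T. hs_has_sum (\<lambda>\<theta>. P \<circ> \<pi>\<^sub>0 \<theta> \<circ> P) (conj_set G (inv s') \<Lambda> #> (inv s' \<otimes> \<one> \<otimes> s)) T" if s': "s' \<in> R" for s'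
  proof -
    have s'\<Gamma>: "inv s' \<in> \<Gamma>" using s' RG subgroup.m_inv_closed[OF subgroup_\<Gamma>] by auto
    have "inv s' \<otimes> \<one> \<otimes> s \<in> carrier G" using Rc[OF s] Rc[OF s'] by simp
    from coset_sums[OF this level_conj_set[OF \<Lambda> s'\<Gamma>]] show ?thesis by blast
  qed
  then obtain T where T: "\<And>s'. s' \<in> R \<Longrightarrow>
      hs_has_sum (\<lambda>\<theta>. P \<circ> \<pi>\<^sub>0 \<theta> \<circ> P) (conj_set G (inv s') \<Lambda> #> (inv s' \<otimes> \<one> \<otimes> s)) (T s')" by metis
  \<comment> \<open>Both sides are limits of one series, summed once in the level space and once
    block by block.\<close>
  have lv: "level_vector \<pi>\<^sub>0 \<pi> L R \<Lambda> (\<pi> s (P e)) = (\<Sum>s'\<in>R. \<pi> s' (T s' e))" for e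
  proof (rule has_sum_unique)
    have "\<pi> s (P e) \<in> D" by (rule translate_in_D[OF Rc[OF s] orth_proj_in[OF closed_L]])
    from level_vector_has_sum[OF \<Lambda> R this]
    show "((\<lambda>\<gamma>. level_proj R (\<pi>\<^sub>0 \<gamma> (\<pi> s (P e)))) has_sum level_vector \<pi>\<^sub>0 \<pi> L R \<Lambda> (\<pi> s (P e))) \<Lambda>"
      by (simp add: orth_proj_level_space[OF Rfin RG])
    show "((\<lambda>\<gamma>. level_proj R (\<pi>\<^sub>0 \<gamma> (\<pi> s (P e)))) has_sum (\<Sum>s'\<in>R. \<pi> s' (T s' e))) \<Lambda>"
      unfolding level_proj_def
    proof (rule has_sum_finite_sum)
      fix s' assume s': "s' \<in> R"
      have "((\<lambda>\<theta>. P (\<pi>\<^sub>0 \<theta> (P e))) has_sum T s' e) (conj_set G (inv s') \<Lambda> #> (inv s' \<otimes> \<one> \<otimes> s))"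
        using hs_has_sum_pointwise[OF T[OF s']] by simp
      then have "((\<lambda>\<gamma>. P (\<pi>\<^sub>0 (inv s' \<otimes> \<gamma> \<otimes> \<one> \<otimes> s) (P e))) has_sum T s' e) \<Lambda>"
        using has_sum_reindex_bij_betw[OF bij_betw_conj_coset[OF \<Lambda> Rc[OF s] Rc[OF s'] one_closed],
            of "\<lambda>\<theta>. P (\<pi>\<^sub>0 \<theta> (P e))"] by simp
      then have "((\<lambda>\<gamma>. \<pi> s' (P (\<pi>\<^sub>0 (inv s' \<otimes> \<gamma> \<otimes> \<one> \<otimes> s) (P e)))) has_sum \<pi> s' (T s' e)) \<Lambda>"
        by (rule has_sum_bounded_linear[OF \<pi>_bounded_linear[OF Rc[OF s']]])
      then show "((\<lambda>\<gamma>. \<pi> s' (P (\<pi> (inv s') (\<pi>\<^sub>0 \<gamma> (\<pi> s (P e)))))) has_sum \<pi> s' (T s' e)) \<Lambda>"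
        by (rule has_sum_cong[THEN iffD1, rotated])
          (use Rc[OF s] Rc[OF s'] \<Lambda>c in \<open>simp add: \<pi>\<^sub>0_apply proj_H\<^sub>0_\<pi> \<pi>_mult\<close>)
    qed
  qed
  show ?thesis unfolding lv
  proof (rule square_summable_sum)
    fix s' assume s': "s' \<in> R"
    show "(\<lambda>e. (norm (\<pi> s' (T s' e)))\<^sup>2) summable_on some_onb"
      using T[OF s'] by (simp add: \<pi>_norm[OF Rc[OF s']] hs_has_sum_def hilbert_schmidt_def)
  qed
qed

text \<open>A self-adjoint operator has squared Hilbert--Schmidt norm at least the size of any
  orthonormal set of fixed vectors. The right-hand side is that squared norm, taken along the blocks
  of the level space.\<close>

lemma card_fixed_orthonormal_le:
  assumes F: "finite F" "orthonormal F"
    and fixed: "\<And>f. f \<in> F \<Longrightarrow> f \<in> level_space \<pi> L R \<and> level_vector \<pi>\<^sub>0 \<pi> L R \<Lambda> f = f"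
  shows "real (card F) \<le>
    (\<Sum>s\<in>R. \<Sum>\<^sub>\<infinity>e\<in>some_onb. (norm (level_vector \<pi>\<^sub>0 \<pi> L R \<Lambda> (\<pi> s (P e))))\<^sup>2)"
proof -
  let ?z = "\<lambda>s e. level_vector \<pi>\<^sub>0 \<pi> L R \<Lambda> (\<pi> s (P e))"
  have Rfin: "finite R" and RG: "R \<subseteq> \<Gamma>" using R_finite[OF \<Lambda> R] R_subset[OF \<Lambda> R] .
  have Rc: "\<And>s. s \<in> R \<Longrightarrow> s \<in> carrier G" using RG \<Gamma>_carrier by auto
  have PL: "P x \<in> L" for x by (rule orth_proj_in[OF closed_L])
  have one: "1 = (\<Sum>s\<in>R. (norm (P (\<pi> (inv s) f)))\<^sup>2)" if f: "f \<in> F" for f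
  proof -
    have "f = (\<Sum>s\<in>R. \<pi> s (P (\<pi> (inv s) f)))"
      using level_proj_id[OF Rfin RG] fixed[OF f] unfolding level_proj_def by metis
    then have "(norm f)\<^sup>2 = (norm (\<Sum>s\<in>R. \<pi> s (P (\<pi> (inv s) f))))\<^sup>2" by simp
    also have "\<dots> = (\<Sum>s\<in>R. (norm (\<pi> s (P (\<pi> (inv s) f))))\<^sup>2)"
      by (rule norm_sum_orthogonal[OF Rfin]) (use RG in \<open>auto intro!: L_orthogonal PL\<close>)
    also have "\<dots> = (\<Sum>s\<in>R. (norm (P (\<pi> (inv s) f)))\<^sup>2)"
      by (intro sum.cong refl) (simp add: \<pi>_norm Rc)
    finally show ?thesis using F f by (simp add: orthonormal_def)
  qed
  \<comment> \<open>Self-adjointness moves the averaging operator from the fixed vector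
    \<open>f\<close> to the basis vector, so that Bessel over \<open>F\<close> can be applied for
    each fixed \<open>e\<close>.\<close>
  have coeff: "cinner (P (\<pi> (inv s) f)) e = cinner f (?z s e)" if "f \<in> F" "s \<in> R" for f s e
  proof -
    have zL: "\<pi> s (P e) \<in> level_space \<pi> L R" by (rule translate_in_level_space[OF Rfin that(2) PL RG])
    have "cinner (P (\<pi> (inv s) f)) e = cinner f (\<pi> s (P e))"
      using Rc[OF that(2)] by (simp add: orth_proj_selfadj[OF closed_L] \<pi>_adj)
    also have "\<dots> = cinner f (?z s e)"
      using level_vector_selfadj[OF \<Lambda> R _ zL, of f] fixed[OF that(1)] by simp
    finally show ?thesis .
  qed
  have "real (card F) = (\<Sum>f\<in>F. \<Sum>s\<in>R. (norm (P (\<pi> (inv s) f)))\<^sup>2)"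
    using one by simp
  also have "\<dots> = (\<Sum>s\<in>R. \<Sum>f\<in>F. (norm (P (\<pi> (inv s) f)))\<^sup>2)" by (rule sum.swap)
  also have "\<dots> \<le> (\<Sum>s\<in>R. \<Sum>\<^sub>\<infinity>e\<in>some_onb. (norm (?z s e))\<^sup>2)"
  proof (rule sum_mono)
    fix s assume s: "s \<in> R"
    have "((\<lambda>e. (cmod (cinner f (?z s e)))\<^sup>2) has_sum (norm (P (\<pi> (inv s) f)))\<^sup>2) some_onb" if "f \<in> F" for f
      using Parseval_norm[of "P (\<pi> (inv s) f)"] by (simp add: coeff[OF that s])
    then have "((\<lambda>e. \<Sum>f\<in>F. (cmod (cinner f (?z s e)))\<^sup>2) has_sum (\<Sum>f\<in>F. (norm (P (\<pi> (inv s) f)))\<^sup>2)) some_onb"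
      by (rule has_sum_finite_sum)
    moreover have "(\<Sum>f\<in>F. (cmod (cinner f z))\<^sup>2) \<le> (norm z)\<^sup>2" for z
    proof -
      have "cmod (cinner f z) = cmod (cinner z f)" for f using cinner_commute[of f z] by simp
      then show ?thesis using Bessel_finite[OF F(2,1), of z] by simp
    qed
    ultimately show "(\<Sum>f\<in>F. (norm (P (\<pi> (inv s) f)))\<^sup>2) \<le> (\<Sum>\<^sub>\<infinity>e\<in>some_onb. (norm (?z s e))\<^sup>2)"
      by (rule has_sum_mono[OF _ has_sum_infsum[OF level_vector_hilbert_schmidt[OF s]]])
  qed
  finally show ?thesis .
qed

text \<open>A self-adjoint idempotent is the projection onto its fixed vectors. Idempotence enters
  as a hypothesis because its source is the identification of formal sums, available only once the
  completion is present.\<close>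

lemma fixed_vectors_basis:
  assumes idem: "\<And>x. x \<in> level_space \<pi> L R \<Longrightarrow>
    level_vector \<pi>\<^sub>0 \<pi> L R \<Lambda> (level_vector \<pi>\<^sub>0 \<pi> L R \<Lambda> x) = level_vector \<pi>\<^sub>0 \<pi> L R \<Lambda> x"
  shows "\<exists>B. finite B \<and> orthonormal B \<and>
    (\<forall>e\<in>B. e \<in> level_space \<pi> L R \<and> level_vector \<pi>\<^sub>0 \<pi> L R \<Lambda> e = e) \<and>
    (\<forall>x\<in>level_space \<pi> L R. level_vector \<pi>\<^sub>0 \<pi> L R \<Lambda> x = (\<Sum>e\<in>B. cinner x e *\<^sub>C e))"
proof -
  let ?lv = "level_vector \<pi>\<^sub>0 \<pi> L R \<Lambda>"
  let ?LS = "level_space \<pi> L R"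
  let ?W = "{x \<in> ?LS. ?lv x = x}"
  have cLS: "csubspace ?LS" using closed_LS[OF \<Lambda> R] by (simp add: closed_csubspace_iff)
  have LSD: "x \<in> D" if "x \<in> ?LS" for x using that by (rule LS_D[OF \<Lambda> R])
  have "?lv 0 = 0" using level_vector_scaleC[OF \<Lambda> R csubspace_0[OF csubspace_D], of 0] by simp
  then have W: "csubspace ?W"
    unfolding csubspace_def
    using cLS by (auto simp: csubspace_0 csubspace_add csubspace_scaleC level_vector_add[OF \<Lambda> R LSD LSD]
      level_vector_scaleC[OF \<Lambda> R LSD])
  obtain B where B: "onb_of ?W B" using onb_exists[OF W] by blast
  have BW: "B \<subseteq> ?W" and on: "orthonormal B" and ker: "\<And>x. x \<in> ?W \<Longrightarrow> (\<And>e. e \<in> B \<Longrightarrow> cinner x e = 0) \<Longrightarrow> x = 0"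
    using B by (auto simp: onb_of_iff)
  \<comment> \<open>An infinite basis would contain orthonormal sets of every finite size, against
    the uniform bound.\<close>
  have fin: "finite B"
  proof (rule ccontr)
    assume inf: "infinite B"
    define C where "C = (\<Sum>s\<in>R. \<Sum>\<^sub>\<infinity>e\<in>some_onb. (norm (?lv (\<pi> s (P e))))\<^sup>2)"
    obtain k :: nat where k: "C < real k" using reals_Archimedean2 by blast
    obtain F where F: "finite F" "card F = k" "F \<subseteq> B" using infinite_arbitrarily_large[OF inf] by blast
    have "real (card F) \<le> C"
      unfolding C_def by (rule card_fixed_orthonormal_le[OF F(1) orthonormal_subset[OF on F(3)]]) (use F BW in auto)
    then show False using F k by simp
  qed
  have "?lv x = (\<Sum>e\<in>B. cinner x e *\<^sub>C e)" if x: "x \<in> ?LS" for x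
  proof -
    have lx: "?lv x \<in> ?W" using idem[OF x] level_vector_in[OF \<Lambda> R LSD[OF x]] by simp
    have "(\<Sum>e\<in>B. cinner x e *\<^sub>C e) \<in> ?W"
      by (rule csubspace_sum[OF W]) (rule csubspace_scaleC[OF W], use BW in auto)
    then have diff: "?lv x - (\<Sum>e\<in>B. cinner x e *\<^sub>C e) \<in> ?W" using csubspace_diff[OF W lx] by blast
    \<comment> \<open>The difference is itself fixed and orthogonal to \<open>B\<close>, and
      maximality of \<open>B\<close> among the fixed vectors applies.\<close>
    have "?lv x - (\<Sum>e\<in>B. cinner x e *\<^sub>C e) = 0"
    proof (rule ker[OF diff])
      fix e assume e: "e \<in> B"
      have eW: "e \<in> ?LS" "?lv e = e" using e BW by auto
      have "cinner (?lv x) e = cinner x e"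
        using level_vector_selfadj[OF \<Lambda> R x eW(1)] eW by simp
      moreover have "cinner (\<Sum>f\<in>B. cinner x f *\<^sub>C f) e = (\<Sum>f\<in>B. if f = e then cinner x e else 0)"
        unfolding cinner_sum_left cinner_scaleC_left
        using on e by (intro sum.cong refl) (simp add: orthonormal_cinner)
      ultimately show "cinner (?lv x - (\<Sum>e\<in>B. cinner x e *\<^sub>C e)) e = 0"
        using fin e by (simp add: cinner_diff_left)
    qed
    then show ?thesis by simp
  qed
  then show ?thesis using fin on BW by blast
qed

end

end

section \<open>The trace of the Hecke operator\<close>

context virtual_representation
begin

section \<open>Linearity of formal sums and their scalar products across levels\<close>

lemma \<Phi>_add: "\<Lambda> \<in> level_family G \<Gamma> \<Longrightarrow> x \<in> D \<Longrightarrow> y \<in> D \<Longrightarrow> \<Phi> \<Lambda> (x + y) = \<Phi> \<Lambda> x + \<Phi> \<Lambda> y"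
  and \<Phi>_scaleC: "\<Lambda> \<in> level_family G \<Gamma> \<Longrightarrow> x \<in> D \<Longrightarrow> \<Phi> \<Lambda> (c *\<^sub>C x) = c *\<^sub>C \<Phi> \<Lambda> x"
  using formal_linear[of \<Lambda>] by (auto simp: clinear_on_def)

lemma \<Phi>_diff: "\<Lambda> \<in> level_family G \<Gamma> \<Longrightarrow> x \<in> D \<Longrightarrow> y \<in> D \<Longrightarrow> \<Phi> \<Lambda> (x - y) = \<Phi> \<Lambda> x - \<Phi> \<Lambda> y"
  using \<Phi>_add[of \<Lambda> "x - y" y] csubspace_diff[OF csubspace_D, of x y] by simp

lemma \<Phi>_sum:
  assumes "\<Lambda> \<in> level_family G \<Gamma>" "\<And>i. i \<in> I \<Longrightarrow> f i \<in> D"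
  shows "\<Phi> \<Lambda> (\<Sum>i\<in>I. f i) = (\<Sum>i\<in>I. \<Phi> \<Lambda> (f i))"
proof -
  have "\<Phi> \<Lambda> 0 = 0" using \<Phi>_scaleC[OF assms(1) csubspace_0[OF csubspace_D], of 0] by simp
  then show ?thesis using assms(2)
    by (induction I rule: infinite_finite_induct)
      (simp_all add: \<Phi>_add[OF assms(1)] csubspace_sum[OF csubspace_D])
qed

context
  fixes \<Lambda> R :: "'g set"
  assumes \<Lambda>: "\<Lambda> \<in> level_family G \<Gamma>" and R: "right_transversal G \<Gamma> \<Lambda> R"
begin

text \<open>\<open>\<Phi> \<Lambda>\<close> annihilates \<open>h\<close> minus its level vector. The
  scalar product of that difference with itself is a positive multiple of the squared norm of its
  level vector, which must vanish.\<close>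

lemma level_vector_idem:
  assumes h: "h \<in> D"
  shows "level_vector \<pi>\<^sub>0 \<pi> L R \<Lambda> (level_vector \<pi>\<^sub>0 \<pi> L R \<Lambda> h) = level_vector \<pi>\<^sub>0 \<pi> L R \<Lambda> h"
proof -
  let ?lv = "level_vector \<pi>\<^sub>0 \<pi> L R \<Lambda>"
  have lD: "?lv h \<in> D" by (rule LS_D[OF \<Lambda> R level_vector_in[OF \<Lambda> R h]])
  have dD: "h - ?lv h \<in> D" by (rule csubspace_diff[OF csubspace_D h lD])
  have "\<Phi> \<Lambda> (h - ?lv h) = 0" using \<Phi>_diff[OF \<Lambda> h lD] formal_ident[OF \<Lambda> R h] by simp
  then have "0 = 1 / of_nat (index_in G \<Gamma> \<Lambda>) * cinner (?lv (h - ?lv h)) (?lv (h - ?lv h))"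
    using formal_cinner[OF \<Lambda> R dD dD] by simp
  then have "?lv (h - ?lv h) = 0" using index_pos[OF \<Lambda>] by (simp add: cinner_self_eq_0_iff)
  then show ?thesis using level_vector_diff[OF \<Lambda> R h lD] by simp
qed

lemma formal_cinner_sum:
  assumes h: "h \<in> D" and y: "y \<in> level_space \<pi> L R"
  shows "((\<lambda>\<gamma>. cinner (\<pi>\<^sub>0 \<gamma> h) y) has_sum
    of_nat (index_in G \<Gamma> \<Lambda>) * cinner (\<Phi> \<Lambda> h) (\<Phi> \<Lambda> y)) \<Lambda>"
proof -
  let ?lv = "level_vector \<pi>\<^sub>0 \<pi> L R \<Lambda>"
  have "cinner (?lv h) (?lv y) = cinner (?lv h) y"
    using level_vector_selfadj[OF \<Lambda> R level_vector_in[OF \<Lambda> R h] y] level_vector_idem[OF h] by simp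
  then have "of_nat (index_in G \<Gamma> \<Lambda>) * cinner (\<Phi> \<Lambda> h) (\<Phi> \<Lambda> y) = cinner (?lv h) y"
    using formal_cinner[OF \<Lambda> R h LS_D[OF \<Lambda> R y]] index_pos[OF \<Lambda>] by simp
  then show ?thesis using level_vector_cinner[OF \<Lambda> R h y] by simp
qed

end

text \<open>The mixed case: \<open>h\<close> gives a formal sum over \<open>M\<close>,
  \<open>y\<close> one over \<Lambda>. Written at level \<open>M\<close>, the latter splits into the
  translates \<open>\<pi> t y\<close>. Moving \<open>\<pi> t\<close> across the inner product turns
  the sum over \<open>M\<close> into one over t^{-1} M, and these left cosets partition
  \<Lambda>.\<close>

lemma formal_cinner_sum_sublevel:
  assumes \<Lambda>: "\<Lambda> \<in> level_family G \<Gamma>" and R: "right_transversal G \<Gamma> \<Lambda> R"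
    and M: "M \<in> level_family G \<Gamma>" and M\<Lambda>: "M \<subseteq> \<Lambda>"
    and h: "h \<in> D" and y: "y \<in> level_space \<pi> L R"
  shows "((\<lambda>\<gamma>. cinner (\<pi>\<^sub>0 \<gamma> h) y) has_sum
    of_nat (index_in G \<Gamma> M) * cinner (\<Phi> M h) (\<Phi> \<Lambda> y)) \<Lambda>"
proof -
  note s\<Lambda> = level_subgroup[OF \<Lambda>] and sM = level_subgroup[OF M]
  obtain T where T: "right_transversal G \<Lambda> M T"
    using right_transversal_exists[OF s\<Lambda> sM M\<Lambda>] by blast
  have Tfin: "finite T" by (rule level_transversal_finite'[OF \<Lambda> M T])
  have T\<Lambda>: "T \<subseteq> \<Lambda>" by (rule right_transversalD[OF T])
  have TG: "T \<subseteq> \<Gamma>" using T\<Lambda> level_subset[OF \<Lambda>] by auto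
  have Tc: "\<And>t. t \<in> T \<Longrightarrow> t \<in> carrier G" using TG \<Gamma>_carrier by auto
  have Mc: "\<And>t. t \<in> M \<Longrightarrow> t \<in> carrier G" using level_carrier[OF M] by auto
  have Rfin: "finite R" and RG: "R \<subseteq> \<Gamma>" using R_finite[OF \<Lambda> R] R_subset[OF \<Lambda> R] .
  let ?S = "(\<lambda>(t, s). t \<otimes> s) ` (T \<times> R)"
  have S: "right_transversal G \<Gamma> M ?S"
    by (rule right_transversal_trans[OF subgroup_\<Gamma> s\<Lambda> sM level_subset[OF \<Lambda>] M\<Lambda> R T])
  have ty: "\<pi> t y \<in> level_space \<pi> L ?S" if "t \<in> T" for t
    by (rule level_space_trans[OF Tfin Rfin RG TG that y])
  have "\<Phi> \<Lambda> y = \<Phi> M (\<Sum>t\<in>T. \<pi> t y)"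
    by (rule formal_inclusion[OF \<Lambda> M M\<Lambda> T LS_D[OF \<Lambda> R y]])
  also have "\<dots> = (\<Sum>t\<in>T. \<Phi> M (\<pi> t y))"
    by (rule \<Phi>_sum[OF M]) (rule LS_D[OF M S ty])
  finally have \<Phi>y: "of_nat (index_in G \<Gamma> M) * cinner (\<Phi> M h) (\<Phi> \<Lambda> y)
      = (\<Sum>t\<in>T. of_nat (index_in G \<Gamma> M) * cinner (\<Phi> M h) (\<Phi> M (\<pi> t y)))"
    by (simp add: cinner_sum_right sum_distrib_left)
  note part = inverse_partition[OF s\<Lambda> sM M\<Lambda> T]
  have "((\<lambda>\<gamma>. cinner (\<pi>\<^sub>0 \<gamma> h) y) has_sum (\<Sum>t\<in>T. of_nat (index_in G \<Gamma> M) * cinner (\<Phi> M h) (\<Phi> M (\<pi> t y))))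
      (\<Union>t\<in>T. (\<lambda>b. inv t \<otimes> b) ` M)"
  proof (rule sum_has_sum[OF Tfin])
    fix t assume t: "t \<in> T"
    have inj: "inj_on (\<lambda>b. inv t \<otimes> b) M" using Tc[OF t] Mc by (auto simp: inj_on_def)
    have "((\<lambda>\<gamma>. cinner (\<pi>\<^sub>0 \<gamma> h) (\<pi> t y)) has_sum
        of_nat (index_in G \<Gamma> M) * cinner (\<Phi> M h) (\<Phi> M (\<pi> t y))) M"
      by (rule formal_cinner_sum[OF M S h ty[OF t]])
    then have "((\<lambda>\<gamma>. cinner (\<pi>\<^sub>0 (inv t \<otimes> \<gamma>) h) y) has_sum
        of_nat (index_in G \<Gamma> M) * cinner (\<Phi> M h) (\<Phi> M (\<pi> t y))) M"
      by (rule has_sum_cong[THEN iffD1, rotated])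
        (use Tc[OF t] Mc in \<open>simp add: \<pi>\<^sub>0_mult_left \<pi>_adj\<close>)
    then show "((\<lambda>\<gamma>. cinner (\<pi>\<^sub>0 \<gamma> h) y) has_sum
        of_nat (index_in G \<Gamma> M) * cinner (\<Phi> M h) (\<Phi> M (\<pi> t y))) ((\<lambda>b. inv t \<otimes> b) ` M)"
      unfolding has_sum_reindex[OF inj] o_def .
  qed (rule part(2))
  then show ?thesis unfolding \<Phi>y part(1)[symmetric] .
qed

section \<open>The representation on formal sums and the double coset sum\<close>

lemma U_add: "g \<in> carrier G \<Longrightarrow> U g (x + y) = U g x + U g y"
  and U_scaleC: "g \<in> carrier G \<Longrightarrow> U g (c *\<^sub>C x) = c *\<^sub>C U g x"
  using rep_U by (auto simp: unitary_rep_on_def unitary_on_def clinear_on_def)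

lemma U_sum: "g \<in> carrier G \<Longrightarrow> U g (\<Sum>i\<in>I. f i) = (\<Sum>i\<in>I. U g (f i))"
proof -
  assume g: "g \<in> carrier G"
  have "U g 0 = 0" using U_scaleC[OF g, of 0 0] by simp
  then show ?thesis by (induction I rule: infinite_finite_induct) (simp_all add: U_add[OF g])
qed

text \<open>\<open>U_formal\<close> acts on formal sums over \<Lambda>_{\<sigma>^{-1}}, so
  \<open>x\<close> is first rewritten there by representatives r. Each
  \<open>\<pi> (\<sigma> \<otimes> r) x\<close> then pairs with \<open>y\<close> as a sum over the
  right coset \<Lambda> \<sigma> r, and these cosets make up the double coset.\<close>

lemma hecke_form_has_sum:
  assumes \<Lambda>: "\<Lambda> \<in> level_family G \<Gamma>" and R: "right_transversal G \<Gamma> \<Lambda> R" and \<sigma>: "\<sigma> \<in> carrier G"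
    and x: "x \<in> level_space \<pi> L R" and y: "y \<in> level_space \<pi> L R"
  shows "((\<lambda>\<theta>. cinner (\<pi>\<^sub>0 \<theta> x) y) has_sum
    of_nat (index_in G \<Gamma> (conj_inter G \<Lambda> \<sigma>)) * cinner (U \<sigma> (\<Phi> \<Lambda> x)) (\<Phi> \<Lambda> y)) (double_coset G \<Lambda> \<sigma>)"
proof -
  let ?M = "conj_inter G \<Lambda> \<sigma>"
  let ?M' = "conj_inter G \<Lambda> (inv \<sigma>)"
  have M: "?M \<in> level_family G \<Gamma>" by (rule level_family.conj[OF \<Lambda> \<sigma>])
  have M': "?M' \<in> level_family G \<Gamma>" by (rule level_family.conj[OF \<Lambda> inv_closed[OF \<sigma>]])
  have M\<Lambda>: "?M \<subseteq> \<Lambda>" and M'\<Lambda>: "?M' \<subseteq> \<Lambda>" by (auto simp: conj_inter_def)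
  note s\<Lambda> = level_subgroup[OF \<Lambda>]
  obtain T where T: "right_transversal G \<Lambda> ?M' T"
    using right_transversal_exists[OF s\<Lambda> level_subgroup[OF M'] M'\<Lambda>] by blast
  have Tfin: "finite T" by (rule level_transversal_finite'[OF \<Lambda> M' T])
  have T\<Lambda>: "T \<subseteq> \<Lambda>" by (rule right_transversalD[OF T])
  have Tc: "\<And>t. t \<in> T \<Longrightarrow> t \<in> carrier G" using T\<Lambda> level_carrier[OF \<Lambda>] by auto
  have RG: "R \<subseteq> \<Gamma>" using R_subset[OF \<Lambda> R] .
  have trD: "\<pi> g x \<in> D" if "g \<in> carrier G" for g by (rule level_space_translate_in_D[OF RG that x])
  have sumD: "(\<Sum>r\<in>T. \<pi> r x) \<in> D" by (rule csubspace_sum[OF csubspace_D trD[OF Tc]])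
  have \<pi>sum: "\<pi> \<sigma> (\<Sum>r\<in>T. \<pi> r x) = (\<Sum>r\<in>T. \<pi> (\<sigma> \<otimes> r) x)"
    unfolding \<pi>_sum[OF \<sigma>] using Tc \<sigma> by (intro sum.cong refl) (simp add: \<pi>_mult)
  have sumD': "\<pi> \<sigma> (\<Sum>r\<in>T. \<pi> r x) \<in> D"
    unfolding \<pi>sum by (rule csubspace_sum[OF csubspace_D trD]) (use Tc \<sigma> in auto)
  have "U \<sigma> (\<Phi> \<Lambda> x) = U \<sigma> (\<Phi> ?M' (\<Sum>r\<in>T. \<pi> r x))"
    using formal_inclusion[OF \<Lambda> M' M'\<Lambda> T LS_D[OF \<Lambda> R x]] by simp
  also have "\<dots> = \<Phi> (conj_set G \<sigma> ?M') (\<pi> \<sigma> (\<Sum>r\<in>T. \<pi> r x))"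
    by (rule U_formal[OF \<sigma> \<Lambda> refl sumD sumD'])
  also have "\<dots> = \<Phi> ?M (\<Sum>r\<in>T. \<pi> (\<sigma> \<otimes> r) x)"
    unfolding conj_inter_conj[OF level_carrier[OF \<Lambda>] \<sigma>] \<pi>sum ..
  also have "\<dots> = (\<Sum>r\<in>T. \<Phi> ?M (\<pi> (\<sigma> \<otimes> r) x))"
    by (rule \<Phi>_sum[OF M trD]) (use Tc \<sigma> in auto)
  finally have U: "of_nat (index_in G \<Gamma> ?M) * cinner (U \<sigma> (\<Phi> \<Lambda> x)) (\<Phi> \<Lambda> y)
      = (\<Sum>r\<in>T. of_nat (index_in G \<Gamma> ?M) * cinner (\<Phi> ?M (\<pi> (\<sigma> \<otimes> r) x)) (\<Phi> \<Lambda> y))"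
    by (simp add: cinner_sum_left sum_distrib_left)
  note part = double_coset_partition[OF s\<Lambda> \<sigma> T]
  show ?thesis unfolding U part(1)
  proof (rule sum_has_sum[OF Tfin])
    fix r assume r: "r \<in> T"
    have \<sigma>r: "\<sigma> \<otimes> r \<in> carrier G" using \<sigma> Tc[OF r] by simp
    have inj: "inj_on (\<lambda>b. b \<otimes> (\<sigma> \<otimes> r)) \<Lambda>"
      using \<sigma>r level_carrier[OF \<Lambda>] by (auto simp: inj_on_def subset_iff)
    have "((\<lambda>\<gamma>. cinner (\<pi>\<^sub>0 \<gamma> (\<pi> (\<sigma> \<otimes> r) x)) y) has_sum
        of_nat (index_in G \<Gamma> ?M) * cinner (\<Phi> ?M (\<pi> (\<sigma> \<otimes> r) x)) (\<Phi> \<Lambda> y)) \<Lambda>"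
      by (rule formal_cinner_sum_sublevel[OF \<Lambda> R M M\<Lambda> trD[OF \<sigma>r] y])
    then have "((\<lambda>\<gamma>. cinner (\<pi>\<^sub>0 (\<gamma> \<otimes> (\<sigma> \<otimes> r)) x) y) has_sum
        of_nat (index_in G \<Gamma> ?M) * cinner (\<Phi> ?M (\<pi> (\<sigma> \<otimes> r) x)) (\<Phi> \<Lambda> y)) \<Lambda>"
      by (rule has_sum_cong[THEN iffD1, rotated])
        (use \<sigma>r level_carrier[OF \<Lambda>] in \<open>auto simp: \<pi>\<^sub>0_mult_right simp del: m_closed\<close>)
    then show "((\<lambda>\<theta>. cinner (\<pi>\<^sub>0 \<theta> x) y) has_sum
        of_nat (index_in G \<Gamma> ?M) * cinner (\<Phi> ?M (\<pi> (\<sigma> \<otimes> r) x)) (\<Phi> \<Lambda> y)) (\<Lambda> #> (\<sigma> \<otimes> r))"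
      unfolding r_coset_eq_image has_sum_reindex[OF inj] o_def .
  qed (rule part(2))
qed

context
  fixes \<Lambda> R :: "'g set" and \<sigma> :: 'g
  assumes \<Lambda>: "\<Lambda> \<in> level_family G \<Gamma>" and R: "right_transversal G \<Gamma> \<Lambda> R" and \<sigma>: "\<sigma> \<in> carrier G"
begin

section \<open>Finite coordinates for the Hecke operator and its trace\<close>

lemma \<Phi>_level_vector:
  assumes "h \<in> D"
  shows "\<Phi> \<Lambda> (level_vector \<pi>\<^sub>0 \<pi> L R \<Lambda> h) = \<Phi> \<Lambda> h"
  using formal_ident[OF \<Lambda> R assms] by simp

lemma csubspace_virtual_space: "csubspace (virtual_space G \<Gamma> \<pi>\<^sub>0 \<pi> L \<Phi> \<Lambda>)"
  unfolding csubspace_def virtual_space_def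
proof (intro conjI ballI allI)
  show "0 \<in> \<Phi> \<Lambda> ` D"
    using \<Phi>_scaleC[OF \<Lambda> csubspace_0[OF csubspace_D], of 0] csubspace_0[OF csubspace_D] by (auto intro!: image_eqI[of _ _ 0])
  fix x y assume "x \<in> \<Phi> \<Lambda> ` D" "y \<in> \<Phi> \<Lambda> ` D"
  then obtain a b where "a \<in> D" "b \<in> D" "x = \<Phi> \<Lambda> a" "y = \<Phi> \<Lambda> b" by auto
  then show "x + y \<in> \<Phi> \<Lambda> ` D"
    using \<Phi>_add[OF \<Lambda>] csubspace_add[OF csubspace_D] by (auto intro!: image_eqI[of _ _ "a + b"])
next
  fix c x assume "x \<in> \<Phi> \<Lambda> ` D"
  then obtain a where "a \<in> D" "x = \<Phi> \<Lambda> a" by auto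
  then show "c *\<^sub>C x \<in> \<Phi> \<Lambda> ` D"
    using \<Phi>_scaleC[OF \<Lambda>] csubspace_scaleC[OF csubspace_D] by (auto intro!: image_eqI[of _ _ "c *\<^sub>C a"])
qed

text \<open>\<open>B\<close> is an orthonormal basis of the fixed vectors in \<open>L\<^bsup>\<Lambda>\<^esup>\<close>; the vectors \<open>[\<Gamma> : \<Lambda>]\<^bsup>1/2\<^esup> \<Phi> \<Lambda> e\<close>, \<open>e \<in> B\<close>,
  are then an orthonormal basis of the space of formal sums.\<close>

context
  fixes B :: "'h set"
  assumes fin: "finite B" and on: "orthonormal B"
    and fixed: "\<And>e. e \<in> B \<Longrightarrow> e \<in> level_space \<pi> L R \<and> level_vector \<pi>\<^sub>0 \<pi> L R \<Lambda> e = e"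
    and expand: "\<And>x. x \<in> level_space \<pi> L R \<Longrightarrow> level_vector \<pi>\<^sub>0 \<pi> L R \<Lambda> x = (\<Sum>e\<in>B. cinner x e *\<^sub>C e)"
begin

lemma basis_D: "e \<in> B \<Longrightarrow> e \<in> D"
  using fixed LS_D[OF \<Lambda> R] by blast

text \<open>\<open>\<Phi> \<Lambda>\<close> sees a vector only through its projection onto the fixed
  vectors, and \<open>B\<close> is a basis of those.\<close>

lemma \<Phi>_expand:
  assumes x: "x \<in> level_space \<pi> L R"
  shows "\<Phi> \<Lambda> x = (\<Sum>e\<in>B. cinner x e *\<^sub>C \<Phi> \<Lambda> e)"
proof -
  have "\<Phi> \<Lambda> x = \<Phi> \<Lambda> (\<Sum>e\<in>B. cinner x e *\<^sub>C e)"
    using \<Phi>_level_vector[OF LS_D[OF \<Lambda> R x]] expand[OF x] by simp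
  also have "\<dots> = (\<Sum>e\<in>B. \<Phi> \<Lambda> (cinner x e *\<^sub>C e))"
    by (rule \<Phi>_sum[OF \<Lambda> csubspace_scaleC[OF csubspace_D basis_D]])
  finally show ?thesis by (simp add: \<Phi>_scaleC[OF \<Lambda>] basis_D)
qed

lemma \<Phi>_basis_cinner:
  assumes "e \<in> B" "f \<in> B"
  shows "cinner (\<Phi> \<Lambda> e) (\<Phi> \<Lambda> f) = (if e = f then 1 / of_nat (index_in G \<Gamma> \<Lambda>) else 0)"
  using formal_cinner[OF \<Lambda> R basis_D[OF assms(1)] basis_D[OF assms(2)]] fixed assms
  by (simp add: orthonormal_cinner[OF on])

text \<open>The usual projection formula; the factor [\<Gamma> : \<Lambda>] normalises the vectors
  \<open>\<Phi> \<Lambda> e\<close>, whose squared norm is its reciprocal.\<close>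

lemma orth_proj_virtual_space:
  "orth_proj (virtual_space G \<Gamma> \<pi>\<^sub>0 \<pi> L \<Phi> \<Lambda>) z =
    (\<Sum>e\<in>B. cinner z (\<Phi> \<Lambda> e) *\<^sub>C (of_nat (index_in G \<Gamma> \<Lambda>) *\<^sub>C \<Phi> \<Lambda> e))" (is "_ = ?y")
proof (rule orth_proj_eqI[OF csubspace_virtual_space])
  let ?K = "virtual_space G \<Gamma> \<pi>\<^sub>0 \<pi> L \<Phi> \<Lambda>"
  note cs = csubspace_virtual_space
  have "\<Phi> \<Lambda> e \<in> ?K" if "e \<in> B" for e using basis_D[OF that] by (simp add: virtual_space_def)
  then show "?y \<in> ?K" by (intro csubspace_sum[OF cs] csubspace_scaleC[OF cs])
  have ortho: "cinner (z - ?y) (\<Phi> \<Lambda> f) = 0" if f: "f \<in> B" for f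
  proof -
    have "cinner ?y (\<Phi> \<Lambda> f) = (\<Sum>e\<in>B. if e = f then cinner z (\<Phi> \<Lambda> f) else 0)"
      unfolding cinner_sum_left using index_pos[OF \<Lambda>] f
      by (intro sum.cong refl) (simp add: cinner_scaleC_left \<Phi>_basis_cinner)
    then show ?thesis using fin f by (simp add: cinner_diff_left)
  qed
  fix w assume "w \<in> ?K"
  then obtain h where h: "h \<in> D" "w = \<Phi> \<Lambda> h" by (auto simp: virtual_space_def)
  have "w = (\<Sum>e\<in>B. cinner (level_vector \<pi>\<^sub>0 \<pi> L R \<Lambda> h) e *\<^sub>C \<Phi> \<Lambda> e)"
    using \<Phi>_expand[OF level_vector_in[OF \<Lambda> R h(1)]] \<Phi>_level_vector[OF h(1)] h(2) by simp
  then show "cinner (z - ?y) w = 0" by (simp add: cinner_sum_right cinner_scaleC_right ortho)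
qed

lemma hecke_operator_eq:
  "hecke_operator G \<Gamma> \<pi>\<^sub>0 \<pi> L \<Phi> U \<Lambda> \<sigma> z = (\<Sum>e\<in>B. cinner z (\<Phi> \<Lambda> e) *\<^sub>C (\<Sum>f\<in>B.
    (of_nat (index_in G \<Gamma> \<Lambda>) * of_nat (index_in G \<Gamma> (conj_inter G \<Lambda> \<sigma>)) * cinner (U \<sigma> (\<Phi> \<Lambda> e)) (\<Phi> \<Lambda> f)) *\<^sub>C \<Phi> \<Lambda> f))"
proof -
  \<comment> \<open>Of the two factors [\<Gamma> : \<Lambda>] coming from the projections, one
    combines with the Hecke normalisation into the index of \<Lambda>_\<sigma> in \<Gamma>.\<close>
  have idx: "index_in G \<Gamma> (conj_inter G \<Lambda> \<sigma>) = index_in G \<Gamma> \<Lambda> * index_in G \<Lambda> (conj_inter G \<Lambda> \<sigma>)"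
    by (rule index_mult[OF \<Lambda> level_family.conj[OF \<Lambda> \<sigma>]]) (auto simp: conj_inter_def)
  have "hecke_operator G \<Gamma> \<pi>\<^sub>0 \<pi> L \<Phi> U \<Lambda> \<sigma> z = (\<Sum>f\<in>B. \<Sum>e\<in>B. (cinner z (\<Phi> \<Lambda> e) *
      (of_nat (index_in G \<Gamma> \<Lambda>) * of_nat (index_in G \<Gamma> (conj_inter G \<Lambda> \<sigma>)) * cinner (U \<sigma> (\<Phi> \<Lambda> e)) (\<Phi> \<Lambda> f))) *\<^sub>C \<Phi> \<Lambda> f)"
  proof -
    have sl: "(\<Sum>i\<in>I. c i) *\<^sub>C (x::'k) = (\<Sum>i\<in>I. c i *\<^sub>C x)" for c :: "'h \<Rightarrow> complex" and I x
      by (induction I rule: infinite_finite_induct) (simp_all add: scaleC_add_left)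
    show ?thesis
      unfolding hecke_operator_def o_def orth_proj_virtual_space U_sum[OF \<sigma>] U_scaleC[OF \<sigma>]
        cinner_sum_left cinner_scaleC_left scaleC_sum_right scaleC_scaleC sl sum_distrib_left sum_distrib_right
      by (intro sum.cong refl arg_cong[where f = "\<lambda>c. c *\<^sub>C _"]) (simp add: idx mult_ac)
  qed
  also have "\<dots> = (\<Sum>e\<in>B. \<Sum>f\<in>B. (cinner z (\<Phi> \<Lambda> e) *
      (of_nat (index_in G \<Gamma> \<Lambda>) * of_nat (index_in G \<Gamma> (conj_inter G \<Lambda> \<sigma>)) * cinner (U \<sigma> (\<Phi> \<Lambda> e)) (\<Phi> \<Lambda> f))) *\<^sub>C \<Phi> \<Lambda> f)"
    by (rule sum.swap)
  finally show ?thesis by (simp only: scaleC_sum_right scaleC_scaleC)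
qed

text \<open>A factorisation into two Hilbert--Schmidt operators is required; the projection on the
  right can be repeated, and it has finite rank as well.\<close>

lemma trace_class_hecke_operator: "trace_class (hecke_operator G \<Gamma> \<pi>\<^sub>0 \<pi> L \<Phi> U \<Lambda> \<sigma>)"
proof -
  let ?T = "hecke_operator G \<Gamma> \<pi>\<^sub>0 \<pi> L \<Phi> U \<Lambda> \<sigma>"
  let ?P = "orth_proj (virtual_space G \<Gamma> \<pi>\<^sub>0 \<pi> L \<Phi> \<Lambda>)"
  have "hilbert_schmidt ?T" unfolding hecke_operator_eq[abs_def] by (rule hilbert_schmidt_finite_rank)
  moreover have "hilbert_schmidt ?P"
    unfolding orth_proj_virtual_space[abs_def] by (rule hilbert_schmidt_finite_rank)
  moreover have "cinner (?P z) (\<Phi> \<Lambda> f) = cinner z (\<Phi> \<Lambda> f)" if f: "f \<in> B" for z f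
  proof -
    have "cinner (?P z) (\<Phi> \<Lambda> f) = (\<Sum>e\<in>B. if e = f then cinner z (\<Phi> \<Lambda> f) else 0)"
      unfolding orth_proj_virtual_space cinner_sum_left using index_pos[OF \<Lambda>] f
      by (intro sum.cong refl) (simp add: cinner_scaleC_left \<Phi>_basis_cinner)
    then show ?thesis using fin f by simp
  qed
  then have "?T = ?T \<circ> ?P" by (simp add: fun_eq_iff hecke_operator_eq)
  ultimately show ?thesis unfolding trace_class_def by blast
qed

text \<open>This is the value of the double coset sum in \<open>hecke_form_has_sum\<close>, now as a
  form that is evaluated at basis vectors.\<close>

definition hecke_coeff :: "'h \<Rightarrow> 'h \<Rightarrow> complex"
  where "hecke_coeff x y =
    of_nat (index_in G \<Gamma> (conj_inter G \<Lambda> \<sigma>)) * cinner (U \<sigma> (\<Phi> \<Lambda> x)) (\<Phi> \<Lambda> y)"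

lemma ctrace_hecke_operator:
  "ctrace (hecke_operator G \<Gamma> \<pi>\<^sub>0 \<pi> L \<Phi> U \<Lambda> \<sigma>) = (\<Sum>e\<in>B. hecke_coeff e e)"
proof -
  let ?n = "of_nat (index_in G \<Gamma> \<Lambda>) :: complex"
  have n: "?n \<noteq> 0" using index_pos[OF \<Lambda>] by simp
  have eq: "cinner (hecke_operator G \<Gamma> \<pi>\<^sub>0 \<pi> L \<Phi> U \<Lambda> \<sigma> z) z =
      (\<Sum>e\<in>B. \<Sum>f\<in>B. (?n * hecke_coeff e f) * cinner z (\<Phi> \<Lambda> e) * cinner (\<Phi> \<Lambda> f) z)" for z
    unfolding hecke_operator_eq cinner_sum_left cinner_scaleC_left sum_distrib_left hecke_coeff_def
    by (intro sum.cong refl) (simp add: mult_ac)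
  have "((\<lambda>z. cinner (hecke_operator G \<Gamma> \<pi>\<^sub>0 \<pi> L \<Phi> U \<Lambda> \<sigma> z) z) has_sum
      (\<Sum>e\<in>B. \<Sum>f\<in>B. (?n * hecke_coeff e f) * cinner (\<Phi> \<Lambda> f) (\<Phi> \<Lambda> e))) some_onb"
    unfolding eq by (rule finite_rank_trace)
  then have "ctrace (hecke_operator G \<Gamma> \<pi>\<^sub>0 \<pi> L \<Phi> U \<Lambda> \<sigma>) =
      (\<Sum>e\<in>B. \<Sum>f\<in>B. (?n * hecke_coeff e f) * cinner (\<Phi> \<Lambda> f) (\<Phi> \<Lambda> e))"
    unfolding ctrace_def by (rule infsumI)
  \<comment> \<open>The remaining factor [\<Gamma> : \<Lambda>] cancels against the squared norm of
    \<open>\<Phi> \<Lambda> e\<close>.\<close>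
  also have "\<dots> = (\<Sum>e\<in>B. \<Sum>f\<in>B. if f = e then hecke_coeff e e else 0)"
    using n by (intro sum.cong refl) (simp add: \<Phi>_basis_cinner)
  also have "\<dots> = (\<Sum>e\<in>B. hecke_coeff e e)" using fin by simp
  finally show ?thesis .
qed

text \<open>The form factors through the fixed vectors, so on the whole level space, which may be
  infinite-dimensional, it is given by one finite matrix.\<close>

lemma hecke_coeff_expand:
  assumes x: "x \<in> level_space \<pi> L R" and y: "y \<in> level_space \<pi> L R"
  shows "hecke_coeff x y = (\<Sum>e\<in>B. \<Sum>f\<in>B. hecke_coeff e f * cinner x e * cinner f y)"
proof -
  have "cnj (cinner y f) = cinner f y" for f using cinner_commute[of f y] by simp
  then show ?thesis
    unfolding hecke_coeff_def \<Phi>_expand[OF x] \<Phi>_expand[OF y] U_sum[OF \<sigma>] U_scaleC[OF \<sigma>]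
      cinner_sum_left cinner_sum_right cinner_scaleC_left cinner_scaleC_right sum_distrib_left
    by (subst sum.swap) (intro sum.cong refl, simp add: mult_ac)
qed

text \<open>Condition (vi) is applied to each of the finitely many right cosets \<open>Y t\<close>
  of s^{-1} \<Lambda> s that make up the index set. The sum of the resulting operators has the
  diagonal entries of a finite rank form, whose trace Parseval evaluates.\<close>

lemma diagonal_block_trace:
  assumes s: "s \<in> R"
  shows "(\<lambda>\<theta>. cmod (ctrace (P \<circ> \<pi>\<^sub>0 \<theta> \<circ> P))) summable_on conj_set G (inv s) (double_coset G \<Lambda> \<sigma>)"
    and "(\<Sum>\<^sub>\<infinity>\<theta>\<in>conj_set G (inv s) (double_coset G \<Lambda> \<sigma>). ctrace (P \<circ> \<pi>\<^sub>0 \<theta> \<circ> P)) =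
      (\<Sum>e\<in>B. \<Sum>f\<in>B. hecke_coeff e f * cinner (P (\<pi> (inv s) f)) (P (\<pi> (inv s) e)))"
proof -
  let ?M = "conj_inter G \<Lambda> (inv \<sigma>)"
  let ?X = "conj_set G (inv s) (double_coset G \<Lambda> \<sigma>)"
  have Rfin: "finite R" and RG: "R \<subseteq> \<Gamma>" using R_finite[OF \<Lambda> R] R_subset[OF \<Lambda> R] .
  have s\<Gamma>: "s \<in> \<Gamma>" and sc: "s \<in> carrier G" using s RG \<Gamma>_carrier by auto
  have s'\<Gamma>: "inv s \<in> \<Gamma>" by (rule subgroup.m_inv_closed[OF subgroup_\<Gamma> s\<Gamma>])
  note s\<Lambda> = level_subgroup[OF \<Lambda>]
  have M: "?M \<in> level_family G \<Gamma>" by (rule level_family.conj[OF \<Lambda> inv_closed[OF \<sigma>]])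
  have M\<Lambda>: "?M \<subseteq> \<Lambda>" by (auto simp: conj_inter_def)
  have \<Lambda>c: "\<And>\<gamma>. \<gamma> \<in> \<Lambda> \<Longrightarrow> \<gamma> \<in> carrier G" using level_carrier[OF \<Lambda>] by auto
  obtain T where T: "right_transversal G \<Lambda> ?M T"
    using right_transversal_exists[OF s\<Lambda> level_subgroup[OF M] M\<Lambda>] by blast
  have Tfin: "finite T" by (rule level_transversal_finite'[OF \<Lambda> M T])
  have Tc: "\<And>t. t \<in> T \<Longrightarrow> t \<in> carrier G" using right_transversalD(1)[OF T] \<Lambda>c by auto
  note dc = double_coset_partition[OF s\<Lambda> \<sigma> T]
  let ?c = "\<lambda>x. inv s \<otimes> x \<otimes> inv (inv s)"
  define Y where "Y t = ?c ` (\<Lambda> #> (\<sigma> \<otimes> t))" for t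
  have dcc: "\<theta> \<in> carrier G" if "\<theta> \<in> double_coset G \<Lambda> \<sigma>" for \<theta>
    using that Tc \<sigma> \<Lambda>c unfolding dc(1) r_coset_eq_image by auto
  have injc: "inj_on ?c (double_coset G \<Lambda> \<sigma>)"
    using dcc sc by (auto simp: inj_on_def)
  have X: "?X = (\<Union>t\<in>T. Y t)" unfolding conj_set_eq dc(1) Y_def by blast
  have Ydisj: "Y t \<inter> Y t' = {}" if "t \<in> T" "t' \<in> T" "t \<noteq> t'" for t t'
  proof -
    have "Y t \<inter> Y t' = ?c ` ((\<Lambda> #> (\<sigma> \<otimes> t)) \<inter> (\<Lambda> #> (\<sigma> \<otimes> t')))"
      unfolding Y_def using that dc(1) by (intro inj_on_image_Int[OF injc, symmetric]) auto
    then show ?thesis using dc(2)[OF that] by simp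
  qed
  \<comment> \<open>s^{-1} \<Lambda> \<sigma> t s is the right coset of s^{-1} \<Lambda> s through
    s^{-1} \<sigma> t s.\<close>
  have Ycoset: "Y t = conj_set G (inv s) \<Lambda> #> (inv s \<otimes> (\<sigma> \<otimes> t) \<otimes> s)" if t: "t \<in> T" for t
  proof -
    have k: "\<sigma> \<otimes> t \<in> carrier G" using \<sigma> Tc[OF t] by simp
    have "conj_set G (inv s) \<Lambda> #> (inv s \<otimes> (\<sigma> \<otimes> t) \<otimes> s) = (\<lambda>\<gamma>. inv s \<otimes> \<gamma> \<otimes> (\<sigma> \<otimes> t) \<otimes> s) ` \<Lambda>"
      using bij_betw_conj_coset[OF \<Lambda> sc sc k] by (simp add: bij_betw_def)
    also have "\<dots> = Y t"
      unfolding Y_def r_coset_eq_image image_image using sc k \<Lambda>c by (intro image_cong refl) (simp add: m_assoc)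
    finally show ?thesis ..
  qed
  have "\<exists>S. hs_has_sum (\<lambda>\<theta>. P \<circ> \<pi>\<^sub>0 \<theta> \<circ> P) (Y t) S
        \<and> (\<lambda>\<theta>. cmod (ctrace (P \<circ> \<pi>\<^sub>0 \<theta> \<circ> P))) summable_on (Y t)
        \<and> trace_class S \<and> ctrace S = (\<Sum>\<^sub>\<infinity>\<theta>\<in>Y t. ctrace (P \<circ> \<pi>\<^sub>0 \<theta> \<circ> P))" if t: "t \<in> T" for t
    unfolding Ycoset[OF t] by (rule coset_sums[OF _ level_conj_set[OF \<Lambda> s'\<Gamma>]]) (use sc \<sigma> Tc[OF t] in simp)
  then obtain S where S: "\<And>t. t \<in> T \<Longrightarrow> hs_has_sum (\<lambda>\<theta>. P \<circ> \<pi>\<^sub>0 \<theta> \<circ> P) (Y t) (S t)"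
      "\<And>t. t \<in> T \<Longrightarrow> (\<lambda>\<theta>. cmod (ctrace (P \<circ> \<pi>\<^sub>0 \<theta> \<circ> P))) summable_on (Y t)"
      "\<And>t. t \<in> T \<Longrightarrow> trace_class (S t)"
      "\<And>t. t \<in> T \<Longrightarrow> ctrace (S t) = (\<Sum>\<^sub>\<infinity>\<theta>\<in>Y t. ctrace (P \<circ> \<pi>\<^sub>0 \<theta> \<circ> P))" by metis
  show "(\<lambda>\<theta>. cmod (ctrace (P \<circ> \<pi>\<^sub>0 \<theta> \<circ> P))) summable_on ?X"
    unfolding X by (rule summable_on_finite_union_disjoint[OF Tfin S(2) Ydisj])
  have "(\<Sum>\<^sub>\<infinity>\<theta>\<in>?X. ctrace (P \<circ> \<pi>\<^sub>0 \<theta> \<circ> P)) = (\<Sum>t\<in>T. ctrace (S t))"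
    unfolding X using sum_infsum[OF Tfin abs_summable_summable[OF S(2)] Ydisj] S(4) by simp
  also have "\<dots> = (\<Sum>e\<in>B. \<Sum>f\<in>B. hecke_coeff e f * cinner (P (\<pi> (inv s) f)) (P (\<pi> (inv s) e)))"
  proof (rule has_sum_unique)
    show "((\<lambda>z. \<Sum>t\<in>T. cinner (S t z) z) has_sum (\<Sum>t\<in>T. ctrace (S t))) some_onb"
      by (rule has_sum_finite_sum[OF ctrace_has_sum[OF S(3)]])
    \<comment> \<open>For fixed \<open>z\<close> the same family of matrix coefficients is summed in
      two ways: through the operators \<open>S t\<close>, and through the double coset formula for
      the vector \<open>\<pi> s (P z)\<close>.\<close>
    have "(\<Sum>t\<in>T. cinner (S t z) z) = hecke_coeff (\<pi> s (P z)) (\<pi> s (P z))" for z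
    proof (rule has_sum_unique)
      have "((\<lambda>\<theta>. cinner (P (\<pi>\<^sub>0 \<theta> (P z))) z) has_sum (\<Sum>t\<in>T. cinner (S t z) z)) (\<Union>t\<in>T. Y t)"
      proof (rule sum_has_sum[OF Tfin _ Ydisj])
        fix t assume "t \<in> T"
        from has_sum_cinner_left[OF hs_has_sum_pointwise[OF S(1)[OF this], of z], of z]
        show "((\<lambda>\<theta>. cinner (P (\<pi>\<^sub>0 \<theta> (P z))) z) has_sum cinner (S t z) z) (Y t)" by simp
      qed
      then have "((\<lambda>\<theta>. cinner (P (\<pi>\<^sub>0 (?c \<theta>) (P z))) z) has_sum (\<Sum>t\<in>T. cinner (S t z) z)) (double_coset G \<Lambda> \<sigma>)"
        unfolding X[symmetric] conj_set_eq has_sum_reindex[OF injc] o_def .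
      then show "((\<lambda>\<theta>. cinner (\<pi>\<^sub>0 \<theta> (\<pi> s (P z))) (\<pi> s (P z))) has_sum (\<Sum>t\<in>T. cinner (S t z) z)) (double_coset G \<Lambda> \<sigma>)"
        by (rule has_sum_cong[THEN iffD1, rotated])
          (use dcc sc in \<open>simp add: orth_proj_selfadj[OF closed_L] \<pi>\<^sub>0_apply proj_H\<^sub>0_\<pi> \<pi>_mult \<pi>_adj\<close>)
      have z: "\<pi> s (P z) \<in> level_space \<pi> L R"
        by (rule translate_in_level_space[OF Rfin s orth_proj_in[OF closed_L] RG])
      show "((\<lambda>\<theta>. cinner (\<pi>\<^sub>0 \<theta> (\<pi> s (P z))) (\<pi> s (P z))) has_sum hecke_coeff (\<pi> s (P z)) (\<pi> s (P z))) (double_coset G \<Lambda> \<sigma>)"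
        unfolding hecke_coeff_def by (rule hecke_form_has_sum[OF \<Lambda> R \<sigma> z z])
    qed
    also have "hecke_coeff (\<pi> s (P z)) (\<pi> s (P z)) = (\<Sum>e\<in>B. \<Sum>f\<in>B. hecke_coeff e f *
        cinner z (P (\<pi> (inv s) e)) * cinner (P (\<pi> (inv s) f)) z)" for z
    proof -
      have zL: "\<pi> s (P z) \<in> level_space \<pi> L R"
        by (rule translate_in_level_space[OF Rfin s orth_proj_in[OF closed_L] RG])
      have 1: "cinner (\<pi> s (P z)) e = cinner z (P (\<pi> (inv s) e))" for e
        using sc by (simp add: \<pi>_adj orth_proj_selfadj[OF closed_L])
      then have 2: "cinner f (\<pi> s (P z)) = cinner (P (\<pi> (inv s) f)) z" for f
        using cinner_commute[of f "\<pi> s (P z)"] cinner_commute[of "P (\<pi> (inv s) f)" z] by simp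
      show ?thesis unfolding hecke_coeff_expand[OF zL zL] 1 2 ..
    qed
    finally show "((\<lambda>z. \<Sum>t\<in>T. cinner (S t z) z) has_sum
        (\<Sum>e\<in>B. \<Sum>f\<in>B. hecke_coeff e f * cinner (P (\<pi> (inv s) f)) (P (\<pi> (inv s) e)))) some_onb"
      by (simp only: finite_rank_trace)
  qed
  finally show "(\<Sum>\<^sub>\<infinity>\<theta>\<in>?X. ctrace (P \<circ> \<pi>\<^sub>0 \<theta> \<circ> P)) =
      (\<Sum>e\<in>B. \<Sum>f\<in>B. hecke_coeff e f * cinner (P (\<pi> (inv s) f)) (P (\<pi> (inv s) e)))" .
qed

text \<open>Summed over \<open>s\<close>, the block inner products give the full inner product of
  \<open>f\<close> and \<open>e\<close>, because basis vectors lie in the level space.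
  Orthonormality leaves the diagonal.\<close>

lemma sum_diagonal_blocks:
  "(\<Sum>s\<in>R. \<Sum>e\<in>B. \<Sum>f\<in>B. hecke_coeff e f * cinner (P (\<pi> (inv s) f)) (P (\<pi> (inv s) e))) =
    (\<Sum>e\<in>B. hecke_coeff e e)"
proof -
  have Rfin: "finite R" and RG: "R \<subseteq> \<Gamma>" using R_finite[OF \<Lambda> R] R_subset[OF \<Lambda> R] .
  have Rc: "\<And>s. s \<in> R \<Longrightarrow> s \<in> carrier G" using RG \<Gamma>_carrier by auto
  have blocks: "(\<Sum>s\<in>R. cinner (P (\<pi> (inv s) f)) (P (\<pi> (inv s) e))) = (if e = f then 1 else 0)"
    if "e \<in> B" "f \<in> B" for e f
  proof -
    have "(\<Sum>s\<in>R. cinner (P (\<pi> (inv s) f)) (P (\<pi> (inv s) e))) = (\<Sum>s\<in>R. cinner (\<pi> s (P (\<pi> (inv s) f))) e)"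
      using Rc by (intro sum.cong refl)
        (simp add: \<pi>_adj orth_proj_cinner_right[OF closed_L orth_proj_in[OF closed_L]])
    also have "\<dots> = cinner (level_proj R f) e" by (simp add: level_proj_def cinner_sum_left)
    also have "\<dots> = cinner f e" using level_proj_id[OF Rfin RG] fixed[OF that(2)] by simp
    finally show ?thesis using that by (auto simp: orthonormal_cinner[OF on])
  qed
  have "(\<Sum>s\<in>R. \<Sum>e\<in>B. \<Sum>f\<in>B. hecke_coeff e f * cinner (P (\<pi> (inv s) f)) (P (\<pi> (inv s) e))) =
      (\<Sum>e\<in>B. \<Sum>f\<in>B. \<Sum>s\<in>R. hecke_coeff e f * cinner (P (\<pi> (inv s) f)) (P (\<pi> (inv s) e)))"
    by (subst sum.swap, rule sum.cong[OF refl], rule sum.swap)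
  also have "\<dots> = (\<Sum>e\<in>B. \<Sum>f\<in>B. if e = f then hecke_coeff e e else 0)"
    unfolding sum_distrib_left[symmetric] by (intro sum.cong refl) (simp add: blocks)
  also have "\<dots> = (\<Sum>e\<in>B. hecke_coeff e e)" using fin by simp
  finally show ?thesis .
qed

end

lemma hecke_operator_trace:
  "trace_class (hecke_operator G \<Gamma> \<pi>\<^sub>0 \<pi> L \<Phi> U \<Lambda> \<sigma>)"
  "s \<in> R \<Longrightarrow> (\<lambda>\<theta>. cmod (ctrace (P \<circ> \<pi>\<^sub>0 \<theta> \<circ> P))) summable_on conj_set G (inv s) (double_coset G \<Lambda> \<sigma>)"
  "ctrace (hecke_operator G \<Gamma> \<pi>\<^sub>0 \<pi> L \<Phi> U \<Lambda> \<sigma>) =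
    (\<Sum>s\<in>R. \<Sum>\<^sub>\<infinity>\<theta>\<in>conj_set G (inv s) (double_coset G \<Lambda> \<sigma>). ctrace (P \<circ> \<pi>\<^sub>0 \<theta> \<circ> P))"
proof -
  obtain B where B: "finite B" "orthonormal B"
      "\<And>e. e \<in> B \<Longrightarrow> e \<in> level_space \<pi> L R \<and> level_vector \<pi>\<^sub>0 \<pi> L R \<Lambda> e = e"
      "\<And>x. x \<in> level_space \<pi> L R \<Longrightarrow> level_vector \<pi>\<^sub>0 \<pi> L R \<Lambda> x = (\<Sum>e\<in>B. cinner x e *\<^sub>C e)"
    using fixed_vectors_basis[OF \<Lambda> R level_vector_idem[OF \<Lambda> R LS_D[OF \<Lambda> R]]] by blast
  show "trace_class (hecke_operator G \<Gamma> \<pi>\<^sub>0 \<pi> L \<Phi> U \<Lambda> \<sigma>)"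
    by (rule trace_class_hecke_operator[OF B])
  show "s \<in> R \<Longrightarrow> (\<lambda>\<theta>. cmod (ctrace (P \<circ> \<pi>\<^sub>0 \<theta> \<circ> P))) summable_on conj_set G (inv s) (double_coset G \<Lambda> \<sigma>)"
    by (rule diagonal_block_trace(1)[OF B])
  have "ctrace (hecke_operator G \<Gamma> \<pi>\<^sub>0 \<pi> L \<Phi> U \<Lambda> \<sigma>) = (\<Sum>e\<in>B. hecke_coeff e e)"
    by (rule ctrace_hecke_operator[OF B])
  also have "\<dots> = (\<Sum>s\<in>R. \<Sum>e\<in>B. \<Sum>f\<in>B.
      hecke_coeff e f * cinner (P (\<pi> (inv s) f)) (P (\<pi> (inv s) e)))"
    by (rule sum_diagonal_blocks[OF B, symmetric])
  also have "\<dots> = (\<Sum>s\<in>R. \<Sum>\<^sub>\<infinity>\<theta>\<in>conj_set G (inv s) (double_coset G \<Lambda> \<sigma>). ctrace (P \<circ> \<pi>\<^sub>0 \<theta> \<circ> P))"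
    by (rule sum.cong[OF refl], rule diagonal_block_trace(2)[OF B, symmetric])
  finally show "ctrace (hecke_operator G \<Gamma> \<pi>\<^sub>0 \<pi> L \<Phi> U \<Lambda> \<sigma>) =
      (\<Sum>s\<in>R. \<Sum>\<^sub>\<infinity>\<theta>\<in>conj_set G (inv s) (double_coset G \<Lambda> \<sigma>). ctrace (P \<circ> \<pi>\<^sub>0 \<theta> \<circ> P))" .
qed

end

end

text \<open>The first two conjuncts guarantee that neither the trace on the left nor the sums over
  theta take the default value of a divergent sum. Conjugating the double coset by the inverse of
  \<open>s\<close> gives the set s^{-1} \<Gamma>_0 \<sigma> \<Gamma>_0 s.\<close>

theorem corollary3:
  fixes G :: "('g, 'b) monoid_scheme" and \<Gamma> \<Gamma>\<^sub>0 R :: "'g set" and \<sigma> :: 'g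
    and \<pi>\<^sub>0 \<pi> :: "'g \<Rightarrow> 'h::chilbert_space \<Rightarrow> 'h" and H\<^sub>0 L :: "'h set"
    and \<Phi> :: "'g set \<Rightarrow> 'h \<Rightarrow> 'k::chilbert_space" and U :: "'g \<Rightarrow> 'k \<Rightarrow> 'k"
  assumes "virtual_representation G \<Gamma> \<pi>\<^sub>0 H\<^sub>0 \<pi> L \<Phi> U"
    and "\<sigma> \<in> carrier G"
    and "\<Gamma>\<^sub>0 \<in> level_family G \<Gamma>"
    and "right_transversal G \<Gamma> \<Gamma>\<^sub>0 R"
  shows "trace_class (hecke_operator G \<Gamma> \<pi>\<^sub>0 \<pi> L \<Phi> U \<Gamma>\<^sub>0 \<sigma>)
    \<and> (\<forall>s\<in>R. (\<lambda>\<theta>. cmod (ctrace (orth_proj L \<circ> \<pi>\<^sub>0 \<theta> \<circ> orth_proj L))) summable_on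
          conj_set G (inv\<^bsub>G\<^esub> s) (double_coset G \<Gamma>\<^sub>0 \<sigma>))
    \<and> ctrace (hecke_operator G \<Gamma> \<pi>\<^sub>0 \<pi> L \<Phi> U \<Gamma>\<^sub>0 \<sigma>) =
        (\<Sum>s\<in>R. \<Sum>\<^sub>\<infinity>\<theta>\<in>conj_set G (inv\<^bsub>G\<^esub> s) (double_coset G \<Gamma>\<^sub>0 \<sigma>).
          ctrace (orth_proj L \<circ> \<pi>\<^sub>0 \<theta> \<circ> orth_proj L))"
proof -
  interpret virtual_representation G \<Gamma> \<pi>\<^sub>0 H\<^sub>0 \<pi> L \<Phi> U by (rule assms(1))
  show ?thesis
    using hecke_operator_trace(1,3)[OF assms(3,4,2)] hecke_operator_trace(2)[OF assms(3,4,2)] by blast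
qed

end
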